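(* Let $d>1$, $\gamma\in\mathbb{R}\setminus\{0\}$ and $b\in\mathbb{R}$ with $\gamma+b>0$, and let $Y$ be the relative system of the interacting branching diffusion $Z$ on $\mathbb{R}^d$ with drift parameter $b$ and interaction parameter $\gamma$. Let $B\subset\mathbb{R}^d$ be a Borel set. Then, almost surely, $$\lim_{m\to\infty}\left(2^{-m}\sum_{i=1}^{2^m}1_B(Y_m^i)-P(Y_m^i\in B)\right)=0,$$ where $m$ runs through the positive integers and $P(Y_m^i\in B)$ does not depend on $i\in\{1,\dots,2^m\}$.
   Context: Model. Fix $d\ge1$, $b\in\mathbb{R}$ and $\gamma\neq 0$. The process $Z$ starts at time $0$ with one particle at the origin of $\mathbb{R}^d$. For each $m=0,1,2,\dots$, during the time interval $[m,m+1)$ there are exactly $2^m$ particles, with positions $Z_t^i$, $1\le i\le 2^m$; at each integer time $m\ge 1$ every particle is replaced by exactly two offspring, located at the parent's position (labels are arbitrary but independent of the spatial motion). On $[m,m+1)$ the positions satisfy $$\mathrm{d}Z_t^i = \mathrm{d}W_t^{i,m} - bZ_t^i\,\mathrm{d}t + \frac{1}{2^m}\sum_{j=1}^{2^m}\gamma\,(Z_t^j-Z_t^i)\,\mathrm{d}t,\qquad 1\le i\le 2^m,$$ where $\{W^{i,m}\}_{1\le i\le 2^m}$ are independent standard $d$-dimensional Brownian motions on $[m,m+1)$, also independent of the past up to time $m$. Center of mass: for $t\in[m,m+1)$, $\overline{Z_t}:=2^{-m}\sum_{i=1}^{2^m}Z_t^i$. Relative system: $Y_t^i:=Z_t^i-\overline{Z_t}$,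 $1\le i\le 2^{\lfloor t\rfloor}$. By symmetry, for fixed $t$ all $Y_t^i$ have the same law. *)

theory Defs
  imports "HOL-Probability.Probability"
begin

definition generated_events :: "'w measure \<Rightarrow> 'b measure \<Rightarrow> ('w \<Rightarrow> 'b) set \<Rightarrow> 'w set set" where
  "generated_events M N F = sigma_sets (space M) {X -` A \<inter> space M | X A. X \<in> F \<and> A \<in> sets N}"

text \<open>Standard Brownian motion on the half-open interval from \<open>s\<close> to \<open>u\<close>, started from the
  origin at time \<open>s\<close>; the increment over a time span \<open>h\<close> has law \<open>N(0, h I)\<close>, and
  \<open>normal_density\<close> takes the standard deviation as its second argument.\<close>

definition (in prob_space) standard_brownian_motion ::
    "real \<Rightarrow> real \<Rightarrow> (real \<Rightarrow> 'a \<Rightarrow> real ^ 'd) \<Rightarrow> bool" where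
  "standard_brownian_motion s u W \<longleftrightarrow>
     (\<forall>t\<in>{s..<u}. random_variable borel (W t)) \<and>
     (AE \<omega> in M. W s \<omega> = 0) \<and>
     (AE \<omega> in M. continuous_on {s..<u} (\<lambda>t. W t \<omega>)) \<and>
     (\<forall>t\<in>{s..<u}. \<forall>t'\<in>{t<..<u}.
        distributed M lborel (\<lambda>\<omega>. W t' \<omega> - W t \<omega>)
          (\<lambda>x. ennreal (\<Prod>k\<in>UNIV. normal_density 0 (sqrt (t' - t)) (x $ k)))) \<and>
     (\<forall>n (\<tau> :: nat \<Rightarrow> real). (\<forall>k\<le>n. \<tau> k \<in> {s..<u}) \<longrightarrow> (\<forall>k<n. \<tau> k < \<tau> (Suc k)) \<longrightarrow>
        indep_vars (\<lambda>_. borel) (\<lambda>k \<omega>. W (\<tau> (Suc k)) \<omega> - W (\<tau> k) \<omega>) {..<n})"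

definition particles :: "real \<Rightarrow> nat set" where
  "particles t = {1..2 ^ nat \<lfloor>t\<rfloor>}"

definition center_of_mass :: "(nat \<Rightarrow> real \<Rightarrow> 'w \<Rightarrow> real ^ 'd) \<Rightarrow> real \<Rightarrow> 'w \<Rightarrow> real ^ 'd" where
  "center_of_mass Z t \<omega> = (1 / 2 ^ nat \<lfloor>t\<rfloor>) *\<^sub>R (\<Sum>i\<in>particles t. Z i t \<omega>)"

definition relative_system ::
    "(nat \<Rightarrow> real \<Rightarrow> 'w \<Rightarrow> real ^ 'd) \<Rightarrow> nat \<Rightarrow> real \<Rightarrow> 'w \<Rightarrow> real ^ 'd" where
  "relative_system Z i t \<omega> = Z i t \<omega> - center_of_mass Z t \<omega>"

text \<open>\<open>Z i t\<close> is the position of particle \<open>i\<close> at time \<open>t\<close>, meaningful only for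
  \<open>i \<in> particles t\<close>, and \<open>W m i\<close> drives particle \<open>i\<close> during the interval from \<open>m\<close> to \<open>m + 1\<close>.
  The labelling is encoded by \<open>parent m i \<omega>\<close>, the label in \<open>{1..2 ^ m}\<close> of the parent of the
  particle that is born at time \<open>m + 1\<close> with label \<open>i\<close>. It may be random; labels are
  independent of the spatial motion in the sense that the parent maps are independent of all
  driving Brownian motions together.

  The stochastic differential equation has additive noise, so it is the pathwise integral
  equation stated in \<open>sde\<close>. Since the time intervals are half-open, the
  position of a parent at its branching time is its left limit there.\<close>

locale interacting_branching_diffusion = prob_space M for M :: "'w measure" +
  fixes b \<gamma> :: real
    and parent :: "nat \<Rightarrow> nat \<Rightarrow> 'w \<Rightarrow> nat"
    and W :: "nat \<Rightarrow> nat \<Rightarrow> real \<Rightarrow> 'w \<Rightarrow> real ^ 'd"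
    and Z :: "nat \<Rightarrow> real \<Rightarrow> 'w \<Rightarrow> real ^ 'd"
  assumes parent_measurable:
      "\<And>m i. i \<in> {1..2 ^ Suc m} \<Longrightarrow> random_variable (count_space UNIV) (parent m i)"
    and parent_in:
      "\<And>m i \<omega>. i \<in> {1..2 ^ Suc m} \<Longrightarrow> \<omega> \<in> space M \<Longrightarrow> parent m i \<omega> \<in> {1..2 ^ m}"
    and two_offspring:
      "\<And>m j \<omega>. j \<in> {1..2 ^ m} \<Longrightarrow> \<omega> \<in> space M \<Longrightarrow>
         card {i \<in> {1..2 ^ Suc m}. parent m i \<omega> = j} = 2"
    and labels_indep_motion:
      "indep_set
         (generated_events M (count_space UNIV) {parent m i | m i. i \<in> {1..2 ^ Suc m}})
         (generated_events M borel
            {W m i t | m i t. i \<in> {1..2 ^ m} \<and> t \<in> {real m..<real m + 1}})"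
    and brownian:
      "\<And>m i. i \<in> {1..2 ^ m} \<Longrightarrow> standard_brownian_motion (real m) (real m + 1) (W m i)"
    and brownian_indep:
      "\<And>m. indep_sets (\<lambda>i. generated_events M borel {W m i t | t. t \<in> {real m..<real m + 1}})
         {1..2 ^ m}"
    and brownian_indep_past:
      "\<And>m. indep_set
         (generated_events M borel
            {W m i t | i t. i \<in> {1..2 ^ m} \<and> t \<in> {real m..<real m + 1}})
         (generated_events M borel
            ({Z i t | i t. t \<in> {0..real m} \<and> i \<in> particles t} \<union>
             {W k i t | k i t. k < m \<and> i \<in> {1..2 ^ k} \<and> t \<in> {real k..<real k + 1}}))"
    and Z_measurable: "\<And>t i. 0 \<le> t \<Longrightarrow> i \<in> particles t \<Longrightarrow> random_variable borel (Z i t)"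
    and start: "AE \<omega> in M. Z 1 0 \<omega> = 0"
    and sde:
      "AE \<omega> in M. \<forall>m. \<forall>i\<in>{1..2 ^ m}. \<forall>t\<in>{real m..<real m + 1}.
         ((\<lambda>r. - b *\<^sub>R Z i r \<omega> + (1 / 2 ^ m) *\<^sub>R (\<Sum>j\<in>{1..2 ^ m}. \<gamma> *\<^sub>R (Z j r \<omega> - Z i r \<omega>)))
            has_integral
          (Z i t \<omega> - Z i (real m) \<omega> - (W m i t \<omega> - W m i (real m) \<omega>))) {real m..t}"
    and branching:
      "AE \<omega> in M. \<forall>m. \<forall>i\<in>{1..2 ^ Suc m}.
         ((\<lambda>t. Z (parent m i \<omega>) t \<omega>) \<longlongrightarrow> Z i (real (Suc m)) \<omega>) (at_left (real (Suc m)))"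

end

theory Submission
  imports Defs "HOL-Real_Asymp.Real_Asymp"
begin

text \<open>
Write \<open>c = \<gamma> + b\<close>. Relative to the centre of mass the interaction disappears: during one generation
every relative position is an Ornstein-Uhlenbeck path with rate \<open>c\<close>, driven by the Brownian motion of
the particle minus the mean of all Brownian motions of the generation. Over a unit of time this
gives \<open>Y\<^sub>i(m+1) = \<rho> Y\<^sub>p(m) + \<xi>\<^sub>p - mean \<xi>\<close>, where \<open>\<rho> = e\<^bsup>-c\<^esup> < 1\<close>, \<open>p\<close> is the parent of \<open>i\<close> and the
\<open>\<xi>\<close> are independent Gaussian vectors (\<open>relative_system_increment\<close>). To avoid stochastic
integration, the \<open>\<xi>\<close> are only approximated by Riemann sums of Brownian increments. After
normalisation all approximations have the same law, and almost sure limits preserve a common law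
(\<open>distr_AE_limit\<close>).

Condition on the genealogy, which is independent of the motion. The relative positions become
linear combinations of independent Gaussian vectors, with an explicit recursion for their
coefficients. All positions of generation \<open>m\<close> then have the same Gaussian law, whatever the
genealogy; this is the claim that the probability does not depend on the particle. The joint law of
two positions is determined by the Gram matrix of their coefficients, and their sum and difference
are independent (\<open>sum_difference_law\<close>).

The convergence follows from second moments. If two Gaussian vectors with the same law have
covariance \<open>K\<close>, the events that they lie in \<open>B\<close> have covariance at most a constant times \<open>\<bar>K\<bar>\<close>,
for any Borel set \<open>B\<close>: replacing the variances of sum and difference by their mean makes the vectors
independent and changes probabilities by \<open>O(\<bar>K\<bar>)\<close> only (\<open>gauss_pair_covariance_bound\<close>). Averaged
over all pairs of generation \<open>m\<close>, the numbers \<open>\<bar>K\<bar>\<close> obey \<open>q(m+1) \<le> \<rho>\<^sup>2 q(m) + 2 / 2\<^sup>m\<close>, because each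
pair of parents has four pairs of children and only a fraction \<open>2\<^bsup>-m\<^esup>\<close> of these pairs share a parent
(\<open>sum_gram_le\<close>). Hence the mean square deviations are summable and the deviations tend to 0 almost
surely.
\<close>

section \<open>The standard Gaussian measure\<close>

text \<open>The density of the standard normal law \<open>N(0, I)\<close>, written through the norm so that its
  invariance under rotations is visible.\<close>

definition gauss_dens :: "'a::euclidean_space \<Rightarrow> real" where
  "gauss_dens x = exp (- (norm x)\<^sup>2 / 2) / sqrt (2 * pi) ^ DIM('a)"

definition std_gauss :: "'a::euclidean_space measure" where
  "std_gauss = density lborel (\<lambda>x. ennreal (gauss_dens x))"

text \<open>Defining \<open>N(0, a\<^sup>2 I)\<close> as an image measure keeps the degenerate case \<open>a = 0\<close>, a point mass,
  which occurs here: the relative positions vanish in generations 0 and 1.\<close>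

definition gauss :: "real \<Rightarrow> 'a::euclidean_space measure" where
  "gauss a = distr std_gauss borel (\<lambda>x. a *\<^sub>R x)"

lemma gauss_dens_measurable [measurable]: "gauss_dens \<in> borel_measurable borel"
  unfolding gauss_dens_def by measurable

lemma gauss_dens_nonneg [simp]: "0 \<le> gauss_dens x"
  by (simp add: gauss_dens_def)

lemma sets_std_gauss [simp, measurable_cong]: "sets std_gauss = sets borel"
  by (simp add: std_gauss_def)

lemma space_std_gauss [simp]: "space std_gauss = UNIV"
  by (simp add: std_gauss_def)

lemma sets_gauss [simp, measurable_cong]: "sets (gauss a) = sets borel"
  by (simp add: gauss_def)

lemma space_gauss [simp]: "space (gauss a) = UNIV"
  by (simp add: gauss_def)

lemma norm_sq_Basis: "(norm (x::'a::euclidean_space))\<^sup>2 = (\<Sum>b\<in>Basis. (x \<bullet> b)\<^sup>2)"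
  by (subst power2_norm_eq_inner, subst euclidean_inner) (simp add: power2_eq_square)

lemma gauss_dens_prod: "gauss_dens (x::'a::euclidean_space) = (\<Prod>b\<in>Basis. std_normal_density (x \<bullet> b))"
proof -
  have "(\<Prod>b\<in>Basis. std_normal_density (x \<bullet> b))
      = (\<Prod>b\<in>(Basis::'a set). 1 / sqrt (2 * pi)) * (\<Prod>b\<in>Basis. exp (- (x \<bullet> b)\<^sup>2 / 2))"
    by (simp only: std_normal_density_def prod.distrib)
  also have "(\<Prod>b\<in>Basis. exp (- (x \<bullet> b)\<^sup>2 / 2)) = exp (- (norm x)\<^sup>2 / 2)"
    by (simp add: exp_sum[symmetric] norm_sq_Basis sum_negf sum_divide_distrib)
  finally show ?thesis
    by (simp add: gauss_dens_def power_one_over)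
qed

lemma prob_space_std_gauss: "prob_space (std_gauss :: 'a::euclidean_space measure)"
proof
  have "emeasure (std_gauss :: 'a measure) (space std_gauss)
      = (\<integral>\<^sup>+x. (\<Prod>b\<in>Basis. ennreal (std_normal_density ((x::'a) \<bullet> b))) \<partial>lborel)"
    by (simp add: std_gauss_def emeasure_density gauss_dens_prod prod_ennreal)
  also have "\<dots> = (\<Prod>b\<in>(Basis::'a set). \<integral>\<^sup>+x. ennreal (std_normal_density x) \<partial>lborel)"
    by (rule nn_integral_lborel_prod) auto
  also have "(\<integral>\<^sup>+x. ennreal (std_normal_density x) \<partial>lborel) = 1"
    by (subst nn_integral_eq_integral) (auto simp: integrable_normal_density)
  finally show "emeasure (std_gauss :: 'a measure) (space std_gauss) = 1" by simp
qed

interpretation std_gauss: prob_space "std_gauss :: 'a::euclidean_space measure"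
  by (rule prob_space_std_gauss)

interpretation std_gauss_pair: pair_prob_space
  "std_gauss :: 'a::euclidean_space measure" "std_gauss :: 'b::euclidean_space measure" ..

lemma prob_space_gauss: "prob_space (gauss a)"
  unfolding gauss_def by (rule std_gauss.prob_space_distr) simp

lemma nn_integral_gauss:
  assumes [measurable]: "f \<in> borel_measurable borel"
  shows "(\<integral>\<^sup>+x. f x \<partial>gauss a) = (\<integral>\<^sup>+x. f (a *\<^sub>R x) \<partial>std_gauss)"
  unfolding gauss_def by (subst nn_integral_distr) auto

lemma nn_integral_std_gauss:
  assumes [measurable]: "f \<in> borel_measurable borel"
  shows "(\<integral>\<^sup>+x. f x \<partial>std_gauss) = (\<integral>\<^sup>+x. ennreal (gauss_dens x) * f x \<partial>lborel)"
  unfolding std_gauss_def by (subst nn_integral_density) auto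

lemma nn_integral_lborel_affine:
  fixes t :: "'a::euclidean_space"
  assumes [measurable]: "f \<in> borel_measurable borel" and c: "c \<noteq> 0"
  shows "(\<integral>\<^sup>+x. f x \<partial>lborel) = ennreal (\<bar>c\<bar> ^ DIM('a)) * (\<integral>\<^sup>+x. f (t + c *\<^sub>R x) \<partial>lborel)"
  by (subst lborel_affine[OF c, of t])
     (simp add: nn_integral_density nn_integral_distr nn_integral_cmult)

lemma nn_integral_std_gauss_uminus:
  assumes [measurable]: "f \<in> borel_measurable borel"
  shows "(\<integral>\<^sup>+x. f (- x) \<partial>std_gauss) = (\<integral>\<^sup>+x. f x \<partial>std_gauss)"
proof -
  have "(\<integral>\<^sup>+x. f (- x) \<partial>std_gauss) = (\<integral>\<^sup>+x. ennreal (gauss_dens x) * f (- x) \<partial>lborel)"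
    by (rule nn_integral_std_gauss) measurable
  also have "\<dots> = (\<integral>\<^sup>+x. ennreal (gauss_dens x) * f x \<partial>lborel)"
    by (subst nn_integral_lborel_affine[where c="-1" and t=0]) (auto simp: gauss_dens_def)
  finally show ?thesis by (simp add: nn_integral_std_gauss)
qed

lemma nn_integral_std_gauss_swap:
  fixes f :: "'a::euclidean_space \<times> 'b::euclidean_space \<Rightarrow> ennreal"
  assumes [measurable]: "f \<in> borel_measurable (borel \<Otimes>\<^sub>M borel)"
  shows "(\<integral>\<^sup>+x. \<integral>\<^sup>+y. f (x, y) \<partial>std_gauss \<partial>std_gauss) = (\<integral>\<^sup>+y. \<integral>\<^sup>+x. f (x, y) \<partial>std_gauss \<partial>std_gauss)"
  by (rule std_gauss_pair.Fubini'[symmetric]) simp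

text \<open>A rotation with nonzero cosine is a composition of two shears and two scalings, so each step is
  an affine substitution in one of the two integrals, and the joint density only depends on
  \<open>\<bar>x\<bar>\<^sup>2 + \<bar>y\<bar>\<^sup>2\<close>.\<close>

lemma std_gauss_rotation_nonzero:
  fixes f :: "'a::euclidean_space \<times> 'a \<Rightarrow> ennreal"
  assumes [measurable]: "f \<in> borel_measurable (borel \<Otimes>\<^sub>M borel)"
    and pq: "p\<^sup>2 + q\<^sup>2 = 1" and p: "p \<noteq> 0"
  shows "(\<integral>\<^sup>+x. \<integral>\<^sup>+y. f (p *\<^sub>R x + q *\<^sub>R y, p *\<^sub>R y - q *\<^sub>R x) \<partial>std_gauss \<partial>std_gauss)
    = (\<integral>\<^sup>+x. \<integral>\<^sup>+y. f (x, y) \<partial>std_gauss \<partial>std_gauss)"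
proof -
  define \<phi> where "\<phi> x = ennreal (gauss_dens x)" for x :: 'a
  define D where "D = DIM('a)"
  have [measurable]: "\<phi> \<in> borel_measurable borel" unfolding \<phi>_def by measurable
  have nn: "(\<integral>\<^sup>+x. \<integral>\<^sup>+y. g x y \<partial>std_gauss \<partial>std_gauss) = (\<integral>\<^sup>+x. \<integral>\<^sup>+y. \<phi> x * (\<phi> y * g x y) \<partial>lborel \<partial>lborel)"
    if [measurable]: "(\<lambda>(x,y). g x y) \<in> borel_measurable (borel \<Otimes>\<^sub>M borel)" for g :: "'a \<Rightarrow> 'a \<Rightarrow> ennreal"
    by (simp add: nn_integral_std_gauss \<phi>_def nn_integral_cmult)
  have pp: "p * p = 1 - q * q" using pq by (simp add: power2_eq_square)
  have rot: "\<phi> (- (q / p) *\<^sub>R (q *\<^sub>R u + p *\<^sub>R v) + (1 / p) *\<^sub>R u) * \<phi> (q *\<^sub>R u + p *\<^sub>R v) = \<phi> u * \<phi> v" for u v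
  proof -
    have "- (q / p) *\<^sub>R (q *\<^sub>R u + p *\<^sub>R v) + (1 / p) *\<^sub>R u = ((1 - q * q) / p) *\<^sub>R u - q *\<^sub>R v"
      using p by (simp add: algebra_simps diff_divide_distrib)
    also have "(1 - q * q) / p = p" using p pp[symmetric] by simp
    finally have e: "- (q / p) *\<^sub>R (q *\<^sub>R u + p *\<^sub>R v) + (1 / p) *\<^sub>R u = p *\<^sub>R u - q *\<^sub>R v" .
    have "(norm (p *\<^sub>R u - q *\<^sub>R v))\<^sup>2 + (norm (q *\<^sub>R u + p *\<^sub>R v))\<^sup>2 = (p * p + q * q) * ((norm u)\<^sup>2 + (norm v)\<^sup>2)"
      by (simp add: power2_norm_eq_inner inner_simps algebra_simps inner_commute)
    also have "\<dots> = (norm u)\<^sup>2 + (norm v)\<^sup>2" using pp by simp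
    finally have n: "(norm (p *\<^sub>R u - q *\<^sub>R v))\<^sup>2 + (norm (q *\<^sub>R u + p *\<^sub>R v))\<^sup>2 = (norm u)\<^sup>2 + (norm v)\<^sup>2" .
    have "gauss_dens (p *\<^sub>R u - q *\<^sub>R v) * gauss_dens (q *\<^sub>R u + p *\<^sub>R v) = gauss_dens u * gauss_dens v"
      unfolding gauss_dens_def using n by (simp add: exp_add[symmetric] add_divide_distrib[symmetric])
    then show ?thesis unfolding e \<phi>_def by (simp add: ennreal_mult[symmetric])
  qed
  have img: "(p *\<^sub>R (- (q / p) *\<^sub>R y + (1 / p) *\<^sub>R u) + q *\<^sub>R y,
      p *\<^sub>R y - q *\<^sub>R (- (q / p) *\<^sub>R y + (1 / p) *\<^sub>R u)) = (u, (1 / p) *\<^sub>R y - (q / p) *\<^sub>R u)" for y u :: 'a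
  proof -
    have "p *\<^sub>R y - q *\<^sub>R (- (q / p) *\<^sub>R y + (1 / p) *\<^sub>R u) = ((p * p + q * q) / p) *\<^sub>R y - (q / p) *\<^sub>R u"
      using p by (simp add: algebra_simps add_divide_distrib)
    moreover have "(p * p + q * q) / p = 1 / p" using pp by simp
    moreover have "p *\<^sub>R (- (q / p) *\<^sub>R y + (1 / p) *\<^sub>R u) + q *\<^sub>R y = u"
      using p by (simp add: algebra_simps)
    ultimately show ?thesis by simp
  qed
  have img2: "(1 / p) *\<^sub>R (q *\<^sub>R u + p *\<^sub>R v) - (q / p) *\<^sub>R u = v" for u v :: 'a
    using p by (simp add: algebra_simps)
  \<comment> \<open>The two substitutions are \<open>x = (u - q y) / p\<close> for fixed \<open>y\<close> and then \<open>y = q u + p v\<close> for fixed \<open>u\<close>; their Jacobians cancel.\<close>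
  have "(\<integral>\<^sup>+x. \<integral>\<^sup>+y. f (p *\<^sub>R x + q *\<^sub>R y, p *\<^sub>R y - q *\<^sub>R x) \<partial>std_gauss \<partial>std_gauss)
     = (\<integral>\<^sup>+x. \<integral>\<^sup>+y. \<phi> x * (\<phi> y * f (p *\<^sub>R x + q *\<^sub>R y, p *\<^sub>R y - q *\<^sub>R x)) \<partial>lborel \<partial>lborel)"
    by (rule nn) measurable
  also have "\<dots> = (\<integral>\<^sup>+y. \<integral>\<^sup>+x. \<phi> x * (\<phi> y * f (p *\<^sub>R x + q *\<^sub>R y, p *\<^sub>R y - q *\<^sub>R x)) \<partial>lborel \<partial>lborel)"
    by (rule lborel_pair.Fubini'[symmetric]) simp
  also have "\<dots> = (\<integral>\<^sup>+y. ennreal (\<bar>1 / p\<bar> ^ D) * (\<integral>\<^sup>+u. \<phi> (- (q / p) *\<^sub>R y + (1 / p) *\<^sub>R u) * (\<phi> y * f (u, (1 / p) *\<^sub>R y - (q / p) *\<^sub>R u)) \<partial>lborel) \<partial>lborel)"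
  proof (rule nn_integral_cong)
    fix y :: 'a
    show "(\<integral>\<^sup>+x. \<phi> x * (\<phi> y * f (p *\<^sub>R x + q *\<^sub>R y, p *\<^sub>R y - q *\<^sub>R x)) \<partial>lborel)
      = ennreal (\<bar>1 / p\<bar> ^ D) * (\<integral>\<^sup>+u. \<phi> (- (q / p) *\<^sub>R y + (1 / p) *\<^sub>R u) * (\<phi> y * f (u, (1 / p) *\<^sub>R y - (q / p) *\<^sub>R u)) \<partial>lborel)"
      using nn_integral_lborel_affine[where c="1/p" and t="- (q / p) *\<^sub>R y" and
          f="\<lambda>x. \<phi> x * (\<phi> y * f (p *\<^sub>R x + q *\<^sub>R y, p *\<^sub>R y - q *\<^sub>R x))"] p
      unfolding img D_def by simp
  qed
  also have "\<dots> = ennreal (\<bar>1 / p\<bar> ^ D) * (\<integral>\<^sup>+y. \<integral>\<^sup>+u. \<phi> (- (q / p) *\<^sub>R y + (1 / p) *\<^sub>R u) * (\<phi> y * f (u, (1 / p) *\<^sub>R y - (q / p) *\<^sub>R u)) \<partial>lborel \<partial>lborel)"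
    by (rule nn_integral_cmult) measurable
  also have "(\<integral>\<^sup>+y. \<integral>\<^sup>+u. \<phi> (- (q / p) *\<^sub>R y + (1 / p) *\<^sub>R u) * (\<phi> y * f (u, (1 / p) *\<^sub>R y - (q / p) *\<^sub>R u)) \<partial>lborel \<partial>lborel)
    = (\<integral>\<^sup>+u. \<integral>\<^sup>+y. \<phi> (- (q / p) *\<^sub>R y + (1 / p) *\<^sub>R u) * (\<phi> y * f (u, (1 / p) *\<^sub>R y - (q / p) *\<^sub>R u)) \<partial>lborel \<partial>lborel)"
    by (rule lborel_pair.Fubini') simp
  also have "\<dots> = (\<integral>\<^sup>+u. ennreal (\<bar>p\<bar> ^ D) * (\<integral>\<^sup>+v. \<phi> u * (\<phi> v * f (u, v)) \<partial>lborel) \<partial>lborel)"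
  proof (rule nn_integral_cong)
    fix u :: 'a
    show "(\<integral>\<^sup>+y. \<phi> (- (q / p) *\<^sub>R y + (1 / p) *\<^sub>R u) * (\<phi> y * f (u, (1 / p) *\<^sub>R y - (q / p) *\<^sub>R u)) \<partial>lborel)
      = ennreal (\<bar>p\<bar> ^ D) * (\<integral>\<^sup>+v. \<phi> u * (\<phi> v * f (u, v)) \<partial>lborel)"
      by (rule trans[OF nn_integral_lborel_affine[where c=p and t="q *\<^sub>R u"]])
         (use p in \<open>simp_all only: img2 D_def mult.assoc[symmetric] rot, measurable\<close>)
  qed
  also have "\<dots> = ennreal (\<bar>p\<bar> ^ D) * (\<integral>\<^sup>+u. \<integral>\<^sup>+v. \<phi> u * (\<phi> v * f (u, v)) \<partial>lborel \<partial>lborel)"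
    by (rule nn_integral_cmult) measurable
  also have "(\<integral>\<^sup>+u. \<integral>\<^sup>+v. \<phi> u * (\<phi> v * f (u, v)) \<partial>lborel \<partial>lborel)
     = (\<integral>\<^sup>+x. \<integral>\<^sup>+y. f (x, y) \<partial>std_gauss \<partial>std_gauss)"
    by (rule nn[symmetric]) measurable
  also have "ennreal (\<bar>1 / p\<bar> ^ D) * (ennreal (\<bar>p\<bar> ^ D) * X) = X" for X
    using p by (simp add: mult.assoc[symmetric] ennreal_mult[symmetric] power_mult_distrib[symmetric])
  finally show ?thesis .
qed

lemma std_gauss_rotation:
  fixes f :: "'a::euclidean_space \<times> 'a \<Rightarrow> ennreal"
  assumes [measurable]: "f \<in> borel_measurable (borel \<Otimes>\<^sub>M borel)"
    and pq: "p\<^sup>2 + q\<^sup>2 = 1"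
  shows "(\<integral>\<^sup>+x. \<integral>\<^sup>+y. f (p *\<^sub>R x + q *\<^sub>R y, p *\<^sub>R y - q *\<^sub>R x) \<partial>std_gauss \<partial>std_gauss)
    = (\<integral>\<^sup>+x. \<integral>\<^sup>+y. f (x, y) \<partial>std_gauss \<partial>std_gauss)"
proof (cases "p = 0")
  case False
  then show ?thesis using std_gauss_rotation_nonzero[OF assms] by simp
next
  case True
  then consider "q = 1" | "q = -1" using pq by (auto simp: power2_eq_1_iff)
  then show ?thesis
  proof cases
    case 1
    have "(\<integral>\<^sup>+x. \<integral>\<^sup>+y. f (y, - x) \<partial>std_gauss \<partial>std_gauss) = (\<integral>\<^sup>+y. \<integral>\<^sup>+x. f (y, - x) \<partial>std_gauss \<partial>std_gauss)"
      by (rule nn_integral_std_gauss_swap[of "\<lambda>(x, y). f (y, - x)", simplified]) 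
    also have "\<dots> = (\<integral>\<^sup>+y. \<integral>\<^sup>+x. f (y, x) \<partial>std_gauss \<partial>std_gauss)"
      by (intro nn_integral_cong nn_integral_std_gauss_uminus) simp
    finally show ?thesis using True 1 by simp
  next
    case 2
    have "(\<integral>\<^sup>+x. \<integral>\<^sup>+y. f (- y, x) \<partial>std_gauss \<partial>std_gauss) = (\<integral>\<^sup>+x. \<integral>\<^sup>+y. f (y, x) \<partial>std_gauss \<partial>std_gauss)"
      by (intro nn_integral_cong nn_integral_std_gauss_uminus) simp
    also have "\<dots> = (\<integral>\<^sup>+y. \<integral>\<^sup>+x. f (y, x) \<partial>std_gauss \<partial>std_gauss)"
      by (rule nn_integral_std_gauss_swap[of "\<lambda>(x, y). f (y, x)", simplified])
    finally show ?thesis using True 2 by simp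
  qed
qed

lemma polar_coordinates_real: "\<exists>r p q::real. 0 \<le> r \<and> r\<^sup>2 = a\<^sup>2 + c\<^sup>2 \<and> p\<^sup>2 + q\<^sup>2 = 1 \<and> a = r * p \<and> c = r * q"
proof (cases "a = 0 \<and> c = 0")
  case True
  then show ?thesis by (intro exI[of _ 0] exI[of _ 1]) (auto intro: exI[of _ 0])
next
  case False
  define r where "r = sqrt (a\<^sup>2 + c\<^sup>2)"
  have s: "a\<^sup>2 + c\<^sup>2 \<noteq> 0" using False by (simp add: sum_power2_eq_zero_iff)
  then have r: "r \<noteq> 0" "r\<^sup>2 = a\<^sup>2 + c\<^sup>2" "0 \<le> r" by (auto simp: r_def)
  have "(a / r)\<^sup>2 + (c / r)\<^sup>2 = 1"
    using r s by (simp add: power_divide add_divide_distrib[symmetric])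
  then show ?thesis using r by (intro exI[of _ r] exI[of _ "a / r"] exI[of _ "c / r"]) auto
qed

text \<open>Rotate so that \<open>a x + c y\<close> becomes a multiple of the first coordinate alone.\<close>

lemma nn_integral_std_gauss_combine:
  fixes f :: "'a::euclidean_space \<Rightarrow> ennreal"
  assumes [measurable]: "f \<in> borel_measurable borel" and r: "r\<^sup>2 = a\<^sup>2 + c\<^sup>2" "0 \<le> r"
  shows "(\<integral>\<^sup>+x. \<integral>\<^sup>+y. f (a *\<^sub>R x + c *\<^sub>R y) \<partial>std_gauss \<partial>std_gauss) = (\<integral>\<^sup>+x. f (r *\<^sub>R x) \<partial>std_gauss)"
proof -
  obtain r' p q where 1: "0 \<le> r'" "r'\<^sup>2 = a\<^sup>2 + c\<^sup>2" "p\<^sup>2 + q\<^sup>2 = 1" "a = r' * p" "c = r' * q"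
    using polar_coordinates_real by blast
  have "r' = r" using r 1 by (metis power2_eq_iff_nonneg)
  then have "(\<integral>\<^sup>+x. \<integral>\<^sup>+y. f (a *\<^sub>R x + c *\<^sub>R y) \<partial>std_gauss \<partial>std_gauss) =
     (\<integral>\<^sup>+x. \<integral>\<^sup>+y. f (r *\<^sub>R (p *\<^sub>R x + q *\<^sub>R y)) \<partial>std_gauss \<partial>std_gauss)"
    using 1 by (simp add: algebra_simps)
  also have "\<dots> = (\<integral>\<^sup>+x. \<integral>\<^sup>+y. f (r *\<^sub>R x) \<partial>(std_gauss :: 'a measure) \<partial>std_gauss)"
    by (rule std_gauss_rotation[where f="\<lambda>(x, y). f (r *\<^sub>R x)", OF _ 1(3), unfolded prod.case]) simp
  also have "\<dots> = (\<integral>\<^sup>+x. f (r *\<^sub>R x) \<partial>std_gauss)"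
    by (simp add: nn_integral_const std_gauss.emeasure_space_1[simplified])
  finally show ?thesis .
qed

text \<open>Two linear functions of three independent standard vectors are brought to triangular form by
  Givens rotations: the first removes \<open>z\<close> from the first function, the second merges \<open>y\<close> and \<open>z\<close> in
  the second one. Rotations preserve the inner products of the coefficient vectors, which is all
  that the three equations say.\<close>

lemma nn_integral_std_gauss_three_to_two:
  "\<exists>\<alpha>' \<beta>' \<delta>'. 0 \<le> \<alpha>' \<and> 0 \<le> \<delta>' \<and> \<alpha>'\<^sup>2 = \<alpha>\<^sup>2 + a\<^sup>2 \<and> \<alpha>' * \<beta>' = \<alpha> * \<beta> + a * c \<and>
      \<beta>'\<^sup>2 + \<delta>'\<^sup>2 = \<beta>\<^sup>2 + \<delta>\<^sup>2 + c\<^sup>2 \<and>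
    (\<forall>f :: 'a::euclidean_space \<times> 'a \<Rightarrow> ennreal. f \<in> borel_measurable (borel \<Otimes>\<^sub>M borel) \<longrightarrow> 
     (\<integral>\<^sup>+x. \<integral>\<^sup>+y. \<integral>\<^sup>+z. f (\<alpha> *\<^sub>R x + a *\<^sub>R z, \<beta> *\<^sub>R x + \<delta> *\<^sub>R y + c *\<^sub>R z) \<partial>std_gauss \<partial>std_gauss \<partial>std_gauss)
      = (\<integral>\<^sup>+x. \<integral>\<^sup>+y. f (\<alpha>' *\<^sub>R x, \<beta>' *\<^sub>R x + \<delta>' *\<^sub>R y) \<partial>std_gauss \<partial>std_gauss))"
proof -
  obtain r p q where 1: "0 \<le> r" "r\<^sup>2 = \<alpha>\<^sup>2 + a\<^sup>2" "p\<^sup>2 + q\<^sup>2 = 1" "\<alpha> = r * p" "a = r * q"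
    using polar_coordinates_real by blast
  define B where "B = \<beta> * p + c * q"
  define C where "C = c * p - \<beta> * q"
  define d where "d = sqrt (\<delta>\<^sup>2 + C\<^sup>2)"
  have d: "d\<^sup>2 = \<delta>\<^sup>2 + C\<^sup>2" "0 \<le> d" by (auto simp: d_def)
  have "B\<^sup>2 + C\<^sup>2 = (\<beta>\<^sup>2 + c\<^sup>2) * (p\<^sup>2 + q\<^sup>2)"
    by (simp add: B_def C_def power2_eq_square algebra_simps)
  then have g: "B\<^sup>2 + d\<^sup>2 = \<beta>\<^sup>2 + \<delta>\<^sup>2 + c\<^sup>2" using d 1 by simp
  have rB: "r * B = \<alpha> * \<beta> + a * c" using 1 by (simp add: B_def algebra_simps)
  have "(\<integral>\<^sup>+x. \<integral>\<^sup>+y. \<integral>\<^sup>+z. f (\<alpha> *\<^sub>R x + a *\<^sub>R z, \<beta> *\<^sub>R x + \<delta> *\<^sub>R y + c *\<^sub>R z) \<partial>std_gauss \<partial>std_gauss \<partial>std_gauss)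
      = (\<integral>\<^sup>+x. \<integral>\<^sup>+y. f (r *\<^sub>R x, B *\<^sub>R x + d *\<^sub>R y) \<partial>std_gauss \<partial>std_gauss)"
    if [measurable]: "f \<in> borel_measurable (borel \<Otimes>\<^sub>M borel)" for f :: "'a \<times> 'a \<Rightarrow> ennreal"
  proof -
    have "(\<integral>\<^sup>+x. \<integral>\<^sup>+y. \<integral>\<^sup>+z. f (\<alpha> *\<^sub>R x + a *\<^sub>R z, \<beta> *\<^sub>R x + \<delta> *\<^sub>R y + c *\<^sub>R z) \<partial>std_gauss \<partial>std_gauss \<partial>std_gauss)
       = (\<integral>\<^sup>+y. \<integral>\<^sup>+x. \<integral>\<^sup>+z. f (\<alpha> *\<^sub>R x + a *\<^sub>R z, \<beta> *\<^sub>R x + \<delta> *\<^sub>R y + c *\<^sub>R z) \<partial>std_gauss \<partial>std_gauss \<partial>std_gauss)"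
      by (rule nn_integral_std_gauss_swap[of "\<lambda>(x, y). \<integral>\<^sup>+z. f (\<alpha> *\<^sub>R x + a *\<^sub>R z, \<beta> *\<^sub>R x + \<delta> *\<^sub>R y + c *\<^sub>R z) \<partial>std_gauss", simplified])
    also have "\<dots> = (\<integral>\<^sup>+y. \<integral>\<^sup>+x. \<integral>\<^sup>+z. f (r *\<^sub>R x, B *\<^sub>R x + \<delta> *\<^sub>R y + C *\<^sub>R z) \<partial>std_gauss \<partial>std_gauss \<partial>std_gauss)"
    proof (rule nn_integral_cong)
      fix y :: 'a
      have e: "(\<alpha> *\<^sub>R x + a *\<^sub>R z, \<beta> *\<^sub>R x + \<delta> *\<^sub>R y + c *\<^sub>R z)
         = (r *\<^sub>R (p *\<^sub>R x + q *\<^sub>R z), B *\<^sub>R (p *\<^sub>R x + q *\<^sub>R z) + \<delta> *\<^sub>R y + C *\<^sub>R (p *\<^sub>R z - q *\<^sub>R x))" for x z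
      proof -
        have pp: "p * p = 1 - q * q" using 1 by (simp add: power2_eq_square)
        have "B *\<^sub>R (p *\<^sub>R x + q *\<^sub>R z) + C *\<^sub>R (p *\<^sub>R z - q *\<^sub>R x) 
          = (\<beta> * (p * p + q * q)) *\<^sub>R x + (c * (p * p + q * q)) *\<^sub>R z"
          by (simp add: B_def C_def algebra_simps)
        also have "\<dots> = \<beta> *\<^sub>R x + c *\<^sub>R z" using pp by simp
        finally show ?thesis using 1 by (simp add: algebra_simps)
      qed
      show "(\<integral>\<^sup>+x. \<integral>\<^sup>+z. f (\<alpha> *\<^sub>R x + a *\<^sub>R z, \<beta> *\<^sub>R x + \<delta> *\<^sub>R y + c *\<^sub>R z) \<partial>std_gauss \<partial>std_gauss)
        = (\<integral>\<^sup>+x. \<integral>\<^sup>+z. f (r *\<^sub>R x, B *\<^sub>R x + \<delta> *\<^sub>R y + C *\<^sub>R z) \<partial>std_gauss \<partial>std_gauss)"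
        unfolding e
        by (rule std_gauss_rotation[where f="\<lambda>(x, z). f (r *\<^sub>R x, B *\<^sub>R x + \<delta> *\<^sub>R y + C *\<^sub>R z)", OF _ 1(3), unfolded prod.case]) simp
    qed
    also have "\<dots> = (\<integral>\<^sup>+x. \<integral>\<^sup>+y. \<integral>\<^sup>+z. f (r *\<^sub>R x, B *\<^sub>R x + \<delta> *\<^sub>R y + C *\<^sub>R z) \<partial>std_gauss \<partial>std_gauss \<partial>std_gauss)"
      by (rule nn_integral_std_gauss_swap[of "\<lambda>(y, x). \<integral>\<^sup>+z. f (r *\<^sub>R x, B *\<^sub>R x + \<delta> *\<^sub>R y + C *\<^sub>R z) \<partial>std_gauss", simplified])
    also have "\<dots> = (\<integral>\<^sup>+x. \<integral>\<^sup>+y. f (r *\<^sub>R x, B *\<^sub>R x + d *\<^sub>R y) \<partial>std_gauss \<partial>std_gauss)"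
    proof (rule nn_integral_cong)
      fix x :: 'a
      show "(\<integral>\<^sup>+y. \<integral>\<^sup>+z. f (r *\<^sub>R x, B *\<^sub>R x + \<delta> *\<^sub>R y + C *\<^sub>R z) \<partial>std_gauss \<partial>std_gauss)
        = (\<integral>\<^sup>+y. f (r *\<^sub>R x, B *\<^sub>R x + d *\<^sub>R y) \<partial>std_gauss)"
        using nn_integral_std_gauss_combine[of "\<lambda>w. f (r *\<^sub>R x, B *\<^sub>R x + w)", OF _ d] by (simp add: add.assoc)
    qed
    finally show ?thesis .
  qed
  then show ?thesis using 1 d g rB by blast
qed

section \<open>Laws of linear combinations of independent Gaussian vectors\<close>

definition bigauss :: "real \<Rightarrow> real \<Rightarrow> ('a::euclidean_space \<times> 'a) measure" where
  "bigauss a b = distr (std_gauss \<Otimes>\<^sub>M std_gauss) borel (\<lambda>(x, y). (a *\<^sub>R x, b *\<^sub>R y))"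

lemma sets_bigauss [simp, measurable_cong]: "sets (bigauss a b) = sets borel"
  by (simp add: bigauss_def)

lemma space_bigauss [simp]: "space (bigauss a b) = UNIV"
  by (simp add: bigauss_def)

lemma scale_pair_measurable [measurable]:
  "(\<lambda>(x::'a::euclidean_space, y::'a). (a *\<^sub>R x, b *\<^sub>R y)) \<in> std_gauss \<Otimes>\<^sub>M std_gauss \<rightarrow>\<^sub>M borel"
  by (simp add: borel_prod[symmetric])

lemma prob_space_bigauss: "prob_space (bigauss a b)"
  unfolding bigauss_def by (rule std_gauss_pair.prob_space_distr) measurable

lemma emeasure_bigauss:
  assumes [measurable]: "A \<in> sets (borel :: ('a::euclidean_space \<times> 'a) measure)"
  shows "emeasure (bigauss a b) A = (\<integral>\<^sup>+x. \<integral>\<^sup>+y. indicator A (a *\<^sub>R x, b *\<^sub>R y) \<partial>std_gauss \<partial>std_gauss)"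
proof -
  have A [measurable]: "A \<in> sets (borel \<Otimes>\<^sub>M borel)" using assms by (simp only: borel_prod)
  have "emeasure (bigauss a b) A = (\<integral>\<^sup>+z. indicator A z \<partial>bigauss a b)" by simp
  also have "\<dots> = (\<integral>\<^sup>+z. indicator A ((\<lambda>(x, y). (a *\<^sub>R x, b *\<^sub>R y)) z) \<partial>(std_gauss \<Otimes>\<^sub>M std_gauss))"
    unfolding bigauss_def by (rule nn_integral_distr) auto
  also have "\<dots> = (\<integral>\<^sup>+x. \<integral>\<^sup>+y. indicator A (a *\<^sub>R x, b *\<^sub>R y) \<partial>std_gauss \<partial>std_gauss)"
    by (subst std_gauss.nn_integral_fst[symmetric]) auto
  finally show ?thesis .
qed

lemma measure_bigauss:
  assumes [measurable]: "A \<in> sets (borel :: ('a::euclidean_space \<times> 'a) measure)"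
  shows "measure (bigauss a b) A = (\<integral>x. \<integral>y. indicator A (a *\<^sub>R x, b *\<^sub>R y) \<partial>std_gauss \<partial>std_gauss)"
proof -
  have A [measurable]: "A \<in> sets (borel \<Otimes>\<^sub>M borel)" using assms by (simp only: borel_prod)
  interpret prob_space "bigauss a b" by (rule prob_space_bigauss)
  have "measure (bigauss a b) A = (\<integral>z. indicator A z \<partial>bigauss a b)" by simp
  also have "\<dots> = (\<integral>z. indicator A ((\<lambda>(x, y). (a *\<^sub>R x, b *\<^sub>R y)) z) \<partial>(std_gauss \<Otimes>\<^sub>M std_gauss))"
    unfolding bigauss_def by (rule integral_distr) auto
  also have "\<dots> = (\<integral>x. \<integral>y. indicator A (a *\<^sub>R x, b *\<^sub>R y) \<partial>std_gauss \<partial>std_gauss)"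
    by (subst std_gauss_pair.integral_fst'[symmetric]) (auto intro!: std_gauss_pair.integrable_const_bound[where B=1])
  finally show ?thesis .
qed

text \<open>The joint law of two linear combinations only depends on the Gram matrix of their coefficient
  vectors. When a summand is added, the reduction from three vectors to two restores the
  triangular form.\<close>

lemma (in prob_space) nn_integral_two_combinations:
  fixes X :: "'e \<Rightarrow> 'a \<Rightarrow> 'b::euclidean_space"
  assumes "finite E" "indep_vars (\<lambda>_. borel) X E" "\<And>e. e \<in> E \<Longrightarrow> distr M borel (X e) = std_gauss"
  shows "\<exists>\<alpha> \<beta> \<delta>. 0 \<le> \<alpha> \<and> 0 \<le> \<delta> \<and> \<alpha>\<^sup>2 = (\<Sum>e\<in>E. (a e)\<^sup>2) \<and> \<alpha> * \<beta> = (\<Sum>e\<in>E. a e * c e) \<and>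
      \<beta>\<^sup>2 + \<delta>\<^sup>2 = (\<Sum>e\<in>E. (c e)\<^sup>2) \<and>
    (\<forall>f :: 'b \<times> 'b \<Rightarrow> ennreal. f \<in> borel_measurable (borel \<Otimes>\<^sub>M borel) \<longrightarrow>
     (\<integral>\<^sup>+\<omega>. f (\<Sum>e\<in>E. a e *\<^sub>R X e \<omega>, \<Sum>e\<in>E. c e *\<^sub>R X e \<omega>) \<partial>M)
      = (\<integral>\<^sup>+x. \<integral>\<^sup>+y. f (\<alpha> *\<^sub>R x, \<beta> *\<^sub>R x + \<delta> *\<^sub>R y) \<partial>std_gauss \<partial>std_gauss))"
  using assms
proof (induction E rule: finite_induct)
  case empty
  show ?case
    by (intro exI[of _ 0])
       (simp add: nn_integral_const emeasure_space_1 std_gauss.emeasure_space_1[simplified])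
next
  case (insert e F)
  have rv [measurable]: "random_variable borel (X i)" if "i \<in> insert e F" for i
    using insert.prems(1) that by (auto simp: indep_vars_def)
  obtain \<alpha> \<beta> \<delta> where IH: "\<alpha>\<^sup>2 = (\<Sum>e\<in>F. (a e)\<^sup>2)" "\<alpha> * \<beta> = (\<Sum>e\<in>F. a e * c e)"
      "\<beta>\<^sup>2 + \<delta>\<^sup>2 = (\<Sum>e\<in>F. (c e)\<^sup>2)"
    and law: "\<And>f :: 'b \<times> 'b \<Rightarrow> ennreal. f \<in> borel_measurable (borel \<Otimes>\<^sub>M borel) \<Longrightarrow>
     (\<integral>\<^sup>+\<omega>. f (\<Sum>e\<in>F. a e *\<^sub>R X e \<omega>, \<Sum>e\<in>F. c e *\<^sub>R X e \<omega>) \<partial>M)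
      = (\<integral>\<^sup>+x. \<integral>\<^sup>+y. f (\<alpha> *\<^sub>R x, \<beta> *\<^sub>R x + \<delta> *\<^sub>R y) \<partial>std_gauss \<partial>std_gauss)"
    using insert.IH insert.prems indep_vars_subset[of "\<lambda>_. borel" X "insert e F" F] by auto
  define P where "P \<omega> = (\<Sum>e\<in>F. a e *\<^sub>R X e \<omega>, \<Sum>e\<in>F. c e *\<^sub>R X e \<omega>)" for \<omega>
  have "indep_var
    (borel \<Otimes>\<^sub>M borel) ((\<lambda>f. (\<Sum>e\<in>F. a e *\<^sub>R f e, \<Sum>e\<in>F. c e *\<^sub>R f e)) \<circ> (\<lambda>\<omega>. restrict (\<lambda>i. X i \<omega>) F))
    (borel \<Otimes>\<^sub>M borel) ((\<lambda>f. (f e, f e)) \<circ> (\<lambda>\<omega>. restrict (\<lambda>i. X i \<omega>) {e}))"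
    using insert.hyps by (intro indep_var_compose[OF indep_var_restrict[OF insert.prems(1)]]) auto
  also have "(\<lambda>f. (\<Sum>e\<in>F. a e *\<^sub>R f e, \<Sum>e\<in>F. c e *\<^sub>R f e)) \<circ> (\<lambda>\<omega>. restrict (\<lambda>i. X i \<omega>) F) = P"
    by (auto simp: P_def fun_eq_iff intro!: sum.cong)
  also have "(\<lambda>f. (f e, f e)) \<circ> (\<lambda>\<omega>. restrict (\<lambda>i. X i \<omega>) {e}) = (\<lambda>\<omega>. (X e \<omega>, X e \<omega>))" by auto
  finally have ind: "indep_var (borel \<Otimes>\<^sub>M borel) P (borel \<Otimes>\<^sub>M borel) (\<lambda>\<omega>. (X e \<omega>, X e \<omega>))" .
  then have [measurable]: "random_variable (borel \<Otimes>\<^sub>M borel) P"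
    and eq: "distr M (borel \<Otimes>\<^sub>M borel) P \<Otimes>\<^sub>M distr M (borel \<Otimes>\<^sub>M borel) (\<lambda>\<omega>. (X e \<omega>, X e \<omega>))
      = distr M ((borel \<Otimes>\<^sub>M borel) \<Otimes>\<^sub>M (borel \<Otimes>\<^sub>M borel)) (\<lambda>\<omega>. (P \<omega>, X e \<omega>, X e \<omega>))"
    by (auto simp: indep_var_distribution_eq)
  interpret XX: prob_space "distr M (borel \<Otimes>\<^sub>M borel) (\<lambda>\<omega>. (X e \<omega>, X e \<omega>))"
    by (rule prob_space_distr) measurable
  obtain \<alpha>' \<beta>' \<delta>' where new: "0 \<le> \<alpha>'" "0 \<le> \<delta>'" "\<alpha>'\<^sup>2 = \<alpha>\<^sup>2 + (a e)\<^sup>2" "\<alpha>' * \<beta>' = \<alpha> * \<beta> + a e * c e"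
      "\<beta>'\<^sup>2 + \<delta>'\<^sup>2 = \<beta>\<^sup>2 + \<delta>\<^sup>2 + (c e)\<^sup>2"
    and three: "\<And>f :: 'b \<times> 'b \<Rightarrow> ennreal. f \<in> borel_measurable (borel \<Otimes>\<^sub>M borel) \<Longrightarrow>
     (\<integral>\<^sup>+x. \<integral>\<^sup>+y. \<integral>\<^sup>+z. f (\<alpha> *\<^sub>R x + a e *\<^sub>R z, \<beta> *\<^sub>R x + \<delta> *\<^sub>R y + c e *\<^sub>R z) \<partial>std_gauss \<partial>std_gauss \<partial>std_gauss)
      = (\<integral>\<^sup>+x. \<integral>\<^sup>+y. f (\<alpha>' *\<^sub>R x, \<beta>' *\<^sub>R x + \<delta>' *\<^sub>R y) \<partial>std_gauss \<partial>std_gauss)"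
    using nn_integral_std_gauss_three_to_two[of \<alpha> "a e" \<beta> "c e" \<delta>, where ?'a='b] by blast
  have "(\<integral>\<^sup>+\<omega>. f (\<Sum>e\<in>insert e F. a e *\<^sub>R X e \<omega>, \<Sum>e\<in>insert e F. c e *\<^sub>R X e \<omega>) \<partial>M)
      = (\<integral>\<^sup>+x. \<integral>\<^sup>+y. f (\<alpha>' *\<^sub>R x, \<beta>' *\<^sub>R x + \<delta>' *\<^sub>R y) \<partial>std_gauss \<partial>std_gauss)"
    if f [measurable]: "f \<in> borel_measurable (borel \<Otimes>\<^sub>M borel)" for f :: "'b \<times> 'b \<Rightarrow> ennreal"
  proof -
    define h where "h = (\<lambda>(w, z). f (fst w + a e *\<^sub>R z, snd w + c e *\<^sub>R z))"
    have [measurable]: "h \<in> borel_measurable ((borel \<Otimes>\<^sub>M borel) \<Otimes>\<^sub>M borel)"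
      unfolding h_def by measurable
    have "(\<integral>\<^sup>+\<omega>. f (\<Sum>e\<in>insert e F. a e *\<^sub>R X e \<omega>, \<Sum>e\<in>insert e F. c e *\<^sub>R X e \<omega>) \<partial>M) = (\<integral>\<^sup>+\<omega>. h (P \<omega>, X e \<omega>) \<partial>M)"
      using insert.hyps by (simp add: h_def P_def add.commute)
    also have "\<dots> = (\<integral>\<^sup>+v. h (fst v, fst (snd v)) \<partial>distr M ((borel \<Otimes>\<^sub>M borel) \<Otimes>\<^sub>M (borel \<Otimes>\<^sub>M borel)) (\<lambda>\<omega>. (P \<omega>, X e \<omega>, X e \<omega>)))"
      by (subst nn_integral_distr) auto
    also have "\<dots> = (\<integral>\<^sup>+w. \<integral>\<^sup>+z. h (w, fst z) \<partial>distr M (borel \<Otimes>\<^sub>M borel) (\<lambda>\<omega>. (X e \<omega>, X e \<omega>)) \<partial>distr M (borel \<Otimes>\<^sub>M borel) P)"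
      unfolding eq[symmetric] by (subst XX.nn_integral_fst[symmetric]) auto
    also have "\<dots> = (\<integral>\<^sup>+w. \<integral>\<^sup>+z. h (w, z) \<partial>distr M borel (X e) \<partial>distr M (borel \<Otimes>\<^sub>M borel) P)"
      by (intro nn_integral_cong) (simp add: nn_integral_distr)
    also have "\<dots> = (\<integral>\<^sup>+w. \<integral>\<^sup>+z. h (w, z) \<partial>std_gauss \<partial>distr M (borel \<Otimes>\<^sub>M borel) P)"
      using insert.prems by simp
    also have "\<dots> = (\<integral>\<^sup>+\<omega>. \<integral>\<^sup>+z. h (P \<omega>, z) \<partial>std_gauss \<partial>M)"
      by (subst nn_integral_distr) auto
    also have "\<dots> = (\<integral>\<^sup>+x. \<integral>\<^sup>+y. \<integral>\<^sup>+z. f (\<alpha> *\<^sub>R x + a e *\<^sub>R z, \<beta> *\<^sub>R x + \<delta> *\<^sub>R y + c e *\<^sub>R z) \<partial>std_gauss \<partial>std_gauss \<partial>std_gauss)"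
      unfolding P_def by (subst law) (auto simp: h_def)
    also have "\<dots> = (\<integral>\<^sup>+x. \<integral>\<^sup>+y. f (\<alpha>' *\<^sub>R x, \<beta>' *\<^sub>R x + \<delta>' *\<^sub>R y) \<partial>std_gauss \<partial>std_gauss)"
      by (rule three) measurable
    finally show ?thesis .
  qed
  moreover have "\<alpha>'\<^sup>2 = (\<Sum>e\<in>insert e F. (a e)\<^sup>2)" "\<alpha>' * \<beta>' = (\<Sum>e\<in>insert e F. a e * c e)"
      "\<beta>'\<^sup>2 + \<delta>'\<^sup>2 = (\<Sum>e\<in>insert e F. (c e)\<^sup>2)"
    using new IH insert.hyps by auto
  ultimately show ?case using new(1,2) by blast
qed

text \<open>For orthogonal coefficient vectors the triangular form is diagonal, so the combinations are
  independent.\<close>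

lemma (in prob_space) orthogonal_combinations_law:
  fixes X :: "'e \<Rightarrow> 'a \<Rightarrow> 'b::euclidean_space"
  assumes E: "finite E" "indep_vars (\<lambda>_. borel) X E" "\<And>e. e \<in> E \<Longrightarrow> distr M borel (X e) = std_gauss"
    and orth: "(\<Sum>e\<in>E. a e * c e) = 0"
  shows "distr M borel (\<lambda>\<omega>. (\<Sum>e\<in>E. a e *\<^sub>R X e \<omega>, \<Sum>e\<in>E. c e *\<^sub>R X e \<omega>))
    = bigauss (sqrt (\<Sum>e\<in>E. (a e)\<^sup>2)) (sqrt (\<Sum>e\<in>E. (c e)\<^sup>2))"
proof -
  define r s where "r = sqrt (\<Sum>e\<in>E. (a e)\<^sup>2)" and "s = sqrt (\<Sum>e\<in>E. (c e)\<^sup>2)"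
  have rv [measurable]: "random_variable borel (X i)" if "i \<in> E" for i
    using E that by (auto simp: indep_vars_def)
  obtain \<alpha> \<beta> \<delta> where abd: "0 \<le> \<alpha>" "0 \<le> \<delta>" "\<alpha>\<^sup>2 = (\<Sum>e\<in>E. (a e)\<^sup>2)" "\<alpha> * \<beta> = 0"
      "\<beta>\<^sup>2 + \<delta>\<^sup>2 = (\<Sum>e\<in>E. (c e)\<^sup>2)"
    and law: "\<And>f :: 'b \<times> 'b \<Rightarrow> ennreal. f \<in> borel_measurable (borel \<Otimes>\<^sub>M borel) \<Longrightarrow>
     (\<integral>\<^sup>+\<omega>. f (\<Sum>e\<in>E. a e *\<^sub>R X e \<omega>, \<Sum>e\<in>E. c e *\<^sub>R X e \<omega>) \<partial>M)
      = (\<integral>\<^sup>+x. \<integral>\<^sup>+y. f (\<alpha> *\<^sub>R x, \<beta> *\<^sub>R x + \<delta> *\<^sub>R y) \<partial>std_gauss \<partial>std_gauss)"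
    using nn_integral_two_combinations[OF E, of a c] orth by auto
  have \<alpha>: "\<alpha> = r" using abd by (simp add: r_def real_sqrt_unique)
  have s: "s\<^sup>2 = \<beta>\<^sup>2 + \<delta>\<^sup>2" "0 \<le> s" using abd by (auto simp: s_def sum_nonneg)
  have law': "(\<integral>\<^sup>+x. \<integral>\<^sup>+y. f (\<alpha> *\<^sub>R x, \<beta> *\<^sub>R x + \<delta> *\<^sub>R y) \<partial>std_gauss \<partial>std_gauss)
       = (\<integral>\<^sup>+x. \<integral>\<^sup>+y. f (r *\<^sub>R x, s *\<^sub>R y) \<partial>std_gauss \<partial>std_gauss)"
    if [measurable]: "f \<in> borel_measurable (borel \<Otimes>\<^sub>M borel)" for f :: "'b \<times> 'b \<Rightarrow> ennreal"
  \<comment> \<open>If \<open>\<alpha> = 0\<close>, orthogonality leaves \<open>\<beta>\<close> free, but then the first vector only serves to build the second combination.\<close>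
  proof (cases "\<alpha> = 0")
    case True
    then show ?thesis
      using nn_integral_std_gauss_combine[of "\<lambda>w. f (0, w)", OF _ s] \<alpha>
      by (simp add: nn_integral_const std_gauss.emeasure_space_1[simplified])
  next
    case False
    then have "\<beta> = 0" using abd by simp
    then have "\<delta> = s" using s abd by (metis add_0 power2_eq_iff_nonneg power_zero_numeral)
    then show ?thesis using \<alpha> \<open>\<beta> = 0\<close> by simp
  qed
  have m [measurable]: "(\<lambda>\<omega>. (\<Sum>e\<in>E. a e *\<^sub>R X e \<omega>, \<Sum>e\<in>E. c e *\<^sub>R X e \<omega>)) \<in> M \<rightarrow>\<^sub>M borel"
    by (simp add: borel_prod[symmetric])
  show ?thesis
  proof (rule measure_eqI)
    fix A assume "A \<in> sets (distr M borel (\<lambda>\<omega>. (\<Sum>e\<in>E. a e *\<^sub>R X e \<omega>, \<Sum>e\<in>E. c e *\<^sub>R X e \<omega>)))"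
    then have A [measurable]: "A \<in> sets borel" by simp
    then have A' [measurable]: "A \<in> sets (borel \<Otimes>\<^sub>M borel)" using A by (simp only: borel_prod)
    have "emeasure (distr M borel (\<lambda>\<omega>. (\<Sum>e\<in>E. a e *\<^sub>R X e \<omega>, \<Sum>e\<in>E. c e *\<^sub>R X e \<omega>))) A
      = (\<integral>\<^sup>+v. indicator A v \<partial>distr M borel (\<lambda>\<omega>. (\<Sum>e\<in>E. a e *\<^sub>R X e \<omega>, \<Sum>e\<in>E. c e *\<^sub>R X e \<omega>)))"
      by simp
    also have "\<dots> = (\<integral>\<^sup>+\<omega>. indicator A (\<Sum>e\<in>E. a e *\<^sub>R X e \<omega>, \<Sum>e\<in>E. c e *\<^sub>R X e \<omega>) \<partial>M)"
      by (rule nn_integral_distr) auto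
    also have "\<dots> = emeasure (bigauss r s) A"
      by (simp add: law law' emeasure_bigauss)
    finally show "emeasure (distr M borel (\<lambda>\<omega>. (\<Sum>e\<in>E. a e *\<^sub>R X e \<omega>, \<Sum>e\<in>E. c e *\<^sub>R X e \<omega>))) A
      = emeasure (bigauss (sqrt (\<Sum>e\<in>E. (a e)\<^sup>2)) (sqrt (\<Sum>e\<in>E. (c e)\<^sup>2))) A"
      by (simp add: r_def s_def)
  qed simp
qed

section \<open>Weakly correlated Gaussian pairs\<close>

text \<open>For \<open>a \<le> b\<close> the density of \<open>N(0, b\<^sup>2 I)\<close> is at least \<open>(a / b)\<^sup>d\<close> times that of \<open>N(0, a\<^sup>2 I)\<close>: the
  exponent is larger and only the normalising constant is lost. Such a minorisation bounds the
  total variation distance from above.\<close>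

lemma gauss_domination:
  fixes f :: "'a::euclidean_space \<Rightarrow> ennreal"
  assumes [measurable]: "f \<in> borel_measurable borel" and ab: "0 < a" "a \<le> b"
  shows "ennreal ((a / b) ^ DIM('a)) * (\<integral>\<^sup>+x. f (a *\<^sub>R x) \<partial>std_gauss) \<le> (\<integral>\<^sup>+x. f (b *\<^sub>R x) \<partial>std_gauss)"
proof -
  have "(\<integral>\<^sup>+x. f (b *\<^sub>R x) \<partial>std_gauss) = (\<integral>\<^sup>+x. ennreal (gauss_dens x) * f (b *\<^sub>R x) \<partial>lborel)"
    by (rule nn_integral_std_gauss) measurable
  also have "\<dots> = ennreal (\<bar>a / b\<bar> ^ DIM('a)) * (\<integral>\<^sup>+x. ennreal (gauss_dens ((a / b) *\<^sub>R x)) * f (a *\<^sub>R x) \<partial>lborel)"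
    using nn_integral_lborel_affine[where c="a/b" and t="0::'a" and
          f="\<lambda>x. ennreal (gauss_dens x) * f (b *\<^sub>R x)"] ab by simp
  also have "\<dots> \<ge> ennreal (\<bar>a / b\<bar> ^ DIM('a)) * (\<integral>\<^sup>+x. ennreal (gauss_dens x) * f (a *\<^sub>R x) \<partial>lborel)"
  proof (intro mult_left_mono nn_integral_mono mult_right_mono ennreal_leI)
    fix x :: 'a
    have "norm ((a / b) *\<^sub>R x) \<le> norm x" using ab mult_right_mono[of "a / b" 1 "norm x"] by simp
    then have "(norm ((a / b) *\<^sub>R x))\<^sup>2 \<le> (norm x)\<^sup>2" by (intro power_mono) auto
    then show "gauss_dens x \<le> gauss_dens ((a / b) *\<^sub>R x)"
      unfolding gauss_dens_def by (intro divide_right_mono) auto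
  qed auto
  finally show ?thesis using ab by (simp add: nn_integral_std_gauss)
qed

lemma gauss_domination_real:
  fixes f :: "'a::euclidean_space \<Rightarrow> real"
  assumes [measurable]: "f \<in> borel_measurable borel" and f: "\<And>x. 0 \<le> f x" "\<And>x. f x \<le> 1"
    and ab: "0 \<le> a" "a \<le> b" "0 < b"
  shows "(a / b) ^ DIM('a) * (\<integral>x. f (a *\<^sub>R x) \<partial>std_gauss) \<le> (\<integral>x. f (b *\<^sub>R x) \<partial>std_gauss)"
proof (cases "a = 0")
  case True
  then show ?thesis using f by (simp add: integral_nonneg_AE power_0_left)
next
  case False
  have int: "integrable std_gauss (\<lambda>x. f (c *\<^sub>R x))" for c
    using f by (intro std_gauss.integrable_const_bound[where B=1]) auto
  have nn: "(\<integral>\<^sup>+x. ennreal (f (c *\<^sub>R x)) \<partial>std_gauss) = ennreal (\<integral>x. f (c *\<^sub>R x) \<partial>std_gauss)" for c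
    using f by (intro nn_integral_eq_integral int) auto
  have pos: "0 \<le> (\<integral>x. f (c *\<^sub>R x) \<partial>std_gauss)" for c
    using f by (simp add: integral_nonneg_AE)
  show ?thesis
    using gauss_domination[of "\<lambda>x. ennreal (f x)" a b] False ab pos
    by (simp add: nn ennreal_mult[symmetric] ennreal_le_iff)
qed

text \<open>Minorisation applied to \<open>f\<close> and to \<open>1 - f\<close> bounds the difference by \<open>1 - (a / b)\<^sup>d\<close>, and Bernoulli
  turns this into the relative difference of the variances.\<close>

lemma gauss_scale_lipschitz_aux:
  fixes f :: "'a::euclidean_space \<Rightarrow> real"
  assumes [measurable]: "f \<in> borel_measurable borel" and f: "\<And>x. 0 \<le> f x" "\<And>x. f x \<le> 1"
    and ab: "0 \<le> a" "a \<le> b" "0 < b"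
  shows "\<bar>(\<integral>x. f (a *\<^sub>R x) \<partial>std_gauss) - (\<integral>x. f (b *\<^sub>R x) \<partial>std_gauss)\<bar> \<le> DIM('a) * ((b\<^sup>2 - a\<^sup>2) / b\<^sup>2)"
proof -
  define u where "u c = (\<integral>x. f (c *\<^sub>R x) \<partial>std_gauss)" for c
  define d where "d = DIM('a)"
  have int: "integrable std_gauss (\<lambda>x. f (c *\<^sub>R x))" for c
    using f by (intro std_gauss.integrable_const_bound[where B=1]) auto
  have u01: "0 \<le> u c" "u c \<le> 1" for c
    unfolding u_def using f std_gauss.integral_le_const[OF int[of c], of 1]
    by (auto simp: integral_nonneg_AE)
  have one: "(\<integral>x. 1 - f (c *\<^sub>R x) \<partial>std_gauss) = 1 - u c" for c
    using int by (simp add: u_def std_gauss.prob_space[simplified])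
  have t: "0 \<le> a / b" "a / b \<le> 1" using ab by auto
  have 1: "(a / b) ^ d * u a \<le> u b"
    unfolding u_def d_def by (rule gauss_domination_real) (use f ab in auto)
  have 2: "(a / b) ^ d * (1 - u a) \<le> 1 - u b"
    using gauss_domination_real[of "\<lambda>x. 1 - f x" a b] f ab by (simp add: one d_def)
  have "1 - (a / b) ^ d \<le> d * (1 - a / b)"
    using Bernoulli_inequality[of "a / b - 1" d] t by (simp add: algebra_simps)
  also have "\<dots> \<le> d * (1 - (a / b)\<^sup>2)"
    using t by (intro mult_left_mono diff_left_mono power_le_one_iff[THEN iffD2] order.trans[OF power_decreasing[of 1 2]]) auto
  also have "1 - (a / b)\<^sup>2 = (b\<^sup>2 - a\<^sup>2) / b\<^sup>2" using ab by (simp add: field_simps)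
  finally have 3: "1 - (a / b) ^ d \<le> d * ((b\<^sup>2 - a\<^sup>2) / b\<^sup>2)" .
  have th: "(a / b) ^ d \<le> 1" using t by (simp add: power_le_one)
  have "u a - u b \<le> (1 - (a / b) ^ d) * u a" using 1 by (simp add: algebra_simps)
  also have "\<dots> \<le> 1 - (a / b) ^ d" using u01[of a] th by (simp add: mult_left_le)
  finally have 4: "u a - u b \<le> 1 - (a / b) ^ d" .
  have "u b - u a \<le> (1 - (a / b) ^ d) * (1 - u a)" using 2 by (simp add: algebra_simps)
  also have "\<dots> \<le> 1 - (a / b) ^ d" using u01[of a] th by (simp add: mult_left_le)
  finally have 5: "u b - u a \<le> 1 - (a / b) ^ d" .
  show ?thesis using 3 4 5 unfolding u_def d_def by (auto simp: abs_le_iff)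
qed

lemma gauss_scale_lipschitz:
  fixes f :: "'a::euclidean_space \<Rightarrow> real"
  assumes m: "f \<in> borel_measurable borel" and f: "\<And>x. 0 \<le> f x" "\<And>x. f x \<le> 1"
    and a: "0 \<le> a" and t: "0 < t"
  shows "\<bar>(\<integral>x. f (a *\<^sub>R x) \<partial>std_gauss) - (\<integral>x. f (t *\<^sub>R x) \<partial>std_gauss)\<bar> \<le> DIM('a) * (\<bar>a\<^sup>2 - t\<^sup>2\<bar> / t\<^sup>2)"
proof (cases "a \<le> t")
  case True
  have "a\<^sup>2 \<le> t\<^sup>2" using True a by (intro power_mono) auto
  then show ?thesis using gauss_scale_lipschitz_aux[OF m f a True t] by simp
next
  case False
  have s: "t\<^sup>2 \<le> a\<^sup>2" using False t by (intro power_mono) auto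
  have "\<bar>(\<integral>x. f (t *\<^sub>R x) \<partial>std_gauss) - (\<integral>x. f (a *\<^sub>R x) \<partial>std_gauss)\<bar> \<le> DIM('a) * ((a\<^sup>2 - t\<^sup>2) / a\<^sup>2)"
    using gauss_scale_lipschitz_aux[OF m f, of t a] False t by simp
  also have "\<dots> \<le> DIM('a) * ((a\<^sup>2 - t\<^sup>2) / t\<^sup>2)"
    using s t False by (intro mult_left_mono divide_left_mono mult_pos_pos) auto
  finally show ?thesis using s by (simp add: abs_minus_commute)
qed

lemma bigauss_lipschitz:
  fixes A :: "('a::euclidean_space \<times> 'a) set"
  assumes A0 [measurable]: "A \<in> sets borel" and a: "0 \<le> a" "0 \<le> b" and t: "0 < t"
  shows "\<bar>measure (bigauss a b) A - measure (bigauss t t) A\<bar>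
    \<le> DIM('a) * (\<bar>a\<^sup>2 - t\<^sup>2\<bar> / t\<^sup>2) + DIM('a) * (\<bar>b\<^sup>2 - t\<^sup>2\<bar> / t\<^sup>2)"
proof -
  have A [measurable]: "A \<in> sets (borel \<Otimes>\<^sub>M borel)" using A0 by (simp only: borel_prod)
  define g :: "real \<Rightarrow> 'a \<Rightarrow> real"
    where "g c u = (\<integral>y. indicator A (u, c *\<^sub>R y) \<partial>(std_gauss :: 'a measure))" for c and u :: 'a
  have [measurable]: "g c \<in> borel_measurable borel" for c
    unfolding g_def by (rule std_gauss.borel_measurable_lebesgue_integral) measurable
  have i1: "integrable std_gauss (\<lambda>y. indicator A (u, c *\<^sub>R y) :: real)" for u and c
    by (intro std_gauss.integrable_const_bound[where B=1]) auto
  have g0: "0 \<le> g c u" "g c u \<le> 1" for c u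
    unfolding g_def by (auto intro!: integral_nonneg_AE std_gauss.integral_le_const[OF i1])
  have ig: "integrable std_gauss (\<lambda>x. g c (r *\<^sub>R x))" for c r
    using g0 by (intro std_gauss.integrable_const_bound[where B=1]) auto
  have m: "measure (bigauss a b) A = (\<integral>x. g b (a *\<^sub>R x) \<partial>std_gauss)" for a b
    by (simp add: measure_bigauss g_def)
  have "\<bar>g b u - g t u\<bar> \<le> DIM('a) * (\<bar>b\<^sup>2 - t\<^sup>2\<bar> / t\<^sup>2)" for u
    unfolding g_def using a t by (intro gauss_scale_lipschitz[where f="\<lambda>y. indicator A (u, y)"]) auto
  then have "\<bar>\<integral>x. g b (a *\<^sub>R x) - g t (a *\<^sub>R x) \<partial>std_gauss\<bar> \<le> DIM('a) * (\<bar>b\<^sup>2 - t\<^sup>2\<bar> / t\<^sup>2)"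
    using ig by (intro order.trans[OF integral_abs_bound] std_gauss.integral_le_const) auto
  then have 1: "\<bar>measure (bigauss a b) A - measure (bigauss a t) A\<bar> \<le> DIM('a) * (\<bar>b\<^sup>2 - t\<^sup>2\<bar> / t\<^sup>2)"
    using ig by (simp add: m)
  have 2: "\<bar>measure (bigauss a t) A - measure (bigauss t t) A\<bar> \<le> DIM('a) * (\<bar>a\<^sup>2 - t\<^sup>2\<bar> / t\<^sup>2)"
    unfolding m using g0 a t by (intro gauss_scale_lipschitz) auto
  show ?thesis using 1 2 by linarith
qed

text \<open>With \<open>u = X + X'\<close> and \<open>v = X' - X\<close> this is the event that \<open>X\<close> and \<open>X'\<close> both lie in \<open>B\<close>.\<close>

definition sum_diff_event :: "'a::real_vector set \<Rightarrow> ('a \<times> 'a) set" where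
  "sum_diff_event B = {(u, v). (1/2) *\<^sub>R (u - v) \<in> B \<and> (1/2) *\<^sub>R (u + v) \<in> B}"

lemma sum_diff_event_measurable [measurable]:
  assumes [measurable]: "(B :: 'a::euclidean_space set) \<in> sets borel"
  shows "sum_diff_event B \<in> sets borel"
proof -
  have "{z \<in> space (borel \<Otimes>\<^sub>M borel). (1/2) *\<^sub>R (fst z - snd z) \<in> B \<and> (1/2) *\<^sub>R (fst z + snd z) \<in> B} \<in> sets (borel \<Otimes>\<^sub>M borel)"
    by measurable
  also have "(borel \<Otimes>\<^sub>M borel :: ('a \<times> 'a) measure) = borel" by (rule borel_prod)
  finally show ?thesis by (simp add: sum_diff_event_def case_prod_beta')
qed

text \<open>When \<open>u\<close> and \<open>v\<close> have the same variance, a rotation by 45 degrees shows that \<open>X\<close> and \<open>X'\<close> are independent, whence the product.\<close>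

lemma measure_bigauss_diag:
  fixes B :: "'a::euclidean_space set"
  assumes [measurable]: "B \<in> sets borel" and s: "0 < s"
  shows "measure (bigauss (sqrt 2 * s) (sqrt 2 * s)) (sum_diff_event B) = (measure (gauss s) B)\<^sup>2"
proof -
  interpret g: prob_space "gauss s :: 'a measure" by (rule prob_space_gauss)
  interpret bg: prob_space "bigauss (sqrt 2 * s) (sqrt 2 * s) :: ('a \<times> 'a) measure" by (rule prob_space_bigauss)
  define h where "h = 1 / sqrt (2::real)"
  have h: "h\<^sup>2 + (- h)\<^sup>2 = 1" by (simp add: h_def power_divide)
  have h2: "sqrt 2 * s = 2 * (s * h)" by (simp add: h_def field_simps)
  have E: "sum_diff_event B \<in> sets borel" using assms(1) by measurable
  have "emeasure (bigauss (sqrt 2 * s) (sqrt 2 * s)) (sum_diff_event B)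
    = (\<integral>\<^sup>+x. \<integral>\<^sup>+y. indicator B (s *\<^sub>R (h *\<^sub>R x + (- h) *\<^sub>R y)) * indicator B (s *\<^sub>R (h *\<^sub>R y - (- h) *\<^sub>R x)) \<partial>std_gauss \<partial>std_gauss)"
    unfolding h2 emeasure_bigauss[OF E]
      by (auto intro!: nn_integral_cong simp: sum_diff_event_def indicator_def algebra_simps)
  also have "\<dots> = (\<integral>\<^sup>+x. \<integral>\<^sup>+y. indicator B (s *\<^sub>R x) * indicator B (s *\<^sub>R y) \<partial>(std_gauss :: 'a measure) \<partial>std_gauss)"
    by (rule std_gauss_rotation[where f="\<lambda>(x, y). indicator B (s *\<^sub>R x) * indicator B (s *\<^sub>R y)", OF _ h, unfolded prod.case]) simp
  also have "\<dots> = (\<integral>\<^sup>+x. indicator B x \<partial>(gauss s :: 'a measure)) * (\<integral>\<^sup>+x. indicator B x \<partial>(gauss s :: 'a measure))"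
    by (subst (1 2) nn_integral_gauss) (auto simp: nn_integral_cmult nn_integral_multc)
  also have "\<dots> = emeasure (gauss s) B * emeasure (gauss s) B" by simp
  finally have "emeasure (bigauss (sqrt 2 * s) (sqrt 2 * s)) (sum_diff_event B) = emeasure (gauss s) B * emeasure (gauss s) B" .
  then show ?thesis
    by (simp add: bg.emeasure_eq_measure g.emeasure_eq_measure ennreal_mult[symmetric] power2_eq_square)
qed

text \<open>If \<open>X\<close> and \<open>X'\<close> have variance \<open>s\<^sup>2\<close> and covariance \<open>K\<close> in each coordinate, then \<open>X + X'\<close> and
  \<open>X' - X\<close> are independent with variances \<open>2 s\<^sup>2 + 2 K\<close> and \<open>2 s\<^sup>2 - 2 K\<close>. Replacing both
  variances by \<open>2 s\<^sup>2\<close> costs little in total variation and makes \<open>X\<close> and \<open>X'\<close> independent. So the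
  events \<open>X \<in> B\<close> and \<open>X' \<in> B\<close> decorrelate linearly in \<open>K\<close>, for every Borel set \<open>B\<close>.\<close>

lemma gauss_pair_covariance_bound:
  fixes B :: "'a::euclidean_space set"
  assumes B: "B \<in> sets borel" and s: "0 < s"
    and a: "0 \<le> a" "a\<^sup>2 = 2 * s\<^sup>2 + 2 * K" and b: "0 \<le> b" "b\<^sup>2 = 2 * s\<^sup>2 - 2 * K"
  shows "\<bar>measure (bigauss a b) (sum_diff_event B) - (measure (gauss s) B)\<^sup>2\<bar> \<le> 2 * real DIM('a) * \<bar>K\<bar> / s\<^sup>2"
proof -
  define t where "t = sqrt 2 * s"
  have t: "0 < t" "t\<^sup>2 = 2 * s\<^sup>2" using s by (auto simp: t_def power_mult_distrib)
  have "\<bar>measure (bigauss a b) (sum_diff_event B) - measure (bigauss t t) (sum_diff_event B)\<bar>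
    \<le> DIM('a) * (\<bar>a\<^sup>2 - t\<^sup>2\<bar> / t\<^sup>2) + DIM('a) * (\<bar>b\<^sup>2 - t\<^sup>2\<bar> / t\<^sup>2)"
    using B a b t by (intro bigauss_lipschitz) auto
  also have "\<dots> = 2 * real DIM('a) * \<bar>K\<bar> / s\<^sup>2"
    unfolding a(2) b(2) t(2) by (simp add: abs_mult)
  finally show ?thesis unfolding t_def measure_bigauss_diag[OF B s] .
qed

section \<open>Almost sure limits of identically distributed variables\<close>

text \<open>Fatou gives \<open>P(L \<in> U) \<le> N(U)\<close> for open \<open>U\<close>, outer regularity extends this to all Borel sets, and
  between two probability measures such an inequality is an equality. The conclusion covers all
  Borel sets, not only continuity sets, because the laws do not vary with \<open>n\<close>.\<close>

lemma (in prob_space) distr_AE_limit: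
  fixes X :: "nat \<Rightarrow> 'a \<Rightarrow> 'b::{second_countable_topology, complete_space}"
  assumes X [measurable]: "\<And>n. X n \<in> borel_measurable M" and L [measurable]: "L \<in> borel_measurable M"
    and law: "\<And>n. distr M borel (X n) = N" and lim: "AE \<omega> in M. (\<lambda>n. X n \<omega>) \<longlonglongrightarrow> L \<omega>"
  shows "distr M borel L = N"
proof -
  have setsN: "sets N = sets borel" using law[of 0] by auto
  interpret N: prob_space N using prob_space_distr[OF X[of 0]] law[of 0] by simp
  interpret D: prob_space "distr M borel L" by (rule prob_space_distr) measurable
  have op: "emeasure (distr M borel L) U \<le> emeasure N U" if U: "open U" for U
  proof -
    have [measurable]: "U \<in> sets borel" using U by simp
    have "emeasure (distr M borel L) U = (\<integral>\<^sup>+\<omega>. indicator U (L \<omega>) \<partial>M)"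
      by (subst nn_integral_indicator[symmetric]) (auto simp: nn_integral_distr simp del: nn_integral_indicator)
    also have "\<dots> \<le> (\<integral>\<^sup>+\<omega>. liminf (\<lambda>n. indicator U (X n \<omega>)) \<partial>M)"
    proof (rule nn_integral_mono_AE, use lim in eventually_elim)
      fix \<omega> assume l: "(\<lambda>n. X n \<omega>) \<longlonglongrightarrow> L \<omega>"
      show "(indicator U (L \<omega>) :: ennreal) \<le> liminf (\<lambda>n. indicator U (X n \<omega>))"
      proof (cases "L \<omega> \<in> U")
        case True
        then have "eventually (\<lambda>n. X n \<omega> \<in> U) sequentially"
          using topological_tendstoD[OF l U] by simp
        then show ?thesis
          by (intro Liminf_bounded) (auto simp: indicator_def elim: eventually_mono)
      qed simp
    qed
    also have "\<dots> \<le> liminf (\<lambda>n. \<integral>\<^sup>+\<omega>. indicator U (X n \<omega>) \<partial>M)"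
      by (rule nn_integral_liminf) measurable
    also have "(\<lambda>n. \<integral>\<^sup>+\<omega>. indicator U (X n \<omega>) \<partial>M) = (\<lambda>n. emeasure N U)"
    proof
      fix n
      have "emeasure (distr M borel (X n)) U = (\<integral>\<^sup>+\<omega>. indicator U (X n \<omega>) \<partial>M)"
        by (subst nn_integral_indicator[symmetric]) (auto simp: nn_integral_distr simp del: nn_integral_indicator)
      then show "(\<integral>\<^sup>+\<omega>. indicator U (X n \<omega>) \<partial>M) = emeasure N U" by (simp add: law)
    qed
    finally show ?thesis by (simp add: Liminf_const)
  qed
  have le: "emeasure (distr M borel L) A \<le> emeasure N A" if A: "A \<in> sets borel" for A
  proof -
    have "emeasure N A = (INF U\<in>{U. A \<subseteq> U \<and> open U}. emeasure N U)"
      by (rule outer_regular) (use setsN A in auto)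
    moreover have "emeasure (distr M borel L) A \<le> (INF U\<in>{U. A \<subseteq> U \<and> open U}. emeasure N U)"
    proof (rule INF_greatest)
      fix U assume U: "U \<in> {U. A \<subseteq> U \<and> open U}"
      then have "emeasure (distr M borel L) A \<le> emeasure (distr M borel L) U"
        by (intro emeasure_mono) auto
      also have "\<dots> \<le> emeasure N U" using op U by auto
      finally show "emeasure (distr M borel L) A \<le> emeasure N U" .
    qed
    ultimately show ?thesis by simp
  qed
  show ?thesis
  proof (rule measure_eqI)
    fix A assume "A \<in> sets (distr M borel L)"
    then have A: "A \<in> sets borel" "- A \<in> sets borel" by auto
    have spN: "space N = UNIV" using sets_eq_imp_space_eq[OF setsN] by simp
    have 1: "measure (distr M borel L) A \<le> measure N A" "measure (distr M borel L) (- A) \<le> measure N (- A)"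
      using le[OF A(1)] le[OF A(2)] by (auto simp: D.emeasure_eq_measure N.emeasure_eq_measure)
    have 2: "measure N (- A) = 1 - measure N A"
      using N.prob_compl[of A] A setsN by (simp add: spN Compl_eq_Diff_UNIV)
    have 3: "measure (distr M borel L) (- A) = 1 - measure (distr M borel L) A"
      using D.prob_compl[of A] A by (simp add: Compl_eq_Diff_UNIV)
    have "measure (distr M borel L) A = measure N A" using 1 unfolding 2 3 by linarith
    then show "emeasure (distr M borel L) A = emeasure N A"
      by (simp add: D.emeasure_eq_measure N.emeasure_eq_measure)
  qed (simp add: setsN)
qed

section \<open>Riemann sums for an Ornstein-Uhlenbeck path\<close>

text \<open>The subdivision points \<open>grid a n k\<close> with \<open>k \<le> n + 1\<close> stay strictly below \<open>a + 1\<close>, because the driving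
  paths are only given on the half-open interval.\<close>

definition grid :: "real \<Rightarrow> nat \<Rightarrow> nat \<Rightarrow> real" where
  "grid a n k = a + real k / real (n + 2)"

text \<open>The factor by which a noise increment at the \<open>k\<close>-th grid point has decayed at the end of the interval.\<close>

definition exp_weight :: "real \<Rightarrow> nat \<Rightarrow> nat \<Rightarrow> real" where
  "exp_weight c n k = exp (- c * (1 - real k / real (n + 2)))"

lemma grid_mem: "k \<le> Suc n \<Longrightarrow> grid a n k \<in> {a..<a + 1}"
  by (auto simp: grid_def field_simps)

lemma grid_step: "grid a n (Suc k) - grid a n k = 1 / real (n + 2)"
  by (simp add: grid_def add_divide_distrib)

text \<open>The path solves \<open>dy = dw - c y dt\<close>, so \<open>E y\<close> has differential \<open>E dw\<close>, where \<open>E s\<close> is the factor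
  by which an increment at time \<open>s\<close> has decayed at the end of the interval. In discrete form: over a
  step from \<open>t\<close> to \<open>t'\<close> the increments of both sides differ by the integral of
  \<open>c (E s y t' - E t y s)\<close>, which is small relative to the step by uniform continuity of \<open>y\<close>, and
  the increments of \<open>E y\<close> telescope.\<close>

lemma exp_weight_riemann_limit_continuous:
  fixes y w :: "real \<Rightarrow> 'a::euclidean_space"
  assumes cont: "continuous_on {a..a + 1} y"
    and eq: "\<And>t. t \<in> {a..<a + 1} \<Longrightarrow> ((\<lambda>r. - c *\<^sub>R y r) has_integral (y t - y a - (w t - w a))) {a..t}"
  shows "(\<lambda>n. \<Sum>k<Suc n. exp_weight c n k *\<^sub>R (w (grid a n (Suc k)) - w (grid a n k)))
    \<longlonglongrightarrow> y (a + 1) - exp (- c) *\<^sub>R y a"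
proof -
  define E where "E s = exp (- c * (1 - (s - a)))" for s :: real
  define v where "v s = E s *\<^sub>R y s" for s
  define R where "R n = (\<Sum>k<Suc n. exp_weight c n k *\<^sub>R (w (grid a n (Suc k)) - w (grid a n k)))" for n
  have Eg: "E (grid a n k) = exp_weight c n k" for n k by (simp add: E_def exp_weight_def grid_def)
  have dE: "((\<lambda>s. c * E s) has_integral (E t' - E t)) {t..t'}" if "t \<le> t'" for t t'
    by (rule fundamental_theorem_of_calculus[OF that])
       (auto simp: E_def has_real_derivative_iff_has_vector_derivative[symmetric] intro!: derivative_eq_intros)
  have yint: "y integrable_on {t..t'}" if "a \<le> t" "t' \<le> a + 1" for t t'
    by (rule integrable_continuous_real) (rule continuous_on_subset[OF cont], use that in auto)
  have weq: "w t' - w t = y t' - y t + c *\<^sub>R integral {t..t'} y"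
    if t: "a \<le> t" "t \<le> t'" "t' < a + 1" for t t'
  proof -
    have J: "c *\<^sub>R integral {a..s} y = (w s - w a) - (y s - y a)" if "s \<in> {a..<a+1}" for s
    proof -
      have "integral {a..s} (\<lambda>r. - c *\<^sub>R y r) = y s - y a - (w s - w a)"
        using eq[OF that] by (rule integral_unique)
      moreover have "integral {a..s} (\<lambda>r. - c *\<^sub>R y r) = - (c *\<^sub>R integral {a..s} y)"
        by simp
      ultimately have "c *\<^sub>R integral {a..s} y = - (y s - y a - (w s - w a))"
        by (metis minus_minus)
      then show ?thesis by simp
    qed
    have "integral {a..t} y + integral {t..t'} y = integral {a..t'} y"
      using t by (intro Henstock_Kurzweil_Integration.integral_combine yint) auto
    then have "integral {t..t'} y = integral {a..t'} y - integral {a..t} y"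
      by (metis add_diff_cancel_left')
    then have "c *\<^sub>R integral {t..t'} y = c *\<^sub>R integral {a..t'} y - c *\<^sub>R integral {a..t} y"
      by (simp only: scaleR_diff_right)
    also have "c *\<^sub>R integral {a..t'} y = (w t' - w a) - (y t' - y a)" using t by (intro J) auto
    also have "c *\<^sub>R integral {a..t} y = (w t - w a) - (y t - y a)" using t by (intro J) auto
    finally show ?thesis by simp
  qed
  have err: "norm (v t' - v t - E t *\<^sub>R (w t' - w t)) \<le> \<bar>c\<bar> * e * (t' - t)"
    if t: "a \<le> t" "t \<le> t'" "t' < a + 1"
      and e: "\<And>s. s \<in> {t..t'} \<Longrightarrow> norm (E s *\<^sub>R y t' - E t *\<^sub>R y s) \<le> e" for t t' e
  proof -
    have "((\<lambda>s. (c * E s) *\<^sub>R y t' - (c * E t) *\<^sub>R y s) has_integral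
        ((E t' - E t) *\<^sub>R y t' - (c * E t) *\<^sub>R integral {t..t'} y)) {t..t'}"
      using t by (intro has_integral_diff has_integral_scaleR_left has_integral_cmul dE
        integrable_integral yint) auto
    moreover have "(E t' - E t) *\<^sub>R y t' - (c * E t) *\<^sub>R integral {t..t'} y = v t' - v t - E t *\<^sub>R (w t' - w t)"
      unfolding weq[OF t] by (simp add: v_def algebra_simps)
    ultimately have I: "((\<lambda>s. (c * E s) *\<^sub>R y t' - (c * E t) *\<^sub>R y s) has_integral
        (v t' - v t - E t *\<^sub>R (w t' - w t))) (cbox t t')" by simp
    have e0: "0 \<le> e" using order_trans[OF norm_ge_zero e[of t]] t by simp
    have "norm (v t' - v t - E t *\<^sub>R (w t' - w t)) \<le> \<bar>c\<bar> * e * measure lborel (cbox t t')"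
    proof (rule has_integral_bound[OF _ I])
      show "0 \<le> \<bar>c\<bar> * e" using e0 by simp
      fix s assume "s \<in> cbox t t'"
      then have "norm (E s *\<^sub>R y t' - E t *\<^sub>R y s) \<le> e" by (intro e) simp
      moreover have "(c * E s) *\<^sub>R y t' - (c * E t) *\<^sub>R y s = c *\<^sub>R (E s *\<^sub>R y t' - E t *\<^sub>R y s)"
        by (simp add: scaleR_diff_right)
      ultimately show "norm ((c * E s) *\<^sub>R y t' - (c * E t) *\<^sub>R y s) \<le> \<bar>c\<bar> * e"
        by (simp add: mult_left_mono)
    qed
    then show ?thesis using t by simp
  qed
  have tele: "v (grid a n (Suc n)) - v a - R n
      = (\<Sum>k<Suc n. v (grid a n (Suc k)) - v (grid a n k) - E (grid a n k) *\<^sub>R (w (grid a n (Suc k)) - w (grid a n k)))" for n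
  proof -
    have "(\<Sum>k<Suc n. v (grid a n (Suc k)) - v (grid a n k)) = v (grid a n (Suc n)) - v (grid a n 0)"
      by (rule sum_lessThan_telescope)
    then show ?thesis by (simp only: sum_subtractf R_def Eg) (simp add: grid_def)
  qed
  have small: "(\<lambda>n. v (grid a n (Suc n)) - v a - R n) \<longlonglongrightarrow> 0"
  proof (rule LIMSEQ_I)
    fix r :: real assume r: "0 < r"
    define e where "e = r / (\<bar>c\<bar> + 1) / 2"
    have e: "0 < e" "\<bar>c\<bar> * e < r" using r by (auto simp: e_def field_simps intro!: add_nonneg_pos)
    have "uniformly_continuous_on ({a..a+1} \<times> {a..a+1}) (\<lambda>z. E (fst z) *\<^sub>R y (snd z))"
      unfolding E_def
      by (intro compact_uniformly_continuous continuous_intros continuous_on_compose2[OF cont] compact_Times) auto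
    then obtain d where d: "0 < d" and D: "\<And>z z'. z \<in> {a..a+1} \<times> {a..a+1} \<Longrightarrow> z' \<in> {a..a+1} \<times> {a..a+1} \<Longrightarrow>
        dist z' z < d \<Longrightarrow> dist (E (fst z') *\<^sub>R y (snd z')) (E (fst z) *\<^sub>R y (snd z)) < e"
      using e by (elim uniformly_continuous_onE) blast+
    obtain N where N: "1 / real (N + 1) < d / 2"
      using reals_Archimedean[of "d / 2"] d by (auto simp: field_simps)
    have "norm (v (grid a n (Suc n)) - v a - R n) < r" if n: "N \<le> n" for n
    proof -
      define h where "h = 1 / real (n + 2)"
      have h: "0 < h" "h < d / 2"
      proof -
        have "h \<le> 1 / real (N + 1)" unfolding h_def using n by (intro divide_left_mono) auto
        then show "h < d / 2" using N by simp
      qed (simp add: h_def)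
      have "norm (v (grid a n (Suc n)) - v a - R n) \<le> (\<Sum>k<Suc n. \<bar>c\<bar> * e * h)"
        unfolding tele
      proof (rule sum_norm_le)
        fix k assume k: "k \<in> {..<Suc n}"
        have g: "grid a n k \<in> {a..<a+1}" "grid a n (Suc k) \<in> {a..<a+1}" using k by (auto intro!: grid_mem simp del: atLeastLessThan_iff)
        have st: "grid a n (Suc k) = grid a n k + h" using grid_step[of a n k] by (simp add: h_def)
        have "norm (v (grid a n (Suc k)) - v (grid a n k) - E (grid a n k) *\<^sub>R (w (grid a n (Suc k)) - w (grid a n k)))
          \<le> \<bar>c\<bar> * e * (grid a n (Suc k) - grid a n k)"
        proof (rule err)
          fix s assume s: "s \<in> {grid a n k..grid a n (Suc k)}"
          have "dist (s, grid a n (Suc k)) (grid a n k, s) \<le> dist s (grid a n k) + dist (grid a n (Suc k)) s"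
            by (simp add: dist_Pair_Pair sqrt_sum_squares_le_sum)
          also have "\<dots> < d" using s st h by (auto simp: dist_real_def)
          finally have "dist (E s *\<^sub>R y (grid a n (Suc k))) (E (grid a n k) *\<^sub>R y s) < e"
            using D[of "(grid a n k, s)" "(s, grid a n (Suc k))"] g s by auto
          then show "norm (E s *\<^sub>R y (grid a n (Suc k)) - E (grid a n k) *\<^sub>R y s) \<le> e"
            by (simp add: dist_norm)
        qed (use g st h in auto)
        then show "norm (v (grid a n (Suc k)) - v (grid a n k) - E (grid a n k) *\<^sub>R (w (grid a n (Suc k)) - w (grid a n k)))
          \<le> \<bar>c\<bar> * e * h" using st by simp
      qed
      also have "\<dots> = \<bar>c\<bar> * e * (real (Suc n) * h)" by simp
      also have "\<dots> \<le> \<bar>c\<bar> * e * 1" using e by (intro mult_left_mono) (auto simp: h_def)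
      also have "\<dots> < r" using e by simp
      finally show ?thesis .
    qed
    then show "\<exists>no. \<forall>n\<ge>no. norm (v (grid a n (Suc n)) - v a - R n - 0) < r" by auto
  qed
  have gl: "(\<lambda>n. grid a n (Suc n)) \<longlonglongrightarrow> a + 1"
  proof -
    have "(\<lambda>n. a + (1 - 1 / real (n + 2))) \<longlonglongrightarrow> a + (1 - 0)"
      by (intro tendsto_intros) (rule LIMSEQ_ignore_initial_segment[OF lim_1_over_n])
    moreover have "a + (1 - 1 / real (n + 2)) = grid a n (Suc n)" for n by (simp add: grid_def field_simps)
    ultimately show ?thesis by simp
  qed
  have "continuous_on {a..a+1} v" unfolding v_def E_def by (intro continuous_intros cont)
  then have "(\<lambda>n. v (grid a n (Suc n))) \<longlonglongrightarrow> v (a + 1)"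
    using gl grid_mem[of "Suc _" _ a]
    by (auto intro!: continuous_on_tendsto_compose[of _ v] always_eventually less_imp_le)
  then have "(\<lambda>n. v (grid a n (Suc n)) - v a - (v (grid a n (Suc n)) - v a - R n)) \<longlonglongrightarrow> v (a + 1) - v a - 0"
    by (intro tendsto_diff small tendsto_const)
  then show ?thesis unfolding R_def[symmetric] by (simp add: v_def E_def)
qed

text \<open>The equation forces \<open>y\<close> to be continuous on the half-open interval; setting it to its left limit
  at the end point reduces to the closed interval.\<close>

lemma exp_weight_riemann_limit:
  fixes y w :: "real \<Rightarrow> 'a::euclidean_space"
  assumes w: "continuous_on {a..<a + 1} w"
    and L: "(y \<longlongrightarrow> L) (at_left (a + 1))"
    and eq: "\<And>t. t \<in> {a..<a + 1} \<Longrightarrow> ((\<lambda>r. - c *\<^sub>R y r) has_integral (y t - y a - (w t - w a))) {a..t}"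
  shows "(\<lambda>n. \<Sum>k<Suc n. exp_weight c n k *\<^sub>R (w (grid a n (Suc k)) - w (grid a n k)))
    \<longlonglongrightarrow> L - exp (- c) *\<^sub>R y a"
proof -
  have loc: "continuous_on {a..T} y" if T: "T < a + 1" for T
  proof (cases "a \<le> T")
    case True
    have "continuous_on {a..T} (\<lambda>t. integral {a..t} (\<lambda>r. - c *\<^sub>R y r) + y a + (w t - w a))"
      using T True eq[of T]
      by (intro continuous_intros indefinite_integral_continuous_1 continuous_on_subset[OF w])
         (auto simp: integrable_on_def)
    then show ?thesis
    proof (rule continuous_on_eq)
      fix t assume "t \<in> {a..T}"
      then have "integral {a..t} (\<lambda>r. - c *\<^sub>R y r) = y t - y a - (w t - w a)"
        using T by (intro integral_unique eq) auto
      then show "integral {a..t} (\<lambda>r. - c *\<^sub>R y r) + y a + (w t - w a) = y t" unfolding \<open>integral _ _ = _\<close> by simp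
    qed
  qed auto
  define z where "z t = (if t < a + 1 then y t else L)" for t
  have "continuous_on {a..a + 1} z"
    unfolding continuous_on_eq_continuous_within
  proof
    fix x assume x: "x \<in> {a..a + 1}"
    show "continuous (at x within {a..a + 1}) z"
    proof (cases "x < a + 1")
      case True
      define T where "T = (x + a + 1) / 2"
      have T: "x < T" "T < a + 1" using True by (auto simp: T_def)
      have "continuous (at x within {a..T}) y"
        using loc[OF T(2)] x T by (auto simp: continuous_on_eq_continuous_within)
      then have "continuous (at x within {a..T}) z"
        by (rule continuous_transform_within[where \<delta>=1]) (use x T in \<open>auto simp: z_def\<close>)
      moreover have "at x within {a..a + 1} = at x within {a..T}"
        by (rule at_within_nhd[of _ "{..<T}"]) (use T in auto)
      ultimately show ?thesis by simp
    next
      case False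
      then have xe: "x = a + 1" using x by simp
      have "(z \<longlongrightarrow> L) (at_left (a + 1))"
        by (rule Lim_transform_eventually[OF L]) (auto simp: eventually_at_filter z_def)
      moreover have "at (a + 1) within {a..a + 1} = at_left (a + 1)"
        by (rule at_within_Icc_at_left) simp
      ultimately show ?thesis unfolding xe continuous_within by (simp add: z_def)
    qed
  qed
  moreover have "((\<lambda>r. - c *\<^sub>R z r) has_integral (z t - z a - (w t - w a))) {a..t}" if t: "t \<in> {a..<a + 1}" for t
  proof -
    have "((\<lambda>r. - c *\<^sub>R z r) has_integral (y t - y a - (w t - w a))) {a..t}"
      by (rule has_integral_eq[OF _ eq[OF t]]) (use t in \<open>auto simp: z_def\<close>)
    then show ?thesis using t by (simp add: z_def)
  qed
  ultimately have "(\<lambda>n. \<Sum>k<Suc n. exp_weight c n k *\<^sub>R (w (grid a n (Suc k)) - w (grid a n k)))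
    \<longlonglongrightarrow> z (a + 1) - exp (- c) *\<^sub>R z a"
    by (rule exp_weight_riemann_limit_continuous)
  then show ?thesis by (simp add: z_def)
qed

text \<open>The variances of the Riemann sums; a geometric sum in closed form.\<close>

lemma exp_weight_variance_limit:
  assumes c: "c > 0"
  shows "(\<lambda>n. (\<Sum>k<Suc n. (exp_weight c n k)\<^sup>2 / real (n + 2))) \<longlonglongrightarrow> (1 - exp (- 2 * c)) / (2 * c)"
proof -
  have "(\<Sum>k<Suc n. (exp_weight c n k)\<^sup>2 / real (n + 2))
     = exp (- 2 * c) / real (n + 2) * ((exp (2 * c * (real n + 1) / (real n + 2)) - 1) / (exp (2 * c / (real n + 2)) - 1))" for n
  proof -
    define x where "x = exp (2 * c / (real n + 2))"
    have x: "x \<noteq> 1" using c by (simp add: x_def)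
    have "(exp_weight c n k)\<^sup>2 = exp (- 2 * c) * x ^ k" for k
    proof -
      have e: "- c * (1 - real k / real (n + 2)) + - c * (1 - real k / real (n + 2))
        = - 2 * c + real k * (2 * c / (real n + 2))"
        by (simp add: algebra_simps)
      show ?thesis
        unfolding exp_weight_def x_def power2_eq_square exp_add[symmetric] exp_of_nat_mult[symmetric] e ..
    qed
    then have "(\<Sum>k<Suc n. (exp_weight c n k)\<^sup>2 / real (n + 2)) = exp (- 2 * c) / real (n + 2) * (\<Sum>k<Suc n. x ^ k)"
      by (simp only: sum_distrib_left) (simp add: field_simps)
    also have "(\<Sum>k<Suc n. x ^ k) = (x ^ Suc n - 1) / (x - 1)" by (rule geometric_sum[OF x])
    also have "x ^ Suc n = exp (2 * c * (real n + 1) / (real n + 2))"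
      by (simp only: x_def exp_of_nat_mult[symmetric]) (simp add: field_simps)
    finally show ?thesis by (simp add: x_def)
  qed
  moreover have "(\<lambda>n. exp (- 2 * c) / real (n + 2) * ((exp (2 * c * (real n + 1) / (real n + 2)) - 1) / (exp (2 * c / (real n + 2)) - 1)))
     \<longlonglongrightarrow> exp (- (2 * c)) * ((exp (2 * c) - 1) * inverse c) / 2"
    using c by real_asymp
  moreover have "exp (- (2 * c)) * ((exp (2 * c) - 1) * inverse c) / 2 = (1 - exp (- 2 * c)) / (2 * c)"
    using c by (simp add: field_simps exp_add[symmetric])
  ultimately show ?thesis by simp
qed

section \<open>Increments of the relative system over one generation\<close>

lemma sum_two_to_one:
  fixes f :: "'b \<Rightarrow> 'c::real_vector"
  assumes "finite I" "finite J" "p ` I \<subseteq> J" and two: "\<And>j. j \<in> J \<Longrightarrow> card {i\<in>I. p i = j} = 2"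
  shows "(\<Sum>i\<in>I. f (p i)) = 2 *\<^sub>R (\<Sum>j\<in>J. f j)"
proof -
  have "(\<Sum>i\<in>I. f (p i)) = (\<Sum>j\<in>J. \<Sum>i\<in>{i\<in>I. p i = j}. f (p i))"
    by (rule sum.group[symmetric]) fact+
  also have "\<dots> = (\<Sum>j\<in>J. 2 *\<^sub>R f j)"
    by (rule sum.cong) (auto simp: two sum_constant_scaleR)
  finally show ?thesis by (simp add: scaleR_sum_right)
qed

context interacting_branching_diffusion
begin

text \<open>The part of the Riemann sum that is due to the Brownian motion of one particle. An index \<open>e\<close> is a
  pair of a generation and a label.\<close>

definition noise :: "nat \<Rightarrow> nat \<times> nat \<Rightarrow> 'w \<Rightarrow> real ^ 'd" where
  "noise n e \<omega> = (\<Sum>k<Suc n. exp_weight (\<gamma> + b) n k *\<^sub>R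
     (W (fst e) (snd e) (grid (real (fst e)) n (Suc k)) \<omega> - W (fst e) (snd e) (grid (real (fst e)) n k) \<omega>))"

text \<open>Subtracting the mean of the equations cancels the interaction and leaves \<open>dY = d(W - mean W) - (\<gamma> + b) Y dt\<close>,
  an equation for each particle separately. At the branching time every particle has exactly two
  children, so the centre of mass of the children equals the limit of that of the parents and the
  relative positions are passed on as well.\<close>

lemma relative_system_increment_path:
  assumes \<omega>: "\<omega> \<in> space M"
    and W: "\<And>j. j \<in> {1..2 ^ m} \<Longrightarrow> continuous_on {real m..<real m + 1} (\<lambda>t. W m j t \<omega>)"
    and Z: "\<And>i t. i \<in> {1..2 ^ m} \<Longrightarrow> t \<in> {real m..<real m + 1} \<Longrightarrow>
         ((\<lambda>r. - b *\<^sub>R Z i r \<omega> + (1 / 2 ^ m) *\<^sub>R (\<Sum>j\<in>{1..2 ^ m}. \<gamma> *\<^sub>R (Z j r \<omega> - Z i r \<omega>)))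
            has_integral
          (Z i t \<omega> - Z i (real m) \<omega> - (W m i t \<omega> - W m i (real m) \<omega>))) {real m..t}"
    and br: "\<And>i. i \<in> {1..2 ^ Suc m} \<Longrightarrow>
         ((\<lambda>t. Z (parent m i \<omega>) t \<omega>) \<longlongrightarrow> Z i (real (Suc m)) \<omega>) (at_left (real (Suc m)))"
    and i: "i \<in> {1..2 ^ Suc m}"
  shows "(\<lambda>n. noise n (m, parent m i \<omega>) \<omega> - (1 / 2 ^ m) *\<^sub>R (\<Sum>q\<in>{1..2 ^ m}. noise n (m, q) \<omega>))
    \<longlonglongrightarrow> relative_system Z i (real (Suc m)) \<omega>
        - exp (- (\<gamma> + b)) *\<^sub>R relative_system Z (parent m i \<omega>) (real m) \<omega>"
proof -
  define S where "S = {1..2 ^ m :: nat}"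
  define av where "av f = (1 / 2 ^ m) *\<^sub>R (\<Sum>q\<in>S. f q)" for f :: "nat \<Rightarrow> real ^ 'd"
  have S: "finite S" "card S = 2 ^ m" by (auto simp: S_def)
  have av_const: "av (\<lambda>q. x) = x" for x
    by (simp only: av_def sum_constant_scaleR S) simp
  have av_diff: "av (\<lambda>q. f q - g q) = av f - av g" for f g
    by (simp add: av_def sum_subtractf scaleR_diff_right)
  have av_add: "av (\<lambda>q. f q + g q) = av f + av g" for f g
    by (simp add: av_def sum.distrib scaleR_add_right)
  have av_scale: "av (\<lambda>q. x *\<^sub>R f q) = x *\<^sub>R av f" for f x
    by (simp add: av_def scaleR_sum_right)
  have rel: "relative_system Z j t \<omega> = Z j t \<omega> - av (\<lambda>q. Z q t \<omega>)" if t: "t \<in> {real m..<real m + 1}" for j t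
  proof -
    have "\<lfloor>t\<rfloor> = int m" using t by (simp add: floor_eq_iff)
    then have "nat \<lfloor>t\<rfloor> = m" by simp
    then show ?thesis by (simp add: relative_system_def center_of_mass_def particles_def av_def S_def)
  qed
  define p where "p k = parent m k \<omega>" for k
  define I where "I = {1..2 ^ Suc m :: nat}"
  have p: "p ` I \<subseteq> S" using parent_in[OF _ \<omega>] by (auto simp: p_def I_def S_def)
  have fib: "card {k\<in>I. p k = j} = 2" if "j \<in> S" for j
    using two_offspring[of j m, OF _ \<omega>] that by (simp add: p_def I_def S_def)
  define L where "L j = lim (\<lambda>n. Z j (real (Suc m) - 1 / real (n + 2)) \<omega>)" for j
  have Lp: "L (p k) = Z k (real (Suc m)) \<omega>" if k: "k \<in> I" for k
  proof -
    have "filterlim (\<lambda>n. real (Suc m) - 1 / real (n + 2)) (at_left (real (Suc m))) sequentially"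
      by real_asymp
    moreover have "((\<lambda>t. Z (p k) t \<omega>) \<longlongrightarrow> Z k (real (Suc m)) \<omega>) (at_left (real (Suc m)))"
      using br[of k] k by (simp add: p_def I_def)
    ultimately have "(\<lambda>n. Z (p k) (real (Suc m) - 1 / real (n + 2)) \<omega>) \<longlonglongrightarrow> Z k (real (Suc m)) \<omega>"
      by (rule filterlim_compose[rotated])
    then show ?thesis unfolding L_def by (rule limI)
  qed
  have Llim: "((\<lambda>t. Z j t \<omega>) \<longlongrightarrow> L j) (at_left (real (Suc m)))" if j: "j \<in> S" for j
  proof -
    have "{k\<in>I. p k = j} \<noteq> {}" using fib[OF j] by (metis card.empty zero_neq_numeral)
    then obtain k where k: "k \<in> I" "p k = j" by auto
    then show ?thesis using br[of k] Lp[of k] by (simp add: p_def I_def)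
  qed
  \<comment> \<open>Two children per parent: averaging over the children or over the parents is the same.\<close>
  have avL: "av L = (1 / 2 ^ Suc m) *\<^sub>R (\<Sum>k\<in>I. Z k (real (Suc m)) \<omega>)"
  proof -
    have "(\<Sum>k\<in>I. Z k (real (Suc m)) \<omega>) = (\<Sum>k\<in>I. L (p k))" by (rule sum.cong) (auto simp: Lp)
    also have "\<dots> = 2 *\<^sub>R (\<Sum>j\<in>S. L j)"
      by (rule sum_two_to_one) (use S p fib in \<open>auto simp: I_def\<close>)
    finally show ?thesis by (simp add: av_def)
  qed
  have relS: "relative_system Z i (real (Suc m)) \<omega> = L (p i) - av L"
  proof -
    have "nat \<lfloor>real (Suc m)\<rfloor> = Suc m" by (metis floor_of_nat nat_int)
    then have "particles (real (Suc m)) = I" "center_of_mass Z (real (Suc m)) \<omega> = av L"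
      unfolding avL by (simp_all add: center_of_mass_def particles_def I_def)
    then show ?thesis using Lp[of i] i by (simp add: relative_system_def I_def)
  qed
  define y where "y j t = Z j t \<omega> - av (\<lambda>q. Z q t \<omega>)" for j t
  define w where "w j t = W m j t \<omega> - av (\<lambda>q. W m q t \<omega>)" for j t
  have j: "p i \<in> S" using p i by (auto simp: I_def)
  have "continuous_on {real m..<real m + 1} (w (p i))"
    unfolding w_def av_def using W j by (intro continuous_intros) (auto simp: S_def)
  moreover have "(y (p i) \<longlongrightarrow> L (p i) - av L) (at_left (real m + 1))"
    unfolding y_def av_def using Llim j by (intro tendsto_intros) (auto simp: add.commute)
  moreover have "((\<lambda>r. - (\<gamma> + b) *\<^sub>R y (p i) r) has_integral
      (y (p i) t - y (p i) (real m) - (w (p i) t - w (p i) (real m)))) {real m..t}"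
    if t: "t \<in> {real m..<real m + 1}" for t
  proof -
    define f where "f k r = - b *\<^sub>R Z k r \<omega> + av (\<lambda>q. \<gamma> *\<^sub>R (Z q r \<omega> - Z k r \<omega>))" for k r
    define D where "D k = Z k t \<omega> - Z k (real m) \<omega> - (W m k t \<omega> - W m k (real m) \<omega>)" for k
    have fD: "(f k has_integral D k) {real m..t}" if "k \<in> S" for k
      unfolding f_def D_def av_def S_def by (rule Z) (use that t in \<open>auto simp: S_def\<close>)
    have "((\<lambda>r. f (p i) r - av (\<lambda>k. f k r)) has_integral D (p i) - av D) {real m..t}"
      unfolding av_def
      by (intro has_integral_diff fD[OF j] has_integral_cmul has_integral_sum fD S) simp_all
    moreover have "f (p i) r - av (\<lambda>k. f k r) = - (\<gamma> + b) *\<^sub>R y (p i) r" for r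
      unfolding f_def y_def av_add av_diff av_scale av_const by (simp add: algebra_simps)
    moreover have "D (p i) - av D = y (p i) t - y (p i) (real m) - (w (p i) t - w (p i) (real m))"
      unfolding D_def y_def w_def av_diff by (simp add: algebra_simps)
    ultimately show ?thesis by simp
  qed
  ultimately have "(\<lambda>n. \<Sum>k<Suc n. exp_weight (\<gamma> + b) n k *\<^sub>R (w (p i) (grid (real m) n (Suc k)) - w (p i) (grid (real m) n k)))
    \<longlonglongrightarrow> L (p i) - av L - exp (- (\<gamma> + b)) *\<^sub>R y (p i) (real m)"
    by (rule exp_weight_riemann_limit)
  moreover have "(\<Sum>k<Suc n. exp_weight (\<gamma> + b) n k *\<^sub>R (w (p i) (grid (real m) n (Suc k)) - w (p i) (grid (real m) n k)))
     = noise n (m, p i) \<omega> - av (\<lambda>q. noise n (m, q) \<omega>)" for n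
  proof -
    have "av (\<lambda>q. noise n (m, q) \<omega>) = (\<Sum>k<Suc n. exp_weight (\<gamma> + b) n k *\<^sub>R
       (av (\<lambda>q. W m q (grid (real m) n (Suc k)) \<omega>) - av (\<lambda>q. W m q (grid (real m) n k) \<omega>)))"
      unfolding av_diff[symmetric] av_scale[symmetric] noise_def
      by (simp only: av_def fst_conv snd_conv scaleR_sum_right) (rule sum.swap)
    then show ?thesis
      by (simp only: noise_def w_def fst_conv snd_conv sum_subtractf[symmetric] scaleR_diff_right)
         (simp add: algebra_simps)
  qed
  moreover have "y (p i) (real m) = relative_system Z (p i) (real m) \<omega>"
    by (simp add: rel y_def)
  ultimately show ?thesis by (simp only: relS av_def S_def p_def)
qed

lemma relative_system_increment:
  "AE \<omega> in M. \<forall>m. \<forall>i\<in>{1..2 ^ Suc m}.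
    (\<lambda>n. noise n (m, parent m i \<omega>) \<omega> - (1 / 2 ^ m) *\<^sub>R (\<Sum>q\<in>{1..2 ^ m}. noise n (m, q) \<omega>))
      \<longlonglongrightarrow> relative_system Z i (real (Suc m)) \<omega>
        - exp (- (\<gamma> + b)) *\<^sub>R relative_system Z (parent m i \<omega>) (real m) \<omega>"
proof -
  have "AE \<omega> in M. \<forall>m j. j \<in> {1..2 ^ m} \<longrightarrow> continuous_on {real m..<real m + 1} (\<lambda>t. W m j t \<omega>)"
    unfolding AE_all_countable
    using brownian by (auto simp: standard_brownian_motion_def)
  with sde branching AE_space show ?thesis
  proof eventually_elim
    case (elim \<omega>)
    then show ?case
      by (intro allI ballI relative_system_increment_path) blast+
  qed
qed

end

section \<open>Independence and law of the noise\<close>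

text \<open>A measure space whose measurable sets are \<open>generated_events\<close>, so that measurability
  with respect to these events can be derived by the usual rules.\<close>

definition generated_algebra :: "'w measure \<Rightarrow> 'b measure \<Rightarrow> ('w \<Rightarrow> 'b) set \<Rightarrow> 'w measure" where
  "generated_algebra M N F = sigma (space M) {X -` A \<inter> space M | X A. X \<in> F \<and> A \<in> sets N}"

lemma space_generated_algebra [simp]: "space (generated_algebra M N F) = space M"
  by (simp add: generated_algebra_def space_measure_of_conv)

lemma sets_generated_algebra: "sets (generated_algebra M N F) = generated_events M N F"
  unfolding generated_algebra_def generated_events_def by (rule sets_measure_of) auto

lemma measurable_generated_algebra:
  assumes "X \<in> F" "X \<in> space M \<rightarrow> space N"
  shows "X \<in> generated_algebra M N F \<rightarrow>\<^sub>M N"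
proof (rule measurableI)
  fix A assume "A \<in> sets N"
  then show "X -` A \<inter> space (generated_algebra M N F) \<in> sets (generated_algebra M N F)"
    unfolding sets_generated_algebra unfolding generated_events_def using assms(1)
    by (intro sigma_sets.Basic) auto
qed (use assms(2) in auto)

lemma generated_events_mono: "F \<subseteq> G \<Longrightarrow> generated_events M N F \<subseteq> generated_events M N G"
  unfolding generated_events_def by (rule sigma_sets_mono') auto

lemma generated_events_subset_Pow: "A \<in> generated_events M N F \<Longrightarrow> A \<subseteq> space M"
  using sets.sets_into_space[of A "generated_algebra M N F"] by (simp add: sets_generated_algebra)

definition noise_index :: "nat \<Rightarrow> (nat \<times> nat) set" where
  "noise_index K = (SIGMA m:{..<K}. {1..2 ^ m})"

lemma finite_noise_index [simp]: "finite (noise_index K)"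
  by (simp add: noise_index_def)

lemma prod_Basis_vec:
  fixes x :: "real ^ 'd"
  shows "(\<Prod>b\<in>Basis. f (x \<bullet> b)) = (\<Prod>k\<in>UNIV. f (x $ k))"
proof -
  have B: "(Basis :: (real ^ 'd) set) = (\<lambda>k. axis k 1) ` UNIV" by (auto simp: Basis_vec_def)
  have inj: "inj (\<lambda>k. axis k 1 :: real ^ 'd)" by (auto simp: inj_on_def axis_eq_axis)
  show ?thesis unfolding B by (subst prod.reindex[OF inj]) (simp add: inner_axis)
qed

lemma distr_normal_vector:
  fixes s :: real
  assumes s: "0 < s"
  shows "distr (density lborel (\<lambda>x :: real ^ 'd. ennreal (\<Prod>k\<in>UNIV. normal_density 0 s (x $ k)))) borel (\<lambda>x. (1 / s) *\<^sub>R x)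
    = std_gauss"
proof (rule measure_eqI)
  have [measurable]: "(\<lambda>x :: real ^ 'd. ennreal (\<Prod>k\<in>UNIV. normal_density 0 s (x $ k))) \<in> borel_measurable borel"
    by measurable
  fix A :: "(real ^ 'd) set"
  assume "A \<in> sets (distr (density lborel (\<lambda>x :: real ^ 'd. ennreal (\<Prod>k\<in>UNIV. normal_density 0 s (x $ k)))) borel (\<lambda>x. (1 / s) *\<^sub>R x))"
  then have A [measurable]: "A \<in> sets borel" by simp
  have dens: "s ^ CARD('d) * (\<Prod>k\<in>UNIV. normal_density 0 s ((s *\<^sub>R x) $ k)) = gauss_dens x" for x :: "real ^ 'd"
  proof -
    have nd: "normal_density 0 s (s * z) = (1 / s) * std_normal_density z" for z
      using s by (simp add: normal_density_def power_mult_distrib real_sqrt_mult field_simps)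
    have "(\<Prod>k\<in>UNIV. normal_density 0 s ((s *\<^sub>R x) $ k)) = (1 / s) ^ CARD('d) * (\<Prod>k\<in>UNIV. std_normal_density (x $ k))"
      by (simp only: vector_scaleR_component real_scaleR_def nd prod.distrib) simp
    then show ?thesis using s
      by (simp add: gauss_dens_prod prod_Basis_vec[of std_normal_density] power_one_over)
  qed
  have "emeasure (distr (density lborel (\<lambda>x :: real ^ 'd. ennreal (\<Prod>k\<in>UNIV. normal_density 0 s (x $ k)))) borel (\<lambda>x. (1 / s) *\<^sub>R x)) A
    = (\<integral>\<^sup>+x. ennreal (\<Prod>k\<in>UNIV. normal_density 0 s (x $ k)) * indicator A ((1 / s) *\<^sub>R x) \<partial>lborel)"
    by (subst nn_integral_indicator[symmetric])
       (simp_all add: nn_integral_distr nn_integral_density del: nn_integral_indicator)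
  also have "\<dots> = ennreal (\<bar>s\<bar> ^ CARD('d)) * (\<integral>\<^sup>+x. ennreal (\<Prod>k\<in>UNIV. normal_density 0 s ((0 + s *\<^sub>R x) $ k)) * indicator A ((1 / s) *\<^sub>R (0 + s *\<^sub>R x)) \<partial>lborel)"
    using nn_integral_lborel_affine[where c=s and t="0 :: real ^ 'd" and
       f="\<lambda>x. ennreal (\<Prod>k\<in>UNIV. normal_density 0 s (x $ k)) * indicator A ((1 / s) *\<^sub>R x)"] s
    by simp
  also have "\<dots> = (\<integral>\<^sup>+x. ennreal (gauss_dens x) * indicator A x \<partial>lborel)"
    using s by (subst nn_integral_cmult[symmetric])
      (auto simp: dens[symmetric] ennreal_mult prod_nonneg mult.assoc intro!: nn_integral_cong)
  also have "\<dots> = emeasure std_gauss A" by (simp add: std_gauss_def emeasure_density)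
  finally show "emeasure (distr (density lborel (\<lambda>x :: real ^ 'd. ennreal (\<Prod>k\<in>UNIV. normal_density 0 s (x $ k)))) borel (\<lambda>x. (1 / s) *\<^sub>R x)) A
     = emeasure std_gauss A" .
qed simp

lemma (in prob_space) unit_combination_law:
  fixes X :: "'e \<Rightarrow> 'a \<Rightarrow> 'b::euclidean_space"
  assumes E: "finite E" "indep_vars (\<lambda>_. borel) X E" "\<And>e. e \<in> E \<Longrightarrow> distr M borel (X e) = std_gauss"
    and unit: "(\<Sum>e\<in>E. (a e)\<^sup>2) = 1"
  shows "distr M borel (\<lambda>\<omega>. \<Sum>e\<in>E. a e *\<^sub>R X e \<omega>) = std_gauss"
proof (rule measure_eqI)
  have rv [measurable]: "random_variable borel (X i)" if "i \<in> E" for i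
    using E that by (auto simp: indep_vars_def)
  fix A assume "A \<in> sets (distr M borel (\<lambda>\<omega>. \<Sum>e\<in>E. a e *\<^sub>R X e \<omega>))"
  then have A [measurable]: "A \<in> sets borel" by simp
  have AU: "A \<times> UNIV \<in> sets (borel :: ('b \<times> 'b) measure)"
    unfolding borel_prod[symmetric] by measurable
  have m [measurable]: "(\<lambda>\<omega>. (\<Sum>e\<in>E. a e *\<^sub>R X e \<omega>, \<Sum>e\<in>E. (0::real) *\<^sub>R X e \<omega>)) \<in> M \<rightarrow>\<^sub>M borel"
    unfolding borel_prod[symmetric] by measurable
  have "emeasure (distr M borel (\<lambda>\<omega>. \<Sum>e\<in>E. a e *\<^sub>R X e \<omega>)) A
    = emeasure (distr M borel (\<lambda>\<omega>. (\<Sum>e\<in>E. a e *\<^sub>R X e \<omega>, \<Sum>e\<in>E. 0 *\<^sub>R X e \<omega>))) (A \<times> UNIV)"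
    using AU by (subst (1 2) emeasure_distr) (auto intro!: arg_cong2[where f=emeasure])
  also have "\<dots> = emeasure (bigauss 1 0) (A \<times> UNIV)"
    using orthogonal_combinations_law[OF E, of a "\<lambda>_. 0"] unit by simp
  also have "\<dots> = emeasure std_gauss A"
    using AU by (simp add: emeasure_bigauss indicator_times std_gauss.emeasure_space_1[simplified])
  finally show "emeasure (distr M borel (\<lambda>\<omega>. \<Sum>e\<in>E. a e *\<^sub>R X e \<omega>)) A = emeasure std_gauss A" .
qed simp

text \<open>The standard deviation of each coordinate of \<open>noise n e\<close>.\<close>

definition noise_sd :: "real \<Rightarrow> nat \<Rightarrow> real" where
  "noise_sd c n = sqrt (\<Sum>k<Suc n. (exp_weight c n k)\<^sup>2 / real (n + 2))"

lemma noise_sd_pos: "0 < noise_sd c n"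
  unfolding noise_sd_def by (intro real_sqrt_gt_zero sum_pos) (auto simp: exp_weight_def)

lemma noise_sd_limit:
  assumes "0 < c"
  shows "noise_sd c \<longlonglongrightarrow> sqrt ((1 - exp (- 2 * c)) / (2 * c))"
  unfolding noise_sd_def by (intro tendsto_real_sqrt exp_weight_variance_limit assms)

context interacting_branching_diffusion
begin

definition motion_events :: "nat \<times> nat \<Rightarrow> 'w set set" where
  "motion_events e = generated_events M borel
     {W (fst e) (snd e) t | t. t \<in> {real (fst e)..<real (fst e) + 1}}"

text \<open>Within a generation independence is assumed; across generations it follows by adding one
  generation at a time, since each is independent of its past.\<close>

lemma indep_sets_motion_events: "indep_sets motion_events (noise_index K)"
proof (induction K)
  case 0
  show ?case by (rule indep_setsI) (auto simp: noise_index_def)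
next
  case (Suc K)
  let ?now = "generated_events M borel {W K i t | i t. i \<in> {1..2 ^ K} \<and> t \<in> {real K..<real K + 1}}"
  let ?past = "generated_events M borel
            ({Z i t | i t. t \<in> {0..real K} \<and> i \<in> particles t} \<union>
             {W k i t | k i t. k < K \<and> i \<in> {1..2 ^ k} \<and> t \<in> {real k..<real k + 1}})"
  interpret now: sigma_algebra "space M" ?now
    unfolding generated_events_def by (rule sigma_algebra_sigma_sets) auto
  interpret past: sigma_algebra "space M" ?past
    unfolding generated_events_def by (rule sigma_algebra_sigma_sets) auto
  have now: "motion_events (K, j) \<subseteq> ?now" if "j \<in> {1..2 ^ K}" for j
    unfolding motion_events_def using that by (intro generated_events_mono) auto
  have past: "motion_events e \<subseteq> ?past" if "e \<in> noise_index K" for e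
    unfolding motion_events_def using that by (intro generated_events_mono) (auto simp: noise_index_def)
  have indep: "indep_set ?now ?past" by (rule brownian_indep_past)
  have indep_now: "indep_sets (\<lambda>j. motion_events (K, j)) {1..2 ^ K}"
    using brownian_indep[of K] by (simp add: motion_events_def)
  have ix: "noise_index (Suc K) = noise_index K \<union> Pair K ` {1..2 ^ K}"
    by (auto simp: noise_index_def less_Suc_eq)
  show ?case
  proof (rule indep_setsI)
    fix e assume "e \<in> noise_index (Suc K)"
    then show "motion_events e \<subseteq> events"
      using now past indep_setD_ev1[OF indep] indep_setD_ev2[OF indep] unfolding ix by blast
  next
    fix A J assume J: "J \<noteq> {}" "J \<subseteq> noise_index (Suc K)" "finite J" and A: "\<forall>j\<in>J. A j \<in> motion_events j"
    define P where "P = J \<inter> noise_index K"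
    define N where "N = {j \<in> {1..2 ^ K}. (K, j) \<in> J}"
    have JPN: "J = P \<union> Pair K ` N" using J(2) unfolding ix P_def N_def by auto
    have disj: "P \<inter> Pair K ` N = {}" by (auto simp: P_def noise_index_def)
    have finP: "finite P" and finN: "finite N" using J(3) by (auto simp: P_def N_def)
    define AP where "AP = space M \<inter> (\<Inter>j\<in>P. A j)"
    define AN where "AN = space M \<inter> (\<Inter>j\<in>N. A (K, j))"
    have AP: "AP \<in> ?past \<and> prob AP = (\<Prod>j\<in>P. prob (A j))"
    proof (cases "P = {}")
      case False
      have 1: "(\<Inter>j\<in>P. A j) \<in> ?past"
        using A past finP False by (intro past.finite_INT) (auto simp: P_def)
      then have "AP = (\<Inter>j\<in>P. A j)" unfolding AP_def using past.space_closed by blast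
      moreover have "prob (\<Inter>j\<in>P. A j) = (\<Prod>j\<in>P. prob (A j))"
        using A False finP by (intro indep_setsD[OF Suc.IH]) (auto simp: P_def)
      ultimately show ?thesis using 1 by simp
    next
      case True
      then have "AP = space M" by (simp add: AP_def)
      then show ?thesis using past.top True prob_space by simp
    qed
    have AN: "AN \<in> ?now \<and> prob AN = (\<Prod>j\<in>N. prob (A (K, j)))"
    proof (cases "N = {}")
      case False
      have 1: "(\<Inter>j\<in>N. A (K, j)) \<in> ?now"
        using A now finN False by (intro now.finite_INT) (auto simp: N_def)
      then have "AN = (\<Inter>j\<in>N. A (K, j))" unfolding AN_def using now.space_closed by blast
      moreover have "prob (\<Inter>j\<in>N. A (K, j)) = (\<Prod>j\<in>N. prob (A (K, j)))"
        using A False finN by (intro indep_setsD[OF indep_now]) (auto simp: N_def)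
      ultimately show ?thesis using 1 by simp
    next
      case True
      then have "AN = space M" by (simp add: AN_def)
      then show ?thesis using now.top True prob_space by simp
    qed
    have "A j \<subseteq> space M" if "j \<in> J" for j
      using A that generated_events_subset_Pow unfolding motion_events_def by blast
    then have "(\<Inter>j\<in>J. A j) \<subseteq> space M" using J(1) by blast
    then have "(\<Inter>j\<in>J. A j) = AN \<inter> AP"
      unfolding AN_def AP_def JPN by blast
    then have "prob (\<Inter>j\<in>J. A j) = prob AN * prob AP"
      using indep_setD[OF indep] AN AP by simp
    also have "\<dots> = (\<Prod>j\<in>P. prob (A j)) * (\<Prod>j\<in>Pair K ` N. prob (A j))"
      using AN AP by (simp add: prod.reindex inj_on_def)
    also have "\<dots> = (\<Prod>j\<in>J. prob (A j))"
      unfolding JPN using finP finN disj by (intro prod.union_disjoint[symmetric]) auto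
    finally show "prob (\<Inter>j\<in>J. A j) = (\<Prod>j\<in>J. prob (A j))" .
  qed
qed

text \<open>Normalising the noise makes its law independent of \<open>n\<close>, so that almost sure limits as \<open>n\<close> grows
  inherit the law.\<close>

definition unit_noise :: "nat \<Rightarrow> nat \<times> nat \<Rightarrow> 'w \<Rightarrow> real ^ 'd" where
  "unit_noise n e \<omega> = (1 / noise_sd (\<gamma> + b) n) *\<^sub>R noise n e \<omega>"

lemma unit_noise_measurable_generated:
  assumes "\<And>t. t \<in> {real (fst e)..<real (fst e) + 1} \<Longrightarrow> W (fst e) (snd e) t \<in> F"
  shows "unit_noise n e \<in> borel_measurable (generated_algebra M borel F)"
proof -
  have [measurable]: "W (fst e) (snd e) (grid (real (fst e)) n k) \<in> borel_measurable (generated_algebra M borel F)"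
    if "k \<le> Suc n" for k
    by (intro measurable_generated_algebra assms grid_mem that) auto
  show ?thesis unfolding unit_noise_def[abs_def] noise_def by measurable
qed

lemma unit_noise_measurable [measurable]:
  assumes "e \<in> noise_index K"
  shows "random_variable borel (unit_noise n e)"
proof -
  have *: "standard_brownian_motion (real (fst e)) (real (fst e) + 1) (W (fst e) (snd e))"
    using assms by (intro brownian) (auto simp: noise_index_def)
  have [measurable]: "W (fst e) (snd e) (grid (real (fst e)) n k) \<in> borel_measurable M"
    if "k \<le> Suc n" for k
    using * grid_mem[OF that] by (simp add: standard_brownian_motion_def)
  show ?thesis unfolding unit_noise_def[abs_def] noise_def by measurable
qed

lemma indep_vars_unit_noise: "indep_vars (\<lambda>_. borel) (unit_noise n) (noise_index K)"
  unfolding indep_vars_def2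
proof (intro conjI ballI)
  show "indep_sets (\<lambda>e. {unit_noise n e -` A \<inter> space M |A. A \<in> sets borel}) (noise_index K)"
  proof (rule indep_sets_mono_sets[OF indep_sets_motion_events])
    fix e assume "e \<in> noise_index K"
    have "unit_noise n e \<in> borel_measurable (generated_algebra M borel {W (fst e) (snd e) t | t. t \<in> {real (fst e)..<real (fst e) + 1}})"
      by (rule unit_noise_measurable_generated) auto
    from measurable_sets[OF this]
    show "{unit_noise n e -` A \<inter> space M |A. A \<in> sets borel} \<subseteq> motion_events e"
      by (auto simp: sets_generated_algebra motion_events_def)
  qed
qed (rule unit_noise_measurable)

text \<open>A combination of independent Brownian increments whose coefficients are normalised to unit length.\<close>

lemma distr_unit_noise:
  assumes e: "e \<in> noise_index K"
  shows "distr M borel (unit_noise n e) = std_gauss"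
proof -
  define c where "c = \<gamma> + b"
  define g where "g = grid (real (fst e)) n"
  define V where "V = W (fst e) (snd e)"
  define N where "N = real (n + 2)"
  have N: "0 < N" by (simp add: N_def)
  have bm: "standard_brownian_motion (real (fst e)) (real (fst e) + 1) V"
    unfolding V_def using e by (intro brownian) (auto simp: noise_index_def)
  have gm: "g k \<in> {real (fst e)..<real (fst e) + 1}" if "k \<le> Suc n" for k
    unfolding g_def by (rule grid_mem[OF that])
  have gs: "g (Suc k) - g k = 1 / N" for k unfolding g_def N_def by (rule grid_step)
  have gl: "g k < g (Suc k)" for k using gs[of k] N zero_less_divide_1_iff[of N] by linarith
  define D where "D k \<omega> = V (g (Suc k)) \<omega> - V (g k) \<omega>" for k \<omega>
  define X where "X k \<omega> = sqrt N *\<^sub>R D k \<omega>" for k \<omega>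
  have "indep_vars (\<lambda>_. borel) D {..<Suc n}"
    unfolding D_def using bm gm gl unfolding standard_brownian_motion_def by blast
  then have indep: "indep_vars (\<lambda>_. borel) X {..<Suc n}"
    unfolding X_def by (rule indep_vars_compose2) measurable
  have law: "distr M borel (X k) = std_gauss" if k: "k \<in> {..<Suc n}" for k
  proof -
    have "distributed M lborel (D k)
          (\<lambda>x. ennreal (\<Prod>l\<in>UNIV. normal_density 0 (sqrt (g (Suc k) - g k)) (x $ l)))"
      unfolding D_def using bm gm[of k] gm[of "Suc k"] gl[of k] k
      unfolding standard_brownian_motion_def by auto
    then have D: "distr M lborel (D k) = density lborel (\<lambda>x. ennreal (\<Prod>l\<in>UNIV. normal_density 0 (sqrt (1 / N)) (x $ l)))"
      and [measurable]: "D k \<in> borel_measurable M"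
      by (auto simp: distributed_def gs)
    have "distr M borel (X k) = distr (distr M lborel (D k)) borel (\<lambda>x. (1 / sqrt (1 / N)) *\<^sub>R x)"
      using N by (subst distr_distr) (auto simp: comp_def X_def[abs_def] real_sqrt_divide)
    also have "\<dots> = std_gauss" unfolding D using N by (intro distr_normal_vector) simp
    finally show ?thesis .
  qed
  define a where "a k = exp_weight c n k / (noise_sd c n * sqrt N)" for k
  have sd2: "(noise_sd c n)\<^sup>2 = (\<Sum>k<Suc n. (exp_weight c n k)\<^sup>2 / N)"
    unfolding noise_sd_def N_def by (rule real_sqrt_pow2) (intro sum_nonneg, simp)
  have "(\<Sum>k<Suc n. (a k)\<^sup>2) = (\<Sum>k<Suc n. (exp_weight c n k)\<^sup>2 / N) / (noise_sd c n)\<^sup>2"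
    unfolding a_def sum_divide_distrib using N
    by (intro sum.cong) (simp_all add: power_divide power_mult_distrib mult.commute)
  then have unit: "(\<Sum>k\<in>{..<Suc n}. (a k)\<^sup>2) = 1"
    unfolding sd2[symmetric] using noise_sd_pos[of c n] by simp
  have "unit_noise n e \<omega> = (\<Sum>k\<in>{..<Suc n}. a k *\<^sub>R X k \<omega>)" for \<omega>
    unfolding unit_noise_def noise_def scaleR_sum_right using N
    by (intro sum.cong) (simp_all add: a_def X_def D_def V_def g_def c_def)
  then have "unit_noise n e = (\<lambda>\<omega>. \<Sum>k\<in>{..<Suc n}. a k *\<^sub>R X k \<omega>)" by blast
  then show ?thesis using unit_combination_law[OF _ indep law unit] by simp
qed

end

section \<open>Covariances along a genealogy\<close>

text \<open>For a fixed genealogy, with \<open>p m i\<close> the parent in generation \<open>m\<close> of particle \<open>i\<close> in generation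
  \<open>m + 1\<close>, the relative position of particle \<open>i\<close> is a linear combination of the noises of all earlier
  particles: it is inherited from the parent with decay \<open>\<rho>\<close>, plus the noise of the parent, minus
  the mean noise of the generation of the parent.\<close>

fun coef :: "real \<Rightarrow> (nat \<Rightarrow> nat \<Rightarrow> nat) \<Rightarrow> nat \<Rightarrow> nat \<Rightarrow> nat \<times> nat \<Rightarrow> real" where
  "coef \<rho> p 0 i e = 0"
| "coef \<rho> p (Suc m) i e = \<rho> * coef \<rho> p m (p m i) e
     + (if fst e = m then of_bool (snd e = p m i) - 1 / 2 ^ m else 0)"

text \<open>The covariance of two particles of generation \<open>m\<close>, in units of the noise variance.\<close>

definition gram :: "real \<Rightarrow> (nat \<Rightarrow> nat \<Rightarrow> nat) \<Rightarrow> nat \<Rightarrow> nat \<Rightarrow> nat \<Rightarrow> real" where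
  "gram \<rho> p m i j = (\<Sum>e\<in>noise_index m. coef \<rho> p m i e * coef \<rho> p m j e)"

text \<open>The common variance of all particles of generation \<open>m\<close>, in units of the noise variance.\<close>

fun sq_norm_coef :: "real \<Rightarrow> nat \<Rightarrow> real" where
  "sq_norm_coef \<rho> 0 = 0"
| "sq_norm_coef \<rho> (Suc m) = \<rho>\<^sup>2 * sq_norm_coef \<rho> m + (1 - 1 / 2 ^ m)"

text \<open>Solves the recursion for an upper bound on the average of \<open>\<bar>gram\<bar>\<close> over all pairs.\<close>

fun gram_bound :: "real \<Rightarrow> nat \<Rightarrow> real" where
  "gram_bound \<rho> 0 = 0"
| "gram_bound \<rho> (Suc m) = \<rho>\<^sup>2 * gram_bound \<rho> m + 2 / 2 ^ m"

definition genealogy :: "nat \<Rightarrow> (nat \<Rightarrow> nat \<Rightarrow> nat) \<Rightarrow> bool" where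
  "genealogy m p \<longleftrightarrow> (\<forall>l<m. (\<forall>i\<in>{1..2 ^ Suc l}. p l i \<in> {1..2 ^ l}) \<and>
     (\<forall>j\<in>{1..2 ^ l}. card {i \<in> {1..2 ^ Suc l}. p l i = j} = 2))"

lemma genealogy_Suc: "genealogy (Suc m) p \<Longrightarrow> genealogy m p"
  by (simp add: genealogy_def)

lemma genealogy_parent: "genealogy (Suc m) p \<Longrightarrow> i \<in> {1..2 ^ Suc m} \<Longrightarrow> p m i \<in> {1..2 ^ m}"
  unfolding genealogy_def by blast

lemma noise_index_Suc: "noise_index (Suc m) = noise_index m \<union> Pair m ` {1..2 ^ m}"
  by (auto simp: noise_index_def less_Suc_eq)

lemma coef_eq_0: "m \<le> fst e \<Longrightarrow> coef \<rho> p m i e = 0"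
  by (induction m arbitrary: i) auto

lemma coef_cong:
  assumes "\<And>l i. l < m \<Longrightarrow> i \<in> {1..2 ^ Suc l} \<Longrightarrow> p l i = p' l i"
    and "genealogy m p" "i \<in> {1..2 ^ m}"
  shows "coef \<rho> p m i e = coef \<rho> p' m i e"
  using assms
proof (induction m arbitrary: i)
  case (Suc m)
  have "p m i = p' m i" using Suc.prems(3) by (intro Suc.prems(1)) auto
  moreover have "coef \<rho> p m (p m i) e = coef \<rho> p' m (p m i) e"
  proof (rule Suc.IH)
    show "p l k = p' l k" if "l < m" "k \<in> {1..2 ^ Suc l}" for l k
      using that by (intro Suc.prems(1)) auto
  qed (use genealogy_parent[OF Suc.prems(2,3)] genealogy_Suc[OF Suc.prems(2)] in auto)
  ultimately show ?case by simp
qed simp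

lemma sum_noise_index_Suc:
  "(\<Sum>e\<in>noise_index (Suc m). f e) = (\<Sum>e\<in>noise_index m. f e) + (\<Sum>q\<in>{1..2 ^ m}. f (m, q))"
proof -
  have "noise_index m \<inter> Pair m ` {1..2 ^ m} = {}" by (auto simp: noise_index_def)
  then show ?thesis unfolding noise_index_Suc
    by (subst sum.union_disjoint) (auto simp: sum.reindex inj_on_def)
qed

text \<open>The recursion of the coefficients, read as the recursion of the positions.\<close>

lemma combination_Suc:
  fixes X :: "nat \<times> nat \<Rightarrow> 'c::real_vector"
  assumes "p m i \<in> {1..2 ^ m}"
  shows "(\<Sum>e\<in>noise_index (Suc m). coef \<rho> p (Suc m) i e *\<^sub>R X e)
    = \<rho> *\<^sub>R (\<Sum>e\<in>noise_index m. coef \<rho> p m (p m i) e *\<^sub>R X e)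
      + (X (m, p m i) - (1 / 2 ^ m) *\<^sub>R (\<Sum>q\<in>{1..2 ^ m}. X (m, q)))"
proof -
  have "(\<Sum>e\<in>noise_index m. coef \<rho> p (Suc m) i e *\<^sub>R X e)
     = (\<Sum>e\<in>noise_index m. \<rho> *\<^sub>R coef \<rho> p m (p m i) e *\<^sub>R X e)"
    by (rule sum.cong) (auto simp: noise_index_def)
  moreover have "(\<Sum>q\<in>{1..2 ^ m}. coef \<rho> p (Suc m) i (m, q) *\<^sub>R X (m, q))
     = (\<Sum>q\<in>{1..2 ^ m}. (if q = p m i then X (m, q) else 0) - (1 / 2 ^ m) *\<^sub>R X (m, q))"
    by (rule sum.cong) (auto simp: coef_eq_0 scaleR_diff_left)
  ultimately show ?thesis using assms
    by (simp add: sum_noise_index_Suc sum_subtractf scaleR_sum_right del: coef.simps)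
qed

text \<open>The noise of a generation minus its mean has covariance \<open>\<delta> - 2\<^bsup>-m\<^esup>\<close>, and it is orthogonal to
  the noise of earlier generations.\<close>

lemma gram_Suc:
  assumes i: "p m i \<in> {1..2 ^ m}" and j: "p m j \<in> {1..2 ^ m}"
  shows "gram \<rho> p (Suc m) i j = \<rho>\<^sup>2 * gram \<rho> p m (p m i) (p m j) + (of_bool (p m i = p m j) - 1 / 2 ^ m)"
proof -
  define N where "N = (2::real) ^ m"
  have N: "N \<noteq> 0" by (simp add: N_def)
  have "(\<Sum>e\<in>noise_index m. coef \<rho> p (Suc m) i e * coef \<rho> p (Suc m) j e)
     = (\<Sum>e\<in>noise_index m. \<rho>\<^sup>2 * (coef \<rho> p m (p m i) e * coef \<rho> p m (p m j) e))"
  proof (rule sum.cong[OF refl])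
    fix e assume "e \<in> noise_index m"
    then have "fst e \<noteq> m" by (auto simp: noise_index_def)
    then show "coef \<rho> p (Suc m) i e * coef \<rho> p (Suc m) j e
      = \<rho>\<^sup>2 * (coef \<rho> p m (p m i) e * coef \<rho> p m (p m j) e)"
      by (simp add: power2_eq_square)
  qed
  moreover have "(\<Sum>q\<in>{1..2 ^ m}. coef \<rho> p (Suc m) i (m, q) * coef \<rho> p (Suc m) j (m, q))
     = of_bool (p m i = p m j) - 1 / N"
  proof -
    have "(\<Sum>q\<in>{1..2 ^ m}. coef \<rho> p (Suc m) i (m, q) * coef \<rho> p (Suc m) j (m, q))
      = (\<Sum>q\<in>{1..2 ^ m}. (if q = p m i then of_bool (p m i = p m j) - 1 / N else 0)
           - (if q = p m j then 1 / N else 0) + 1 / N * (1 / N))"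
    proof (rule sum.cong[OF refl])
      fix q :: nat
      have "(of_bool (q = x) - 1 / N) * (of_bool (q = z) - 1 / N)
        = (if q = x then of_bool (x = z) - 1 / N else 0) - (if q = z then 1 / N else 0) + 1 / N * (1 / N)" for x z :: nat
        by (cases "q = x"; cases "q = z") (simp_all add: algebra_simps)
      then show "coef \<rho> p (Suc m) i (m, q) * coef \<rho> p (Suc m) j (m, q)
        = (if q = p m i then of_bool (p m i = p m j) - 1 / N else 0)
           - (if q = p m j then 1 / N else 0) + 1 / N * (1 / N)"
        by (simp only: coef.simps coef_eq_0 fst_conv snd_conv order_refl N_def[symmetric]) simp
    qed
    also have "\<dots> = of_bool (p m i = p m j) - 1 / N - 1 / N + N * (1 / N * (1 / N))"
      using i j by (simp add: sum.distrib sum_subtractf N_def)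
    finally show ?thesis using N by simp
  qed
  ultimately show ?thesis
    by (simp add: gram_def sum_noise_index_Suc sum_distrib_left N_def del: coef.simps)
qed

lemma gram_self:
  assumes "genealogy m p" "i \<in> {1..2 ^ m}"
  shows "gram \<rho> p m i i = sq_norm_coef \<rho> m"
  using assms
proof (induction m arbitrary: i)
  case 0
  then show ?case by (simp add: gram_def noise_index_def)
next
  case (Suc m)
  then show ?case
    using genealogy_parent[OF Suc.prems] genealogy_Suc[OF Suc.prems(1)] by (simp add: gram_Suc)
qed

lemma sum_sum_two_to_one:
  fixes f :: "nat \<Rightarrow> nat \<Rightarrow> real"
  assumes "genealogy (Suc m) p"
  shows "(\<Sum>i\<in>{1..2 ^ Suc m}. \<Sum>j\<in>{1..2 ^ Suc m}. f (p m i) (p m j))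
    = 4 * (\<Sum>i\<in>{1..2 ^ m}. \<Sum>j\<in>{1..2 ^ m}. f i j)"
proof -
  have p: "p m ` {1..2 ^ Suc m} \<subseteq> {1..2 ^ m}" using genealogy_parent[OF assms] by blast
  have fib: "card {i \<in> {1..2 ^ Suc m}. p m i = j} = 2" if "j \<in> {1..2 ^ m}" for j
    using assms that unfolding genealogy_def by blast
  have two: "(\<Sum>i\<in>{1..2 ^ Suc m}. g (p m i)) = 2 * (\<Sum>j\<in>{1..2 ^ m}. g j)" for g :: "nat \<Rightarrow> real"
    using sum_two_to_one[of _ _ "p m" g, OF _ _ p fib] by simp
  have "(\<Sum>i\<in>{1..2 ^ Suc m}. \<Sum>j\<in>{1..2 ^ Suc m}. f (p m i) (p m j))
    = (\<Sum>i\<in>{1..2 ^ Suc m}. 2 * (\<Sum>j\<in>{1..2 ^ m}. f (p m i) j))"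
    by (rule sum.cong[OF refl]) (rule two)
  also have "\<dots> = 2 * (\<Sum>i\<in>{1..2 ^ m}. 2 * (\<Sum>j\<in>{1..2 ^ m}. f i j))"
    by (rule two)
  finally show ?thesis by (simp add: sum_distrib_left)
qed

text \<open>Each pair of parents has four pairs of children, so passing from one generation to the next
  the average of \<open>\<bar>gram\<bar>\<close> shrinks by \<open>\<rho>\<^sup>2\<close>, apart from a contribution of the diagonal and of the
  mean noise, each of average \<open>2\<^bsup>-m\<^esup>\<close>.\<close>

lemma sum_gram_le:
  assumes "genealogy m p"
  shows "(\<Sum>i\<in>{1..2 ^ m}. \<Sum>j\<in>{1..2 ^ m}. \<bar>gram \<rho> p m i j\<bar>) \<le> 4 ^ m * gram_bound \<rho> m"
  using assms
proof (induction m)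
  case 0
  show ?case by (simp add: gram_def noise_index_def)
next
  case (Suc m)
  have "(\<Sum>i\<in>{1..2 ^ Suc m}. \<Sum>j\<in>{1..2 ^ Suc m}. \<bar>gram \<rho> p (Suc m) i j\<bar>)
     \<le> (\<Sum>i\<in>{1..2 ^ Suc m}. \<Sum>j\<in>{1..2 ^ Suc m}. \<rho>\<^sup>2 * \<bar>gram \<rho> p m (p m i) (p m j)\<bar>
        + ((if p m j = p m i then 1 else 0) + 1 / 2 ^ m))"
  proof (intro sum_mono)
    fix i j :: nat assume ij: "i \<in> {1..2 ^ Suc m}" "j \<in> {1..2 ^ Suc m}"
    have "\<bar>\<rho>\<^sup>2 * gram \<rho> p m (p m i) (p m j)\<bar> = \<rho>\<^sup>2 * \<bar>gram \<rho> p m (p m i) (p m j)\<bar>"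
      by (simp add: abs_mult)
    moreover have "\<bar>of_bool (p m i = p m j) - 1 / 2 ^ m :: real\<bar> \<le> (if p m j = p m i then 1 else 0) + 1 / 2 ^ m"
      by (auto simp: abs_le_iff)
    ultimately show "\<bar>gram \<rho> p (Suc m) i j\<bar> \<le> \<rho>\<^sup>2 * \<bar>gram \<rho> p m (p m i) (p m j)\<bar>
        + ((if p m j = p m i then 1 else 0) + 1 / 2 ^ m)"
      using gram_Suc[where p=p and m=m and i=i and j=j and \<rho>=\<rho>,
          OF genealogy_parent[OF Suc.prems ij(1)] genealogy_parent[OF Suc.prems ij(2)]]
      by linarith
  qed
  also have "\<dots> = 4 * (\<Sum>i\<in>{1..2 ^ m}. \<Sum>j\<in>{1..2 ^ m}. \<rho>\<^sup>2 * \<bar>gram \<rho> p m i j\<bar> + ((if j = i then 1 else 0) + 1 / 2 ^ m))"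
    by (rule sum_sum_two_to_one[OF Suc.prems, of "\<lambda>i j. \<rho>\<^sup>2 * \<bar>gram \<rho> p m i j\<bar> + ((if j = i then 1 else 0) + 1 / 2 ^ m)"])
  also have "\<dots> = 4 * (\<rho>\<^sup>2 * (\<Sum>i\<in>{1..2 ^ m}. \<Sum>j\<in>{1..2 ^ m}. \<bar>gram \<rho> p m i j\<bar>) + 2 * 2 ^ m)"
    by (simp add: sum.distrib sum_distrib_left)
  also have "\<dots> \<le> 4 * (\<rho>\<^sup>2 * (4 ^ m * gram_bound \<rho> m) + 2 * 2 ^ m)"
    using Suc.IH[OF genealogy_Suc[OF Suc.prems]] by (intro mult_left_mono add_right_mono) auto
  also have "\<dots> = 4 ^ Suc m * gram_bound \<rho> (Suc m)"
  proof -
    have "(4::real) ^ m = 2 ^ m * 2 ^ m" by (simp add: power_mult_distrib[symmetric])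
    then have "(4::real) ^ m * (2 / 2 ^ m) = 2 * 2 ^ m" by simp
    then show ?thesis by (simp only: gram_bound.simps power_Suc distrib_left mult.assoc mult.left_commute)
  qed
  finally show ?case .
qed

lemma gram_bound_nonneg: "0 \<le> gram_bound \<rho> m"
  by (induction m) auto

lemma sq_norm_coef_nonneg: "0 \<le> sq_norm_coef \<rho> m"
  by (induction m) auto

text \<open>From generation 2 on the relative positions are nondegenerate; in generations 0 and 1
  they vanish.\<close>

lemma sq_norm_coef_ge_half: "2 \<le> m \<Longrightarrow> 1 / 2 \<le> sq_norm_coef \<rho> m"
proof -
  assume "2 \<le> m"
  then obtain k where m: "m = Suc (Suc k)" by (metis add_2_eq_Suc le_Suc_ex)
  have "(1::real) \<le> 2 ^ k" by simp
  then have "(1 / 2 :: real) \<le> 1 - 1 / 2 ^ Suc k" by (simp add: field_simps)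
  moreover have "0 \<le> \<rho>\<^sup>2 * sq_norm_coef \<rho> (Suc k)"
    by (intro mult_nonneg_nonneg sq_norm_coef_nonneg) auto
  ultimately show ?thesis unfolding m sq_norm_coef.simps(2)[of \<rho> "Suc k"] by linarith
qed

lemma summable_gram_bound:
  assumes "\<rho>\<^sup>2 < 1"
  shows "summable (gram_bound \<rho>)"
proof (rule summableI_nonneg_bounded)
  fix n
  show "0 \<le> gram_bound \<rho> n" by (rule gram_bound_nonneg)
  show "(\<Sum>m<n. gram_bound \<rho> m) \<le> 4 / (1 - \<rho>\<^sup>2)"
  proof (induction n)
    case 0
    show ?case using assms by simp
  next
    case (Suc n)
    have "(\<Sum>m<Suc n. gram_bound \<rho> m) = (\<Sum>m<n. gram_bound \<rho> (Suc m))"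
      by (subst sum.lessThan_Suc_shift) simp
    also have "\<dots> = \<rho>\<^sup>2 * (\<Sum>m<n. gram_bound \<rho> m) + 2 * (\<Sum>m<n. (1 / 2) ^ m)"
      by (simp add: sum.distrib sum_distrib_left power_one_over)
    also have "(\<Sum>m<n. (1 / 2 :: real) ^ m) = 2 * (1 - (1 / 2) ^ n)"
      by (induction n) (simp_all add: algebra_simps)
    also have "\<rho>\<^sup>2 * (\<Sum>m<n. gram_bound \<rho> m) + 2 * (2 * (1 - (1 / 2) ^ n)) \<le> \<rho>\<^sup>2 * (4 / (1 - \<rho>\<^sup>2)) + 4"
      using Suc.IH by (intro add_mono mult_left_mono) auto
    also have "\<dots> = 4 / (1 - \<rho>\<^sup>2)" using assms by (simp add: field_simps)
    finally show ?case .
  qed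
qed

text \<open>Genealogies up to generation \<open>m\<close>, made unique by the default value 0 outside the relevant labels.\<close>

definition tables :: "nat \<Rightarrow> (nat \<Rightarrow> nat \<Rightarrow> nat) set" where
  "tables m = {p. genealogy m p \<and> (\<forall>l i. \<not> (l < m \<and> i \<in> {1..2 ^ Suc l}) \<longrightarrow> p l i = 0)}"

lemma finite_tables: "finite (tables m)"
proof -
  define D :: "(nat \<times> nat) set" where "D = (SIGMA l:{..<m}. {1..2 ^ Suc l})"
  define F where "F = PiE D (\<lambda>(l, i). {1..2 ^ l :: nat})"
  have "finite F" unfolding F_def D_def by (intro finite_PiE) auto
  moreover have "tables m \<subseteq> (\<lambda>f l i. if (l, i) \<in> D then f (l, i) else 0) ` F"
  proof
    fix p assume p: "p \<in> tables m"
    have zero: "p l i = 0" if "(l, i) \<notin> D" for l i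
      using p that unfolding tables_def D_def by blast
    have mem: "p l i \<in> {1..2 ^ l}" if "(l, i) \<in> D" for l i
    proof -
      have "l < m" "i \<in> {1..2 ^ Suc l}" using that by (simp_all add: D_def)
      moreover have "genealogy m p" using p by (simp add: tables_def)
      ultimately show ?thesis unfolding genealogy_def by blast
    qed
    have "restrict (\<lambda>(l, i). p l i) D \<in> F"
      unfolding F_def
    proof (rule restrict_PiE_iff[THEN iffD2], rule ballI)
      fix e assume "e \<in> D"
      then show "(case e of (l, i) \<Rightarrow> p l i) \<in> (case e of (l, i) \<Rightarrow> {1..2 ^ l})"
        using mem by (cases e) simp
    qed
    moreover have "p l i = (if (l, i) \<in> D then restrict (\<lambda>(l, i). p l i) D (l, i) else 0)" for l i
      by (simp add: zero)
    then have "p = (\<lambda>l i. if (l, i) \<in> D then restrict (\<lambda>(l, i). p l i) D (l, i) else 0)" by blast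
    ultimately show "p \<in> (\<lambda>f l i. if (l, i) \<in> D then f (l, i) else 0) ` F" by blast
  qed
  ultimately show ?thesis by (rule finite_surj)
qed

text \<open>Since all particles of a generation have the same variance, sums and differences are orthogonal.\<close>

lemma gram_norms:
  assumes "genealogy m p" "i \<in> {1..2 ^ m}" "j \<in> {1..2 ^ m}"
  shows "(\<Sum>e\<in>noise_index m. (coef \<rho> p m i e + coef \<rho> p m j e)\<^sup>2) = 2 * sq_norm_coef \<rho> m + 2 * gram \<rho> p m i j"
    and "(\<Sum>e\<in>noise_index m. (coef \<rho> p m j e - coef \<rho> p m i e)\<^sup>2) = 2 * sq_norm_coef \<rho> m - 2 * gram \<rho> p m i j"
    and "(\<Sum>e\<in>noise_index m. (coef \<rho> p m i e + coef \<rho> p m j e) * (coef \<rho> p m j e - coef \<rho> p m i e)) = 0"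
proof -
  define A where "A f g = (\<Sum>e\<in>noise_index m. f e * g e :: real)" for f g
  have ii: "A (coef \<rho> p m i) (coef \<rho> p m i) = sq_norm_coef \<rho> m"
    and jj: "A (coef \<rho> p m j) (coef \<rho> p m j) = sq_norm_coef \<rho> m"
    and ij: "A (coef \<rho> p m i) (coef \<rho> p m j) = gram \<rho> p m i j"
    using gram_self[OF assms(1,2), of \<rho>] gram_self[OF assms(1,3), of \<rho>] by (simp_all add: A_def gram_def)
  have "(\<Sum>e\<in>noise_index m. (coef \<rho> p m i e + coef \<rho> p m j e)\<^sup>2)
     = A (coef \<rho> p m i) (coef \<rho> p m i) + A (coef \<rho> p m j) (coef \<rho> p m j) + 2 * A (coef \<rho> p m i) (coef \<rho> p m j)"
    unfolding A_def sum_distrib_left sum.distrib[symmetric]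
    by (rule sum.cong) (simp_all add: power2_eq_square algebra_simps)
  then show "(\<Sum>e\<in>noise_index m. (coef \<rho> p m i e + coef \<rho> p m j e)\<^sup>2) = 2 * sq_norm_coef \<rho> m + 2 * gram \<rho> p m i j"
    by (simp add: ii jj ij)
  have "(\<Sum>e\<in>noise_index m. (coef \<rho> p m j e - coef \<rho> p m i e)\<^sup>2)
     = A (coef \<rho> p m i) (coef \<rho> p m i) + A (coef \<rho> p m j) (coef \<rho> p m j) - 2 * A (coef \<rho> p m i) (coef \<rho> p m j)"
    unfolding A_def sum_distrib_left sum.distrib[symmetric] sum_subtractf[symmetric]
    by (rule sum.cong) (simp_all add: power2_eq_square algebra_simps)
  then show "(\<Sum>e\<in>noise_index m. (coef \<rho> p m j e - coef \<rho> p m i e)\<^sup>2) = 2 * sq_norm_coef \<rho> m - 2 * gram \<rho> p m i j"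
    by (simp add: ii jj ij)
  have "(\<Sum>e\<in>noise_index m. (coef \<rho> p m i e + coef \<rho> p m j e) * (coef \<rho> p m j e - coef \<rho> p m i e))
     = A (coef \<rho> p m j) (coef \<rho> p m j) - A (coef \<rho> p m i) (coef \<rho> p m i)"
    unfolding A_def sum_subtractf[symmetric]
    by (rule sum.cong) (simp_all add: algebra_simps)
  then show "(\<Sum>e\<in>noise_index m. (coef \<rho> p m i e + coef \<rho> p m j e) * (coef \<rho> p m j e - coef \<rho> p m i e)) = 0"
    by (simp add: ii jj)
qed

text \<open>The case \<open>X = X'\<close>, in which the difference vanishes.\<close>

lemma measure_bigauss_equal:
  fixes B :: "'a::euclidean_space set"
  assumes [measurable]: "B \<in> sets borel"
  shows "measure (bigauss (2 * t) 0) (sum_diff_event B) = measure (gauss t) B"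
proof -
  interpret g: prob_space "gauss t :: 'a measure" by (rule prob_space_gauss)
  interpret bg: prob_space "bigauss (2 * t) 0 :: ('a \<times> 'a) measure" by (rule prob_space_bigauss)
  have E: "sum_diff_event B \<in> sets borel" by measurable
  have "emeasure (bigauss (2 * t) 0) (sum_diff_event B)
    = (\<integral>\<^sup>+x. \<integral>\<^sup>+y. indicator B (t *\<^sub>R x) \<partial>(std_gauss :: 'a measure) \<partial>std_gauss)"
    unfolding emeasure_bigauss[OF E]
    by (auto intro!: nn_integral_cong simp: sum_diff_event_def indicator_def)
  also have "\<dots> = (\<integral>\<^sup>+x. indicator B x \<partial>(gauss t :: 'a measure))"
    by (subst nn_integral_gauss) (auto simp: std_gauss.emeasure_space_1[simplified])
  finally have "emeasure (bigauss (2 * t) 0) (sum_diff_event B) = emeasure (gauss t) B" by simp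
  then show ?thesis by (simp add: bg.emeasure_eq_measure g.emeasure_eq_measure)
qed

section \<open>The law of the relative system\<close>

context interacting_branching_diffusion
begin

definition decay :: real where "decay = exp (- (\<gamma> + b))"

text \<open>The standard deviation of the Gaussian integral of \<open>e\<^bsup>-c(1-s)\<^esup>\<close> against a Brownian motion over unit time, for
  \<open>c = \<gamma> + b\<close>; the limit of \<open>noise_sd c\<close>.\<close>

definition limit_sd :: real where "limit_sd = sqrt ((1 - exp (- 2 * (\<gamma> + b))) / (2 * (\<gamma> + b)))"

lemma limit_sd_pos: "0 < \<gamma> + b \<Longrightarrow> 0 < limit_sd"
  unfolding limit_sd_def by (intro real_sqrt_gt_zero divide_pos_pos) auto

text \<open>Relative positions computed from the discretised, normalised noise along the random genealogy.\<close>

definition approx :: "nat \<Rightarrow> nat \<Rightarrow> nat \<Rightarrow> 'w \<Rightarrow> real ^ 'd" where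
  "approx n m i \<omega> = (\<Sum>e\<in>noise_index m. coef decay (\<lambda>l k. parent l k \<omega>) m i e *\<^sub>R unit_noise n e \<omega>)"

text \<open>Approximations and positions satisfy the same recursion along the genealogy, up to the error of the
  Riemann sums in each generation, which tends to 0.\<close>

lemma approx_limit:
  assumes c: "0 < \<gamma> + b"
  shows "AE \<omega> in M. \<forall>m. \<forall>i\<in>{1..2 ^ m}.
    (\<lambda>n. approx n m i \<omega>) \<longlonglongrightarrow> (1 / limit_sd) *\<^sub>R relative_system Z i (real m) \<omega>"
  using relative_system_increment AE_space
proof eventually_elim
  case (elim \<omega>)
  have "\<forall>i\<in>{1..2 ^ m}. (\<lambda>n. approx n m i \<omega>) \<longlonglongrightarrow> (1 / limit_sd) *\<^sub>R relative_system Z i (real m) \<omega>" for m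
  proof (induction m)
    case 0
    show ?case
      by (simp add: approx_def noise_index_def relative_system_def center_of_mass_def particles_def)
  next
    case (Suc m)
    show ?case
    proof
      fix i :: nat assume i: "i \<in> {1..2 ^ Suc m}"
      define k where "k = parent m i \<omega>"
      have k: "k \<in> {1..2 ^ m}" unfolding k_def by (rule parent_in[OF i elim(2)])
      define d where "d n = noise n (m, k) \<omega> - (1 / 2 ^ m) *\<^sub>R (\<Sum>q\<in>{1..2 ^ m}. noise n (m, q) \<omega>)" for n
      have d: "d \<longlonglongrightarrow> relative_system Z i (real (Suc m)) \<omega> - decay *\<^sub>R relative_system Z k (real m) \<omega>"
        unfolding d_def k_def decay_def using elim(1) i by blast
      have step: "approx n (Suc m) i \<omega> = decay *\<^sub>R approx n m k \<omega> + (1 / noise_sd (\<gamma> + b) n) *\<^sub>R d n" for n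
      proof -
        have "(1 / noise_sd (\<gamma> + b) n) *\<^sub>R d n
          = unit_noise n (m, k) \<omega> - (1 / 2 ^ m) *\<^sub>R (\<Sum>q\<in>{1..2 ^ m}. unit_noise n (m, q) \<omega>)"
          unfolding d_def unit_noise_def scaleR_sum_right scaleR_diff_right
          by (simp add: scaleR_sum_right mult.commute)
        then show ?thesis
          unfolding approx_def using k unfolding k_def by (subst combination_Suc) simp_all
      qed
      have "(\<lambda>n. decay *\<^sub>R approx n m k \<omega> + (1 / noise_sd (\<gamma> + b) n) *\<^sub>R d n) \<longlonglongrightarrow>
         decay *\<^sub>R ((1 / limit_sd) *\<^sub>R relative_system Z k (real m) \<omega>)
         + (1 / limit_sd) *\<^sub>R (relative_system Z i (real (Suc m)) \<omega> - decay *\<^sub>R relative_system Z k (real m) \<omega>)"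
        using Suc.IH k limit_sd_pos[OF c] noise_sd_limit[OF c]
        by (intro tendsto_intros d) (auto simp: limit_sd_def)
      then show "(\<lambda>n. approx n (Suc m) i \<omega>) \<longlonglongrightarrow> (1 / limit_sd) *\<^sub>R relative_system Z i (real (Suc m)) \<omega>"
        unfolding step by (simp add: scaleR_diff_right mult.commute)
    qed
  qed
  then show ?case by blast
qed

definition table_event :: "nat \<Rightarrow> (nat \<Rightarrow> nat \<Rightarrow> nat) \<Rightarrow> 'w set" where
  "table_event m p = {\<omega> \<in> space M. \<forall>l\<in>{..<m}. \<forall>i\<in>{1..2 ^ Suc l}. parent l i \<omega> = p l i}"

lemma table_event_generated:
  "table_event m p \<in> generated_events M (count_space UNIV) {parent m i | m i. i \<in> {1..2 ^ Suc m}}"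
proof -
  let ?G = "generated_algebra M (count_space UNIV) {parent m i | m i. i \<in> {1..2 ^ Suc m}}"
  have *: "parent l i \<in> ?G \<rightarrow>\<^sub>M count_space UNIV" if "i \<in> {1..2 ^ Suc l}" for l i
    by (rule measurable_generated_algebra) (use that in auto)
  have "Measurable.pred ?G (\<lambda>\<omega>. \<forall>l\<in>{..<m}. \<forall>i\<in>{1..2 ^ Suc l}. parent l i \<omega> = p l i)"
  proof (intro pred_intros_finite)
    fix l i :: nat assume "i \<in> {1..2 ^ Suc l}"
    note [measurable] = *[OF this]
    show "Measurable.pred ?G (\<lambda>\<omega>. parent l i \<omega> = p l i)" by measurable
  qed auto
  then have "{\<omega> \<in> space ?G. \<forall>l\<in>{..<m}. \<forall>i\<in>{1..2 ^ Suc l}. parent l i \<omega> = p l i} \<in> sets ?G"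
    by (rule predE)
  then show ?thesis by (simp add: table_event_def sets_generated_algebra)
qed

lemma table_event_measurable [measurable]: "table_event m p \<in> events"
  using table_event_generated indep_setD_ev1[OF labels_indep_motion] by blast

lemma disjoint_table_events: "disjoint_family_on (table_event m) (tables m)"
  unfolding disjoint_family_on_def
proof (intro ballI impI, rule ccontr)
  fix p p' assume p: "p \<in> tables m" "p' \<in> tables m" "p \<noteq> p'"
    and "table_event m p \<inter> table_event m p' \<noteq> {}"
  then obtain \<omega> where \<omega>: "\<omega> \<in> table_event m p" "\<omega> \<in> table_event m p'" by blast
  have "p l i = p' l i" for l i
  proof (cases "l < m \<and> i \<in> {1..2 ^ Suc l}")
    case True
    then have "parent l i \<omega> = p l i" "parent l i \<omega> = p' l i" using \<omega> unfolding table_event_def by blast+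
    then show ?thesis by simp
  next
    case False
    then have "p l i = 0" "p' l i = 0" using p unfolding tables_def by blast+
    then show ?thesis by simp
  qed
  then have "p = p'" by blast
  then show False using p(3) by contradiction
qed

lemma Union_table_events: "(\<Union>p\<in>tables m. table_event m p) = space M"
proof
  show "(\<Union>p\<in>tables m. table_event m p) \<subseteq> space M" by (auto simp: table_event_def)
  show "space M \<subseteq> (\<Union>p\<in>tables m. table_event m p)"
  proof
    fix \<omega> assume \<omega>: "\<omega> \<in> space M"
    define p where "p l i = (if l < m \<and> i \<in> {1..2 ^ Suc l} then parent l i \<omega> else 0)" for l i
    have "genealogy m p"
      unfolding genealogy_def
    proof (intro allI impI conjI ballI)
      fix l i :: nat assume "l < m" "i \<in> {1..2 ^ Suc l}"
      then show "p l i \<in> {1..2 ^ l}" unfolding p_def using parent_in[of i l \<omega>] \<omega> by presburger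
    next
      fix l j :: nat assume "l < m" "j \<in> {1..2 ^ l}"
      moreover from this have "{i \<in> {1..2 ^ Suc l}. p l i = j} = {i \<in> {1..2 ^ Suc l}. parent l i \<omega> = j}"
        by (auto simp: p_def)
      ultimately show "card {i \<in> {1..2 ^ Suc l}. p l i = j} = 2"
        using two_offspring[of j l \<omega>] \<omega> by presburger
    qed
    then have "p \<in> tables m" by (auto simp: tables_def p_def)
    moreover have "\<omega> \<in> table_event m p" using \<omega> by (auto simp: table_event_def p_def)
    ultimately show "\<omega> \<in> (\<Union>p\<in>tables m. table_event m p)" by blast
  qed
qed

lemma prob_eq_sum_tables:
  assumes [measurable]: "F \<in> events"
  shows "prob F = (\<Sum>p\<in>tables m. prob (table_event m p \<inter> F))"
proof -
  have "F = (\<Union>p\<in>tables m. table_event m p \<inter> F)"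
    using Union_table_events[of m] sets.sets_into_space[OF assms] by blast
  then have "prob F = prob (\<Union>p\<in>tables m. table_event m p \<inter> F)" by simp
  also have "\<dots> = (\<Sum>p\<in>tables m. prob (table_event m p \<inter> F))"
    using disjoint_table_events[of m] by (intro finite_measure_finite_Union finite_tables) (auto simp: disjoint_family_on_def)
  finally show ?thesis .
qed

lemma sum_prob_tables: "(\<Sum>p\<in>tables m. prob (table_event m p)) = 1"
  using prob_eq_sum_tables[of "space M" m] sets.sets_into_space[OF table_event_measurable]
  by (simp add: prob_space Int_absorb2)

lemma relative_system_measurable [measurable]:
  assumes "i \<in> {1..2 ^ m}"
  shows "random_variable borel (relative_system Z i (real m))"
proof -
  have part: "particles (real m) = {1..2 ^ m}" by (simp add: particles_def)
  have [measurable]: "random_variable borel (Z q (real m))" if "q \<in> {1..2 ^ m}" for q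
    by (rule Z_measurable) (use that part in auto)
  note [measurable] = this[OF assms]
  show ?thesis unfolding relative_system_def[abs_def] center_of_mass_def part by measurable
qed

text \<open>Given the genealogy, the approximations are linear combinations of independent standard vectors,
  because the labels are independent of the motion. Their sums and differences have the stated law
  for every \<open>n\<close>, and so do their almost sure limits.\<close>

lemma sum_difference_law:
  assumes c: "0 < \<gamma> + b" and p: "genealogy m p" and pos: "0 < prob (table_event m p)"
    and i: "i \<in> {1..2 ^ m}" and j: "j \<in> {1..2 ^ m}"
  shows "distr (uniform_measure M (table_event m p)) borel
      (\<lambda>\<omega>. ((1 / limit_sd) *\<^sub>R (relative_system Z i (real m) \<omega> + relative_system Z j (real m) \<omega>),
            (1 / limit_sd) *\<^sub>R (relative_system Z j (real m) \<omega> - relative_system Z i (real m) \<omega>)))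
    = bigauss (sqrt (2 * sq_norm_coef decay m + 2 * gram decay p m i j))
              (sqrt (2 * sq_norm_coef decay m - 2 * gram decay p m i j))"
    (is "distr ?U borel ?L = ?N")
proof -
  define E where "E = table_event m p"
  have E [measurable]: "E \<in> events" by (simp add: E_def)
  have Epos: "emeasure M E \<noteq> 0" using pos by (simp add: E_def emeasure_eq_measure)
  interpret U: prob_space ?U
    using Epos by (intro prob_space_uniform_measure) (auto simp: E_def)
  define a where "a = coef decay p m i"
  define d where "d = coef decay p m j"
  define X where "X n \<omega> = (\<Sum>e\<in>noise_index m. (a e + d e) *\<^sub>R unit_noise n e \<omega>, \<Sum>e\<in>noise_index m. (d e - a e) *\<^sub>R unit_noise n e \<omega>)" for n \<omega>
  have XM [measurable]: "X n \<in> M \<rightarrow>\<^sub>M borel" for n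
    unfolding X_def[abs_def] borel_prod[symmetric] by measurable
  let ?G = "generated_algebra M borel {W m i t | m i t. i \<in> {1..2 ^ m} \<and> t \<in> {real m..<real m + 1}}"
  have XG: "X n \<in> ?G \<rightarrow>\<^sub>M borel" for n
  proof -
    have [measurable]: "unit_noise n e \<in> borel_measurable ?G" if "e \<in> noise_index m" for e
    proof (rule unit_noise_measurable_generated)
      fix t assume "t \<in> {real (fst e)..<real (fst e) + 1}"
      then show "W (fst e) (snd e) t \<in> {W m i t | m i t. i \<in> {1..2 ^ m} \<and> t \<in> {real m..<real m + 1}}"
        using that by (intro CollectI exI[of _ "fst e"] exI[of _ "snd e"] exI[of _ t]) (auto simp: noise_index_def)
    qed
    show ?thesis unfolding X_def[abs_def] borel_prod[symmetric] by measurable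
  qed
  have lawM: "distr M borel (X n) = ?N" for n
    unfolding X_def[abs_def] a_def d_def
    using orthogonal_combinations_law[OF finite_noise_index indep_vars_unit_noise distr_unit_noise gram_norms(3)[OF p i j]]
    by (simp only: gram_norms[OF p i j])
  have law: "distr ?U borel (X n) = ?N" for n
    unfolding lawM[of n, symmetric]
  proof (rule measure_eqI)
    fix A assume "A \<in> sets (distr ?U borel (X n))"
    then have A [measurable]: "A \<in> sets borel" by simp
    define F where "F = X n -` A \<inter> space M"
    have F [measurable]: "F \<in> events" unfolding F_def by measurable
    have "F \<in> sets ?G" using measurable_sets[OF XG A, of n] by (simp add: F_def)
    then have "prob (E \<inter> F) = prob E * prob F"
      unfolding E_def sets_generated_algebra
      by (intro indep_setD[OF labels_indep_motion] table_event_generated)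
    then have "emeasure ?U F = emeasure M F"
      using pos E F by (simp add: E_def[symmetric] emeasure_uniform_measure emeasure_eq_measure divide_ennreal)
    then show "emeasure (distr ?U borel (X n)) A = emeasure (distr M borel (X n)) A"
      by (simp add: emeasure_distr F_def)
  qed simp
  have LM: "?L \<in> M \<rightarrow>\<^sub>M borel"
    using i j unfolding borel_prod[symmetric] by measurable
  have lim: "AE \<omega> in ?U. (\<lambda>n. X n \<omega>) \<longlonglongrightarrow> ?L \<omega>"
  proof (rule AE_uniform_measureI)
    show "AE \<omega> in M. \<omega> \<in> table_event m p \<longrightarrow> (\<lambda>n. X n \<omega>) \<longlonglongrightarrow> ?L \<omega>"
      using approx_limit[OF c]
    proof eventually_elim
      case (elim \<omega>)
      show ?case
      proof
        assume \<omega>: "\<omega> \<in> table_event m p"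
        have "coef decay p m k e = coef decay (\<lambda>l k. parent l k \<omega>) m k e" if "k \<in> {1..2 ^ m}" for k e
        proof (rule coef_cong[OF _ p that])
          show "p l i = parent l i \<omega>" if "l < m" "i \<in> {1..2 ^ Suc l}" for l i
            using \<omega> that unfolding table_event_def by auto
        qed
        then have "X n \<omega> = (approx n m i \<omega> + approx n m j \<omega>, approx n m j \<omega> - approx n m i \<omega>)" for n
          using i j by (simp add: X_def a_def d_def approx_def scaleR_add_left scaleR_diff_left sum.distrib sum_subtractf)
        then show "(\<lambda>n. X n \<omega>) \<longlonglongrightarrow> ?L \<omega>"
          unfolding scaleR_add_right scaleR_diff_right using elim i j by (auto intro!: tendsto_intros)
      qed
    qed
  qed measurable
  show ?thesis
    by (rule U.distr_AE_limit[OF _ _ law lim]) (use XM LM in simp_all)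
qed

text \<open>The law given the genealogy, evaluated on the event that both positions lie in \<open>B\<close>.\<close>

lemma prob_pair:
  assumes c: "0 < \<gamma> + b" and p: "genealogy m p" and i: "i \<in> {1..2 ^ m}" and j: "j \<in> {1..2 ^ m}"
    and B [measurable]: "B \<in> sets borel"
  shows "prob (table_event m p \<inter> {\<omega> \<in> space M. relative_system Z i (real m) \<omega> \<in> B \<and> relative_system Z j (real m) \<omega> \<in> B})
    = prob (table_event m p) * measure (bigauss (sqrt (2 * sq_norm_coef decay m + 2 * gram decay p m i j))
              (sqrt (2 * sq_norm_coef decay m - 2 * gram decay p m i j))) (sum_diff_event {x. limit_sd *\<^sub>R x \<in> B})"
proof (cases "prob (table_event m p) = 0")
  case True
  have "prob (table_event m p \<inter> {\<omega> \<in> space M. relative_system Z i (real m) \<omega> \<in> B \<and> relative_system Z j (real m) \<omega> \<in> B})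
     \<le> prob (table_event m p)"
    by (intro finite_measure_mono) auto
  then show ?thesis using True by (simp add: measure_le_0_iff)
next
  case False
  then have pos: "0 < prob (table_event m p)" by (simp add: zero_less_measure_iff)
  define B' where "B' = {x. limit_sd *\<^sub>R x \<in> B}"
  have "{x \<in> space borel. limit_sd *\<^sub>R x \<in> B} \<in> sets borel" by measurable
  then have B' [measurable]: "B' \<in> sets borel" by (simp add: B'_def)
  have sB: "sum_diff_event B' \<in> sets borel" by measurable
  note [measurable] = relative_system_measurable[OF i] relative_system_measurable[OF j]
  define F where "F = {\<omega> \<in> space M. relative_system Z i (real m) \<omega> \<in> B \<and> relative_system Z j (real m) \<omega> \<in> B}"
  have F [measurable]: "F \<in> events" unfolding F_def by measurable
  let ?U = "uniform_measure M (table_event m p)"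
  let ?L = "\<lambda>\<omega>. ((1 / limit_sd) *\<^sub>R (relative_system Z i (real m) \<omega> + relative_system Z j (real m) \<omega>),
            (1 / limit_sd) *\<^sub>R (relative_system Z j (real m) \<omega> - relative_system Z i (real m) \<omega>))"
  have LM [measurable]: "?L \<in> M \<rightarrow>\<^sub>M borel"
    unfolding borel_prod[symmetric] by measurable
  have half: "(1 / 2) *\<^sub>R ((1 / limit_sd) *\<^sub>R (x + y) - (1 / limit_sd) *\<^sub>R (y - x)) = (1 / limit_sd) *\<^sub>R x"
    "(1 / 2) *\<^sub>R ((1 / limit_sd) *\<^sub>R (x + y) + (1 / limit_sd) *\<^sub>R (y - x)) = (1 / limit_sd) *\<^sub>R y" for x y :: "real ^ 'd"
  proof -
    have "(1 / limit_sd) *\<^sub>R (x + y) - (1 / limit_sd) *\<^sub>R (y - x) = 2 *\<^sub>R ((1 / limit_sd) *\<^sub>R x)"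
      "(1 / limit_sd) *\<^sub>R (x + y) + (1 / limit_sd) *\<^sub>R (y - x) = 2 *\<^sub>R ((1 / limit_sd) *\<^sub>R y)"
      unfolding scaleR_2 by (simp_all add: scaleR_add_right scaleR_diff_right)
    then show "(1 / 2) *\<^sub>R ((1 / limit_sd) *\<^sub>R (x + y) - (1 / limit_sd) *\<^sub>R (y - x)) = (1 / limit_sd) *\<^sub>R x"
      "(1 / 2) *\<^sub>R ((1 / limit_sd) *\<^sub>R (x + y) + (1 / limit_sd) *\<^sub>R (y - x)) = (1 / limit_sd) *\<^sub>R y"
      by simp_all
  qed
  have "?L \<omega> \<in> sum_diff_event B' \<longleftrightarrow> relative_system Z i (real m) \<omega> \<in> B \<and> relative_system Z j (real m) \<omega> \<in> B" for \<omega>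
    unfolding sum_diff_event_def B'_def mem_Collect_eq prod.case half using limit_sd_pos[OF c] by simp
  then have L: "?L -` sum_diff_event B' \<inter> space M = F" unfolding F_def by blast
  have "measure (distr ?U borel ?L) (sum_diff_event B') = measure ?U F"
    using sB by (subst measure_distr) (auto simp: L)
  also have "\<dots> = prob (table_event m p \<inter> F) / prob (table_event m p)"
    using pos by (intro measure_uniform_measure) (auto simp: emeasure_eq_measure)
  finally show ?thesis
    unfolding sum_difference_law[OF c p pos i j] using pos by (simp add: F_def B'_def field_simps)
qed

text \<open>The common law of the relative positions in generation \<open>m\<close>, which is \<open>N(0, limit_sd\<^sup>2 sq_norm_coef I)\<close>.\<close>

definition rescaled_law :: "nat \<Rightarrow> (real ^ 'd) set \<Rightarrow> real" where
  "rescaled_law m B = measure (gauss (sqrt (sq_norm_coef decay m))) {x. limit_sd *\<^sub>R x \<in> B}"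

lemma rescaled_measurable:
  assumes "B \<in> sets borel"
  shows "{x :: real ^ 'd. limit_sd *\<^sub>R x \<in> B} \<in> sets borel"
proof -
  have "{x \<in> space borel. limit_sd *\<^sub>R x \<in> B} \<in> sets borel" using assms by measurable
  then show ?thesis by simp
qed

text \<open>The variance of a single position is the same for all labels and all genealogies.\<close>

lemma prob_single:
  assumes c: "0 < \<gamma> + b" and i: "i \<in> {1..2 ^ m}" and B: "B \<in> sets borel"
  shows "prob {\<omega> \<in> space M. relative_system Z i (real m) \<omega> \<in> B} = rescaled_law m B"
proof -
  note [measurable] = relative_system_measurable[OF i] B
  have s: "sqrt (4 * sq_norm_coef decay m) = 2 * sqrt (sq_norm_coef decay m)"
    by (simp add: real_sqrt_mult)
  have "prob {\<omega> \<in> space M. relative_system Z i (real m) \<omega> \<in> B}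
    = (\<Sum>p\<in>tables m. prob (table_event m p \<inter> {\<omega> \<in> space M. relative_system Z i (real m) \<omega> \<in> B}))"
    by (rule prob_eq_sum_tables) measurable
  also have "\<dots> = (\<Sum>p\<in>tables m. prob (table_event m p) * rescaled_law m B)"
  proof (rule sum.cong[OF refl])
    fix p assume "p \<in> tables m"
    then have p: "genealogy m p" by (simp add: tables_def)
    show "prob (table_event m p \<inter> {\<omega> \<in> space M. relative_system Z i (real m) \<omega> \<in> B}) = prob (table_event m p) * rescaled_law m B"
      using prob_pair[OF c p i i B]
      by (simp add: gram_self[OF p i] s measure_bigauss_equal rescaled_measurable[OF B] rescaled_law_def)
  qed
  also have "\<dots> = rescaled_law m B"
    by (simp add: sum_distrib_right[symmetric] sum_prob_tables)
  finally show ?thesis .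
qed

section \<open>The law of large numbers\<close>

text \<open>Given the genealogy, each covariance of indicators is at most a multiple of the covariance of the
  positions; averaging over genealogies keeps the bound, since it holds for each of them.\<close>

lemma sum_covariance_le:
  assumes c: "0 < \<gamma> + b" and m: "2 \<le> m" and B: "B \<in> sets borel"
  shows "(\<Sum>i\<in>{1..2 ^ m}. \<Sum>j\<in>{1..2 ^ m}.
      \<bar>prob {\<omega> \<in> space M. relative_system Z i (real m) \<omega> \<in> B \<and> relative_system Z j (real m) \<omega> \<in> B} - (rescaled_law m B)\<^sup>2\<bar>)
    \<le> 4 ^ m * (4 * real CARD('d) * gram_bound decay m)"
proof -
  define s where "s = sq_norm_coef decay m"
  define q where "q = rescaled_law m B"
  have s: "1 / 2 \<le> s" unfolding s_def by (rule sq_norm_coef_ge_half[OF m])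
  define d where "d = real CARD('d)"
  define P where "P p = prob (table_event m p)" for p
  have P0: "0 \<le> P p" for p by (simp add: P_def)
  have P1: "(\<Sum>p\<in>tables m. P p) = 1" unfolding P_def by (rule sum_prob_tables)
  have pair: "\<bar>prob {\<omega> \<in> space M. relative_system Z i (real m) \<omega> \<in> B \<and> relative_system Z j (real m) \<omega> \<in> B} - q\<^sup>2\<bar>
     \<le> (\<Sum>p\<in>tables m. P p * (4 * d * \<bar>gram decay p m i j\<bar>))"
    if i: "i \<in> {1..2 ^ m}" and j: "j \<in> {1..2 ^ m}" for i j
  proof -
    note [measurable] = relative_system_measurable[OF i] relative_system_measurable[OF j] B
    define J where "J p = measure (bigauss (sqrt (2 * s + 2 * gram decay p m i j))
              (sqrt (2 * s - 2 * gram decay p m i j))) (sum_diff_event {x :: real ^ 'd. limit_sd *\<^sub>R x \<in> B})" for p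
    have "prob {\<omega> \<in> space M. relative_system Z i (real m) \<omega> \<in> B \<and> relative_system Z j (real m) \<omega> \<in> B}
       = (\<Sum>p\<in>tables m. P p * J p)"
      by (subst prob_eq_sum_tables[of _ m], measurable)
         (auto intro!: sum.cong simp: P_def J_def s_def tables_def prob_pair[OF c _ i j B])
    moreover have "q\<^sup>2 = (\<Sum>p\<in>tables m. P p * q\<^sup>2)" by (simp add: sum_distrib_right[symmetric] P1)
    ultimately have "\<bar>prob {\<omega> \<in> space M. relative_system Z i (real m) \<omega> \<in> B \<and> relative_system Z j (real m) \<omega> \<in> B} - q\<^sup>2\<bar>
       = \<bar>\<Sum>p\<in>tables m. P p * (J p - q\<^sup>2)\<bar>"
      by (simp add: sum_subtractf right_diff_distrib)
    also have "\<dots> \<le> (\<Sum>p\<in>tables m. \<bar>P p * (J p - q\<^sup>2)\<bar>)" by (rule sum_abs)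
    also have "\<dots> \<le> (\<Sum>p\<in>tables m. P p * (4 * d * \<bar>gram decay p m i j\<bar>))"
    proof (rule sum_mono)
      fix p assume "p \<in> tables m"
      then have p: "genealogy m p" by (simp add: tables_def)
      have a: "0 \<le> 2 * s + 2 * gram decay p m i j" "0 \<le> 2 * s - 2 * gram decay p m i j"
        unfolding s_def gram_norms(1,2)[OF p i j, symmetric] by (simp_all add: sum_nonneg)
      have "\<bar>J p - q\<^sup>2\<bar> \<le> 2 * real DIM(real ^ 'd) * \<bar>gram decay p m i j\<bar> / (sqrt s)\<^sup>2"
        unfolding J_def q_def rescaled_law_def s_def[symmetric]
        by (rule gauss_pair_covariance_bound) (use a s rescaled_measurable[OF B] in auto)
      also have "\<dots> = (2 * d * \<bar>gram decay p m i j\<bar>) / s" using s by (simp add: d_def)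
      also have "\<dots> \<le> (2 * d * \<bar>gram decay p m i j\<bar>) / (1 / 2)"
        using s by (intro divide_left_mono) (auto simp: d_def)
      finally have "\<bar>J p - q\<^sup>2\<bar> \<le> 4 * d * \<bar>gram decay p m i j\<bar>" by simp
      then show "\<bar>P p * (J p - q\<^sup>2)\<bar> \<le> P p * (4 * d * \<bar>gram decay p m i j\<bar>)"
        using P0[of p] by (simp add: abs_mult mult_left_mono)
    qed
    finally show ?thesis .
  qed
  have "(\<Sum>i\<in>{1..2 ^ m}. \<Sum>j\<in>{1..2 ^ m}.
      \<bar>prob {\<omega> \<in> space M. relative_system Z i (real m) \<omega> \<in> B \<and> relative_system Z j (real m) \<omega> \<in> B} - q\<^sup>2\<bar>)
    \<le> (\<Sum>i\<in>{1..2 ^ m}. \<Sum>j\<in>{1..2 ^ m}. \<Sum>p\<in>tables m. P p * (4 * d * \<bar>gram decay p m i j\<bar>))"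
    by (intro sum_mono pair)
  also have "\<dots> = (\<Sum>i\<in>{1..2 ^ m}. \<Sum>p\<in>tables m. \<Sum>j\<in>{1..2 ^ m}. P p * (4 * d * \<bar>gram decay p m i j\<bar>))"
    by (intro sum.cong[OF refl] sum.swap)
  also have "\<dots> = (\<Sum>p\<in>tables m. \<Sum>i\<in>{1..2 ^ m}. \<Sum>j\<in>{1..2 ^ m}. P p * (4 * d * \<bar>gram decay p m i j\<bar>))"
    by (rule sum.swap)
  also have "\<dots> = (\<Sum>p\<in>tables m. P p * (4 * d * (\<Sum>i\<in>{1..2 ^ m}. \<Sum>j\<in>{1..2 ^ m}. \<bar>gram decay p m i j\<bar>)))"
    by (simp only: sum_distrib_left)
  also have "\<dots> \<le> (\<Sum>p\<in>tables m. P p * (4 * d * (4 ^ m * gram_bound decay m)))"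
    by (intro sum_mono mult_left_mono sum_gram_le P0) (auto simp: tables_def d_def)
  also have "\<dots> = 4 ^ m * (4 * d * gram_bound decay m)"
    unfolding sum_distrib_right[symmetric] P1 by simp
  finally show ?thesis unfolding q_def d_def .
qed

lemma mean_square_deviation_le:
  assumes c: "0 < \<gamma> + b" and m: "2 \<le> m" and B: "B \<in> sets borel"
  shows "expectation (\<lambda>\<omega>. ((1 / 2 ^ m) * (\<Sum>i\<in>{1..2 ^ m}. indicator B (relative_system Z i (real m) \<omega>)) - rescaled_law m B)\<^sup>2)
    \<le> 4 * real CARD('d) * gram_bound decay m"
proof -
  define N where "N = (2::real) ^ m"
  have N: "N > 0" "N * N = 4 ^ m" by (simp_all add: N_def power_mult_distrib[symmetric])
  define q where "q = rescaled_law m B"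
  define I where "I = {1..2 ^ m :: nat}"
  have I: "finite I" "real (card I) = N" by (simp_all add: I_def N_def)
  note [measurable] = B
  have [measurable]: "relative_system Z i (real m) \<in> borel_measurable M" if "i \<in> I" for i
    using that unfolding I_def by (rule relative_system_measurable)
  define F where "F i j = {\<omega> \<in> space M. relative_system Z i (real m) \<omega> \<in> B \<and> relative_system Z j (real m) \<omega> \<in> B}" for i j
  have Fm [measurable]: "F i j \<in> events" if "i \<in> I" "j \<in> I" for i j
    using that unfolding F_def by measurable
  have Fii: "prob (F i i) = q" if "i \<in> I" for i
    using prob_single[OF c, of i m B] that B by (simp add: F_def q_def I_def)
  have expand: "((1 / 2 ^ m) * (\<Sum>i\<in>I. indicator B (relative_system Z i (real m) \<omega>)) - q)\<^sup>2
     = (1 / (N * N)) * (\<Sum>i\<in>I. \<Sum>j\<in>I. indicator (F i j) \<omega>) - (2 * q / N) * (\<Sum>i\<in>I. indicator (F i i) \<omega>) + q\<^sup>2"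
    if \<omega>: "\<omega> \<in> space M" for \<omega>
  proof -
    define x where "x i = (indicator B (relative_system Z i (real m) \<omega>) :: real)" for i
    have "x i = indicator (F i i) \<omega>" "x i * x j = indicator (F i j) \<omega>" for i j
      using \<omega> by (auto simp: x_def F_def indicator_def)
    then have "(\<Sum>i\<in>I. \<Sum>j\<in>I. indicator (F i j) \<omega>) = (\<Sum>i\<in>I. x i) * (\<Sum>i\<in>I. x i)"
      "(\<Sum>i\<in>I. indicator (F i i) \<omega>) = (\<Sum>i\<in>I. x i)"
      by (simp_all add: sum_product)
    then show ?thesis unfolding x_def[symmetric] N_def[symmetric] using N(1)
      by (simp add: power2_eq_square field_simps)
  qed
  have "expectation (\<lambda>\<omega>. ((1 / 2 ^ m) * (\<Sum>i\<in>I. indicator B (relative_system Z i (real m) \<omega>)) - q)\<^sup>2)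
    = expectation (\<lambda>\<omega>. (1 / (N * N)) * (\<Sum>i\<in>I. \<Sum>j\<in>I. indicator (F i j) \<omega>) - (2 * q / N) * (\<Sum>i\<in>I. indicator (F i i) \<omega>) + q\<^sup>2)"
    unfolding I_def[symmetric] by (intro Bochner_Integration.integral_cong refl expand)
  also have "\<dots> = (1 / (N * N)) * (\<Sum>i\<in>I. \<Sum>j\<in>I. prob (F i j)) - (2 * q / N) * (\<Sum>i\<in>I. prob (F i i)) + q\<^sup>2"
  proof -
    have int: "integrable M (indicator (F i j) :: 'w \<Rightarrow> real)" if "i \<in> I" "j \<in> I" for i j
      using Fm[OF that] by (simp add: integrable_indicator_iff emeasure_eq_measure)
    have 1: "integrable M (\<lambda>\<omega>. \<Sum>i\<in>I. \<Sum>j\<in>I. indicator (F i j) \<omega> :: real)"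
      by (intro Bochner_Integration.integrable_sum int)
    have 2: "integrable M (\<lambda>\<omega>. \<Sum>i\<in>I. indicator (F i i) \<omega> :: real)"
      by (intro Bochner_Integration.integrable_sum int)
    have ind: "expectation (indicat_real (F i j)) = prob (F i j)" if "i \<in> I" "j \<in> I" for i j
      using Fm[OF that] by (simp add: sets.Int_space_eq2)
    have "expectation (\<lambda>\<omega>. \<Sum>i\<in>I. \<Sum>j\<in>I. indicat_real (F i j) \<omega>) = (\<Sum>i\<in>I. expectation (\<lambda>\<omega>. \<Sum>j\<in>I. indicat_real (F i j) \<omega>))"
      by (intro Bochner_Integration.integral_sum Bochner_Integration.integrable_sum int)
    also have "\<dots> = (\<Sum>i\<in>I. \<Sum>j\<in>I. expectation (indicat_real (F i j)))"
      by (intro sum.cong refl Bochner_Integration.integral_sum int)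
    also have "\<dots> = (\<Sum>i\<in>I. \<Sum>j\<in>I. prob (F i j))" by (intro sum.cong refl ind)
    finally have e1: "expectation (\<lambda>\<omega>. \<Sum>i\<in>I. \<Sum>j\<in>I. indicat_real (F i j) \<omega>) = (\<Sum>i\<in>I. \<Sum>j\<in>I. prob (F i j))" .
    have "expectation (\<lambda>\<omega>. \<Sum>i\<in>I. indicat_real (F i i) \<omega>) = (\<Sum>i\<in>I. expectation (indicat_real (F i i)))"
      by (intro Bochner_Integration.integral_sum int)
    also have "\<dots> = (\<Sum>i\<in>I. prob (F i i))" by (intro sum.cong refl ind)
    finally have e2: "expectation (\<lambda>\<omega>. \<Sum>i\<in>I. indicat_real (F i i) \<omega>) = (\<Sum>i\<in>I. prob (F i i))" .
    show ?thesis
      using 1 2 by (simp add: e1 e2 prob_space)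
  qed
  also have "\<dots> = (1 / (N * N)) * (\<Sum>i\<in>I. \<Sum>j\<in>I. prob (F i j) - q\<^sup>2)"
    using N(1) I by (simp add: Fii sum_subtractf power2_eq_square field_simps)
  also have "\<dots> \<le> (1 / (N * N)) * (\<Sum>i\<in>I. \<Sum>j\<in>I. \<bar>prob (F i j) - q\<^sup>2\<bar>)"
    using N(1) by (intro mult_left_mono sum_mono) auto
  also have "\<dots> \<le> (1 / (N * N)) * (4 ^ m * (4 * real CARD('d) * gram_bound decay m))"
    using sum_covariance_le[OF c m B] N(1) by (intro mult_left_mono) (auto simp: F_def q_def I_def)
  also have "\<dots> = 4 * real CARD('d) * gram_bound decay m" using N by simp
  finally show ?thesis unfolding I_def q_def .
qed

text \<open>The mean square deviations are summable, so the sum of the squared deviations is almost surely finite.\<close>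

lemma law_of_large_numbers:
  assumes c: "0 < \<gamma> + b" and B: "B \<in> sets borel"
  shows "AE \<omega> in M. (\<lambda>m. (1 / 2 ^ m) * (\<Sum>i\<in>{1..2 ^ m}. indicator B (relative_system Z i (real m) \<omega>)) - rescaled_law m B)
    \<longlonglongrightarrow> (0 :: real)"
proof -
  define A where "A m \<omega> = (1 / 2 ^ m) * (\<Sum>i\<in>{1..2 ^ m}. indicator B (relative_system Z i (real m) \<omega>)) - rescaled_law m B" for m \<omega>
  have decay: "decay\<^sup>2 < 1" using c by (simp add: decay_def power_less_one_iff)
  have mA [measurable]: "A m \<in> borel_measurable M" for m
  proof -
    note [measurable] = B
    have [measurable]: "relative_system Z i (real m) \<in> borel_measurable M" if "i \<in> {1..2 ^ m}" for i
      using that by (rule relative_system_measurable)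
    show ?thesis unfolding A_def[abs_def] by measurable
  qed
  have bound: "(A m \<omega>)\<^sup>2 \<le> (1 + \<bar>rescaled_law m B\<bar>)\<^sup>2" for m \<omega>
  proof -
    have "(\<Sum>i\<in>{1..2 ^ m}. indicator B (relative_system Z i (real m) \<omega>) :: real) \<le> (\<Sum>i\<in>{1..2 ^ m :: nat}. 1)"
      by (intro sum_mono) (auto simp: indicator_def)
    then have "(1 / 2 ^ m) * (\<Sum>i\<in>{1..2 ^ m}. indicator B (relative_system Z i (real m) \<omega>) :: real) \<le> 1"
      by (simp add: field_simps)
    moreover have "0 \<le> (1 / 2 ^ m) * (\<Sum>i\<in>{1..2 ^ m}. indicator B (relative_system Z i (real m) \<omega>) :: real)"
      by (intro mult_nonneg_nonneg sum_nonneg) auto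
    ultimately have "\<bar>A m \<omega>\<bar> \<le> 1 + \<bar>rescaled_law m B\<bar>" unfolding A_def by linarith
    then show ?thesis using power_mono[of "\<bar>A m \<omega>\<bar>" "1 + \<bar>rescaled_law m B\<bar>" 2] by simp
  qed
  have int: "integrable M (\<lambda>\<omega>. (A m \<omega>)\<^sup>2)" for m
    by (rule integrable_const_bound[where B="(1 + \<bar>rescaled_law m B\<bar>)\<^sup>2"]) (use bound in auto)
  have "(\<integral>\<^sup>+\<omega>. (\<Sum>m. ennreal ((A (m + 2) \<omega>)\<^sup>2)) \<partial>M) = (\<Sum>m. \<integral>\<^sup>+\<omega>. ennreal ((A (m + 2) \<omega>)\<^sup>2) \<partial>M)"
    by (rule nn_integral_suminf) measurable
  \<comment> \<open>The first two generations, where the positions are degenerate, are skipped.\<close>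
  also have "\<dots> \<le> (\<Sum>m. ennreal (4 * real CARD('d) * gram_bound decay (m + 2)))"
  proof (intro suminf_le summableI)
    fix m
    have "(\<integral>\<^sup>+\<omega>. ennreal ((A (m + 2) \<omega>)\<^sup>2) \<partial>M) = ennreal (expectation (\<lambda>\<omega>. (A (m + 2) \<omega>)\<^sup>2))"
      by (intro nn_integral_eq_integral int) auto
    also have "\<dots> \<le> ennreal (4 * real CARD('d) * gram_bound decay (m + 2))"
      unfolding A_def by (intro ennreal_leI mean_square_deviation_le c B) simp
    finally show "(\<integral>\<^sup>+\<omega>. ennreal ((A (m + 2) \<omega>)\<^sup>2) \<partial>M) \<le> ennreal (4 * real CARD('d) * gram_bound decay (m + 2))" .
  qed
  also have "\<dots> < \<infinity>"
  proof -
    have nn: "0 \<le> 4 * real CARD('d) * gram_bound decay (m + 2)" for m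
      by (intro mult_nonneg_nonneg gram_bound_nonneg) simp_all
    have "summable (\<lambda>m. 4 * real CARD('d) * gram_bound decay (m + 2))"
      by (intro summable_mult summable_ignore_initial_segment summable_gram_bound decay)
    then show ?thesis by (subst suminf_ennreal2[OF nn]) simp_all
  qed
  finally have "AE \<omega> in M. (\<Sum>m. ennreal ((A (m + 2) \<omega>)\<^sup>2)) \<noteq> \<infinity>"
    by (intro nn_integral_PInf_AE) auto
  then have "AE \<omega> in M. (\<lambda>m. A m \<omega>) \<longlonglongrightarrow> 0"
  proof eventually_elim
    case (elim \<omega>)
    then have "summable (\<lambda>m. (A (m + 2) \<omega>)\<^sup>2)"
      by (intro summable_suminf_not_top) auto
    then have "(\<lambda>m. (A (m + 2) \<omega>)\<^sup>2) \<longlonglongrightarrow> 0" by (rule summable_LIMSEQ_zero)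
    then have "(\<lambda>m. sqrt ((A (m + 2) \<omega>)\<^sup>2)) \<longlonglongrightarrow> sqrt 0" by (rule tendsto_real_sqrt)
    then have "(\<lambda>m. A (m + 2) \<omega>) \<longlonglongrightarrow> 0" by (simp add: tendsto_rabs_zero_iff)
    then show ?case by (rule LIMSEQ_offset)
  qed
  then show ?thesis unfolding A_def .
qed

end

theorem corollary6p2:
  fixes M :: "'w measure"
    and b \<gamma> :: real
    and parent :: "nat \<Rightarrow> nat \<Rightarrow> 'w \<Rightarrow> nat"
    and W :: "nat \<Rightarrow> nat \<Rightarrow> real \<Rightarrow> 'w \<Rightarrow> real ^ 'd"
    and Z :: "nat \<Rightarrow> real \<Rightarrow> 'w \<Rightarrow> real ^ 'd"
    and B :: "(real ^ 'd) set"
  assumes "CARD('d) > 1"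
    and "\<gamma> \<noteq> 0"
    and "\<gamma> + b > 0"
    and "interacting_branching_diffusion M b \<gamma> parent W Z"
    and "B \<in> sets borel"
  defines "Y \<equiv> relative_system Z"
  shows "(\<forall>m\<ge>1. \<forall>i\<in>{1..2 ^ m}. \<forall>j\<in>{1..2 ^ m}.
            measure M {\<omega> \<in> space M. Y i (real m) \<omega> \<in> B} =
            measure M {\<omega> \<in> space M. Y j (real m) \<omega> \<in> B}) \<and>
         (\<forall>\<iota> :: nat \<Rightarrow> nat. (\<forall>m\<ge>1. \<iota> m \<in> {1..2 ^ m}) \<longrightarrow>
            (AE \<omega> in M. (\<lambda>m. (1 / 2 ^ m) * (\<Sum>i\<in>{1..2 ^ m}. indicator B (Y i (real m) \<omega>))
               - measure M {\<omega>' \<in> space M. Y (\<iota> m) (real m) \<omega>' \<in> B}) \<longlonglongrightarrow> (0 :: real)))"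
proof -
  interpret interacting_branching_diffusion M b \<gamma> parent W Z by fact
  note single = prob_single[OF assms(3) _ assms(5)]
  have "\<forall>m\<ge>1. \<forall>i\<in>{1..2 ^ m}. \<forall>j\<in>{1..2 ^ m}.
            measure M {\<omega> \<in> space M. Y i (real m) \<omega> \<in> B} =
            measure M {\<omega> \<in> space M. Y j (real m) \<omega> \<in> B}"
    unfolding Y_def by (intro allI impI ballI) (simp only: single)
  moreover have "AE \<omega> in M. (\<lambda>m. (1 / 2 ^ m) * (\<Sum>i\<in>{1..2 ^ m}. indicator B (Y i (real m) \<omega>))
               - measure M {\<omega>' \<in> space M. Y (\<iota> m) (real m) \<omega>' \<in> B}) \<longlonglongrightarrow> (0 :: real)"
    if \<iota>: "\<forall>m\<ge>1. \<iota> m \<in> {1..2 ^ m}" for \<iota> :: "nat \<Rightarrow> nat"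
    using law_of_large_numbers[OF assms(3,5)]
  proof eventually_elim
    case (elim \<omega>)
    show ?case
    proof (rule Lim_transform_eventually[OF elim])
      show "\<forall>\<^sub>F m in sequentially. (1 / 2 ^ m) * (\<Sum>i\<in>{1..2 ^ m}. indicator B (relative_system Z i (real m) \<omega>)) - rescaled_law m B
        = (1 / 2 ^ m) * (\<Sum>i\<in>{1..2 ^ m}. indicator B (Y i (real m) \<omega>))
               - measure M {\<omega>' \<in> space M. Y (\<iota> m) (real m) \<omega>' \<in> B}"
        using eventually_ge_at_top[of 1]
      proof eventually_elim
        case (elim m)
        then show ?case using single[of "\<iota> m" m] \<iota> by (simp add: Y_def)
      qed
    qed
  qed
  ultimately show ?thesis by blast
qed

end
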